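(* Let $M$ be a non-amenable strongly solid type II$_1$ factor. Then no strongly dense C$^\ast$-subalgebra of $M$ has an infinite dimensional regular abelian $\ast$-subalgebra.
   Context: A von Neumann algebra $M$ is strongly solid if for any diffuse amenable von Neumann subalgebra $A$ of $M$, the von Neumann algebra $\mathcal N_M(A)''$ is amenable, where $\mathcal N_M(A)=\{u\in U(M): uAu^\ast=A\}$ and $U(M)$ is the unitary group of $M$. A von Neumann algebra is diffuse if it has no minimal projections. For a (nonzero) $\ast$-subalgebra $C$ of a C$^\ast$-algebra $B$, let $N_B(C)=\{n\in B: nCn^\ast\cup n^\ast Cn\subset C\}$; $C$ is regular in $B$ if $N_B(C)$ generates $B$ as a C$^\ast$-algebra. For the strongly dense C$^\ast$-subalgebras of $M$, regularity of $\ast$-subalgebras is in this C$^\ast$-sense. *)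

theory Defs
  imports "HOL-Analysis.Analysis"
begin

section \<open>Complex Hilbert spaces\<close>

text \<open>The library has real inner product spaces only. A complex one is a real one whose scalar
  multiplication extends to the complex numbers and whose real inner product is the real part of a
  sesquilinear Hermitian form; positive definiteness and the norm are then those of the class
  real\_inner, because the form takes real values on the diagonal.\<close>

class complex_inner = real_inner +
  fixes scaleC :: "complex \<Rightarrow> 'a \<Rightarrow> 'a"  (infixr \<open>*\<^sub>C\<close> 75)
    and cinner :: "'a \<Rightarrow> 'a \<Rightarrow> complex"
  assumes scaleC_add_right: "a *\<^sub>C (x + y) = a *\<^sub>C x + a *\<^sub>C y"
    and scaleC_add_left: "(a + b) *\<^sub>C x = a *\<^sub>C x + b *\<^sub>C x"
    and scaleC_scaleC: "a *\<^sub>C (b *\<^sub>C x) = (a * b) *\<^sub>C x"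
    and scaleC_of_real: "complex_of_real r *\<^sub>C x = r *\<^sub>R x"
    and cinner_add_left: "cinner (x + y) z = cinner x z + cinner y z"
    and cinner_scaleC_left: "cinner (a *\<^sub>C x) y = a * cinner x y"
    and cinner_commute: "cinner y x = cnj (cinner x y)"
    and Re_cinner: "Re (cinner x y) = inner x y"

class chilbert_space = complex_inner + complete_space

lemma norm_scaleC: "norm (a *\<^sub>C x) = cmod a * norm (x::'a::complex_inner)"
proof -
  have diag: "cinner z z = complex_of_real ((norm z)\<^sup>2)" for z :: 'a
  proof (rule complex_eqI)
    show "Re (cinner z z) = Re (complex_of_real ((norm z)\<^sup>2))"
      by (simp add: Re_cinner power2_norm_eq_inner)
    have "Im (cinner z z) = - Im (cinner z z)"
      using arg_cong[OF cinner_commute[of z z], of Im] by simp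
    then show "Im (cinner z z) = Im (complex_of_real ((norm z)\<^sup>2))" by simp
  qed
  have "cinner (a *\<^sub>C x) (a *\<^sub>C x) = a * cnj (a * cinner x x)"
    by (metis cinner_commute cinner_scaleC_left)
  also have "\<dots> = complex_of_real ((cmod a * norm x)\<^sup>2)"
    by (simp add: diag power_mult_distrib complex_norm_square mult.assoc
        del: of_real_power)
  finally have "(norm (a *\<^sub>C x))\<^sup>2 = (cmod a * norm x)\<^sup>2"
    unfolding diag of_real_eq_iff .
  then show ?thesis by (simp add: power2_eq_iff_nonneg)
qed

section \<open>Bounded operators\<close>

text \<open>The type of the library's bounded linear maps contains all bounded real-linear maps. The
  algebra of bounded operators on the complex Hilbert space is the subset of the complex-linear
  ones; commutants and conditional expectations below are relative to that subset.\<close>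

definition bounded_ops :: "('h::chilbert_space \<Rightarrow>\<^sub>L 'h) set" where
  "bounded_ops = {T. \<forall>c x. blinfun_apply T (c *\<^sub>C x) = c *\<^sub>C blinfun_apply T x}"

lift_definition scaleC_op ::
  "complex \<Rightarrow> ('h::chilbert_space \<Rightarrow>\<^sub>L 'h) \<Rightarrow> ('h \<Rightarrow>\<^sub>L 'h)" is "\<lambda>c T x. c *\<^sub>C T x"
proof -
  fix c and T :: "'h \<Rightarrow> 'h"
  assume "bounded_linear T"
  moreover have "bounded_linear (\<lambda>x::'h. c *\<^sub>C x)"
  proof (rule bounded_linear_intro[where K = "cmod c"])
    show "c *\<^sub>C (r *\<^sub>R x) = r *\<^sub>R (c *\<^sub>C x)" for r and x :: 'h
      by (simp add: scaleC_of_real[symmetric] scaleC_scaleC mult.commute)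
  qed (simp_all add: scaleC_add_right norm_scaleC mult.commute)
  ultimately show "bounded_linear (\<lambda>x. c *\<^sub>C T x)"
    by (rule bounded_linear_compose[rotated])
qed

global_interpretation cop: vector_space "scaleC_op :: complex \<Rightarrow> ('h::chilbert_space \<Rightarrow>\<^sub>L 'h) \<Rightarrow> _"
  defines cop_span = cop.span
proof
  fix a b :: complex and S T :: "'h \<Rightarrow>\<^sub>L 'h"
  show "scaleC_op 1 T = T"
    using scaleC_of_real[of 1] by (intro blinfun_eqI) (simp add: scaleC_op.rep_eq)
  show "scaleC_op a (S + T) = scaleC_op a S + scaleC_op a T"
    "scaleC_op (a + b) T = scaleC_op a T + scaleC_op b T"
    "scaleC_op a (scaleC_op b T) = scaleC_op (a * b) T"
    by (auto intro!: blinfun_eqI simp: scaleC_op.rep_eq plus_blinfun.rep_eq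
        scaleC_add_right scaleC_add_left scaleC_scaleC)
qed

text \<open>The Hilbert space adjoint; it exists and is unique by the Riesz representation theorem.\<close>

definition adj :: "('h::chilbert_space \<Rightarrow>\<^sub>L 'h) \<Rightarrow> ('h \<Rightarrow>\<^sub>L 'h)" where
  "adj T = (THE S. \<forall>x y. cinner (blinfun_apply T x) y = cinner x (blinfun_apply S y))"

section \<open>Operator algebras\<close>

definition star_subalgebra :: "('h::chilbert_space \<Rightarrow>\<^sub>L 'h) set \<Rightarrow> bool" where
  "star_subalgebra C \<longleftrightarrow> C \<subseteq> bounded_ops \<and> 0 \<in> C \<and>
     (\<forall>S\<in>C. \<forall>T\<in>C. S + T \<in> C \<and> S o\<^sub>L T \<in> C) \<and> (\<forall>c. \<forall>T\<in>C. scaleC_op c T \<in> C) \<and> (\<forall>T\<in>C. adj T \<in> C)"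

text \<open>A concrete C*-algebra is norm closed; it need not contain the identity operator.\<close>

definition cstar_subalgebra :: "('h::chilbert_space \<Rightarrow>\<^sub>L 'h) set \<Rightarrow> bool" where
  "cstar_subalgebra B \<longleftrightarrow> star_subalgebra B \<and> closed B"

definition commutant :: "('h::chilbert_space \<Rightarrow>\<^sub>L 'h) set \<Rightarrow> ('h \<Rightarrow>\<^sub>L 'h) set" where
  "commutant S = {T \<in> bounded_ops. \<forall>R\<in>S. T o\<^sub>L R = R o\<^sub>L T}"

text \<open>In particular a von Neumann algebra contains the identity operator, so that inclusions of
  von Neumann algebras on the same Hilbert space are unital.\<close>

definition von_neumann_algebra :: "('h::chilbert_space \<Rightarrow>\<^sub>L 'h) set \<Rightarrow> bool" where
  "von_neumann_algebra M \<longleftrightarrow> star_subalgebra M \<and> commutant (commutant M) = M"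

definition factor :: "('h::chilbert_space \<Rightarrow>\<^sub>L 'h) set \<Rightarrow> bool" where
  "factor M \<longleftrightarrow> von_neumann_algebra M \<and> M \<noteq> {0} \<and>
     M \<inter> commutant M = range (\<lambda>c. scaleC_op c id_blinfun)"

definition commutative :: "('h::chilbert_space \<Rightarrow>\<^sub>L 'h) set \<Rightarrow> bool" where
  "commutative C \<longleftrightarrow> (\<forall>S\<in>C. \<forall>T\<in>C. S o\<^sub>L T = T o\<^sub>L S)"

definition projections :: "('h::chilbert_space \<Rightarrow>\<^sub>L 'h) set \<Rightarrow> ('h \<Rightarrow>\<^sub>L 'h) set" where
  "projections A = {p \<in> A. p o\<^sub>L p = p \<and> adj p = p}"

text \<open>For projections, \<open>p o\<^sub>L q = q\<close> means that q is a subprojection of p.\<close>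

definition minimal_projection ::
  "('h::chilbert_space \<Rightarrow>\<^sub>L 'h) set \<Rightarrow> ('h \<Rightarrow>\<^sub>L 'h) \<Rightarrow> bool" where
  "minimal_projection A p \<longleftrightarrow> p \<in> projections A \<and> p \<noteq> 0 \<and>
     (\<forall>q\<in>projections A. p o\<^sub>L q = q \<longrightarrow> q = 0 \<or> q = p)"

definition diffuse :: "('h::chilbert_space \<Rightarrow>\<^sub>L 'h) set \<Rightarrow> bool" where
  "diffuse A \<longleftrightarrow> (\<nexists>p. minimal_projection A p)"

text \<open>Type \<open>II\<^sub>1\<close>: the identity is a finite projection (every isometry of the algebra is a
  unitary) and there is no nonzero abelian projection.\<close>

definition finite_algebra :: "('h::chilbert_space \<Rightarrow>\<^sub>L 'h) set \<Rightarrow> bool" where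
  "finite_algebra M \<longleftrightarrow>
     (\<forall>v\<in>M. adj v o\<^sub>L v = id_blinfun \<longrightarrow> v o\<^sub>L adj v = id_blinfun)"

definition abelian_projection ::
  "('h::chilbert_space \<Rightarrow>\<^sub>L 'h) set \<Rightarrow> ('h \<Rightarrow>\<^sub>L 'h) \<Rightarrow> bool" where
  "abelian_projection M p \<longleftrightarrow> p \<in> projections M \<and> commutative ((\<lambda>x. p o\<^sub>L x o\<^sub>L p) ` M)"

definition type_II1 :: "('h::chilbert_space \<Rightarrow>\<^sub>L 'h) set \<Rightarrow> bool" where
  "type_II1 M \<longleftrightarrow> von_neumann_algebra M \<and> finite_algebra M \<and>
     (\<forall>p. abelian_projection M p \<longrightarrow> p = 0)"

section \<open>Amenability and strong solidity\<close>

text \<open>Amenability of a von Neumann algebra in its spatial form (also called injectivity): there is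
  a conditional expectation, that is, a projection of norm at most one, not required to be normal,
  from all bounded operators onto the algebra.\<close>

definition conditional_expectation ::
  "(('h::chilbert_space \<Rightarrow>\<^sub>L 'h) \<Rightarrow> ('h \<Rightarrow>\<^sub>L 'h)) \<Rightarrow> ('h \<Rightarrow>\<^sub>L 'h) set \<Rightarrow> bool" where
  "conditional_expectation E M \<longleftrightarrow>
     (\<forall>S\<in>bounded_ops. \<forall>T\<in>bounded_ops. E (S + T) = E S + E T) \<and>
     (\<forall>c. \<forall>T\<in>bounded_ops. E (scaleC_op c T) = scaleC_op c (E T)) \<and>
     (\<forall>T\<in>bounded_ops. E T \<in> M \<and> norm (E T) \<le> norm T) \<and>
     (\<forall>T\<in>M. E T = T)"

definition amenable :: "('h::chilbert_space \<Rightarrow>\<^sub>L 'h) set \<Rightarrow> bool" where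
  "amenable M \<longleftrightarrow> von_neumann_algebra M \<and> (\<exists>E. conditional_expectation E M)"

definition unitaries :: "('h::chilbert_space \<Rightarrow>\<^sub>L 'h) set \<Rightarrow> ('h \<Rightarrow>\<^sub>L 'h) set" where
  "unitaries M = {u \<in> M. adj u o\<^sub>L u = id_blinfun \<and> u o\<^sub>L adj u = id_blinfun}"

definition unitary_normalizer ::
  "('h::chilbert_space \<Rightarrow>\<^sub>L 'h) set \<Rightarrow> ('h \<Rightarrow>\<^sub>L 'h) set \<Rightarrow> ('h \<Rightarrow>\<^sub>L 'h) set" where
  "unitary_normalizer M A = {u \<in> unitaries M. (\<lambda>a. u o\<^sub>L a o\<^sub>L adj u) ` A = A}"

definition strongly_solid :: "('h::chilbert_space \<Rightarrow>\<^sub>L 'h) set \<Rightarrow> bool" where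
  "strongly_solid M \<longleftrightarrow> von_neumann_algebra M \<and>
     (\<forall>A. von_neumann_algebra A \<and> A \<subseteq> M \<and> diffuse A \<and> amenable A \<longrightarrow>
        amenable (commutant (commutant (unitary_normalizer M A))))"

section \<open>Regular subalgebras\<close>

definition strongly_dense ::
  "('h::chilbert_space \<Rightarrow>\<^sub>L 'h) set \<Rightarrow> ('h \<Rightarrow>\<^sub>L 'h) set \<Rightarrow> bool" where
  "strongly_dense B M \<longleftrightarrow> B \<subseteq> M \<and> M \<subseteq> strong_operator_topology closure_of B"

definition normalizers ::
  "('h::chilbert_space \<Rightarrow>\<^sub>L 'h) set \<Rightarrow> ('h \<Rightarrow>\<^sub>L 'h) set \<Rightarrow> ('h \<Rightarrow>\<^sub>L 'h) set" where
  "normalizers B C =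
     {n \<in> B. (\<lambda>c. n o\<^sub>L c o\<^sub>L adj n) ` C \<union> (\<lambda>c. adj n o\<^sub>L c o\<^sub>L n) ` C \<subseteq> C}"

definition regular_in ::
  "('h::chilbert_space \<Rightarrow>\<^sub>L 'h) set \<Rightarrow> ('h \<Rightarrow>\<^sub>L 'h) set \<Rightarrow> bool" where
  "regular_in C B \<longleftrightarrow> cstar_subalgebra hull normalizers B C = B"

definition infinite_dimensional :: "('h::chilbert_space \<Rightarrow>\<^sub>L 'h) set \<Rightarrow> bool" where
  "infinite_dimensional C \<longleftrightarrow> (\<nexists>F. finite F \<and> C \<subseteq> cop_span F)"

end

theory Submission
  imports Defs
begin

text \<open>Suppose that \<open>C\<close> is an infinite dimensional regular abelian *-subalgebra of a strongly dense
  C*-subalgebra \<open>B\<close> of \<open>M\<close>, and let \<open>A = C''\<close>. The contradiction comes from feeding \<open>A\<close> to strong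
  solidity: \<open>A\<close> is amenable and diffuse, yet its unitary normalizer generates all of the
  non-amenable algebra \<open>M\<close>. Call \<open>n\<close> normalizing for \<open>A\<close> if \<open>n A n\<^sup>* \<subseteq> A\<close> and \<open>n\<^sup>* A n \<subseteq> A\<close>.

  Since the normalizers of \<open>C\<close> generate \<open>B\<close>, an operator commuting with them commutes with \<open>M\<close>
  (\<open>commutant_of_regular_normalizers\<close>); as \<open>M\<close> is a factor, a closed subspace invariant under them
  and under \<open>M'\<close> is trivial (\<open>factor_irreducible\<close>). The common kernel of \<open>C\<close> is such a subspace, so
  \<open>C\<close> acts nondegenerately and is strongly dense in \<open>A\<close>; therefore every normalizer of \<open>C\<close> is
  normalizing for \<open>A\<close> (\<open>double_commutant_conjugation\<close>).

  \<^emph>\<open>Amenability\<close> (\<open>abelian_amenable\<close>). For finitely many projections of \<open>A\<close> there is an explicit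
  contraction into \<open>A\<close> fixing them: cut with the atoms of the finite Boolean algebra that they
  generate and apply a vector state on every atom. Tychonoff's theorem provides a weak cluster point of
  these maps. It fixes all projections, hence all of \<open>A\<close>, because the projections span a norm dense
  subspace (\<open>projections_span_von_neumann_algebra\<close>).

  \<^emph>\<open>Diffuseness\<close> (\<open>minimal_projection_finite_dimensional\<close>). Let \<open>e\<close> be a minimal projection of \<open>A\<close>.
  For every normalizing \<open>n\<close> with \<open>e n \<noteq> 0\<close>, the operator \<open>n\<^sup>* e n\<close> is a multiple of a minimal
  projection of \<open>A\<close> equivalent to \<open>e\<close> in \<open>M\<close>, and by \<open>factor_irreducible\<close> these projections have
  supremum 1. They are pairwise orthogonal or equal. Infinitely many of them would give a shift
  isometry in \<open>M\<close> that is not unitary; finitely many make \<open>A\<close> finite dimensional.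

  \<^emph>\<open>The normalizer\<close> (\<open>normalizing_commute\<close>). An operator \<open>T\<close> commuting with the unitary normalizer
  of \<open>A\<close> commutes with every normalizing \<open>n\<close> in \<open>M\<close>, by the decomposition of a partial automorphism
  of an abelian algebra into a trivial part and parts moving a projection to an orthogonal one. On the
  trivial part \<open>n\<close> lies in \<open>A' \<inter> M\<close>, which is generated by unitaries commuting with \<open>A\<close>. A part \<open>k\<close>
  with orthogonal supports gives the selfadjoint normalizing operator \<open>x = k + k\<^sup>*\<close>; if \<open>s\<close> is its
  sign, then \<open>s + (1 - s\<^sup>2)\<close> is a unitary normalizing \<open>A\<close>, and \<open>x\<close> is \<open>s\<close> times an element of \<open>A\<close>.

  The only functional calculus involved is the sign of a selfadjoint operator, constructed in
  \<open>symmetric_sign\<close> as a strong limit of odd polynomials. Most computations use the real inner product,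
  for which the adjoint of a complex linear operator is the same.\<close>

section \<open>Hilbert space projections and the Riesz representation\<close>

lemma inner_eqI:
  fixes u v :: "'a::real_inner"
  assumes "\<And>y. inner u y = inner v y"
  shows "u = v"
  using assms[of "u - v"]
  by (simp add: right_minus_eq[symmetric, of u] inner_eq_zero_iff[symmetric, of "u - v"]
      inner_diff_left del: inner_eq_zero_iff right_minus_eq)

text \<open>A minimizing sequence for the distance from \<open>x\<close> to \<open>V\<close> is Cauchy by the parallelogram law, and the
  nearest point obtained in this way is the foot of the perpendicular.\<close>

lemma orthogonal_decomposition:
  fixes V :: "'a::{real_inner,complete_space} set"
  assumes "closed V" and "subspace V"
  shows "\<exists>y\<in>V. \<forall>v\<in>V. inner (x - y) v = 0"
proof -
  have ne: "V \<noteq> {}" using assms(2) subspace_0 by blast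
  define d where "d = infdist x V"
  have d0: "d \<ge> 0" by (simp add: d_def infdist_nonneg)
  have dle: "d \<le> norm (x - v)" if "v \<in> V" for v
    using infdist_le[OF that, of x] by (simp add: d_def dist_norm)
  have "\<exists>v\<in>V. (norm (x - v))\<^sup>2 < d\<^sup>2 + 1 / real (Suc n)" for n
  proof -
    have "d < sqrt (d\<^sup>2 + 1 / real (Suc n))" by (rule real_less_rsqrt) simp
    then obtain v where v: "v \<in> V" "dist x v < sqrt (d\<^sup>2 + 1 / real (Suc n))"
      using ne cInf_lessD[of "dist x ` V"] by (auto simp: d_def infdist_notempty)
    have "(norm (x - v))\<^sup>2 < (sqrt (d\<^sup>2 + 1 / real (Suc n)))\<^sup>2"
      using v(2) by (intro power_strict_mono) (auto simp: dist_norm)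
    also have "\<dots> = d\<^sup>2 + 1 / real (Suc n)" by (simp add: add_nonneg_nonneg)
    finally show ?thesis using v(1) by blast
  qed
  then obtain v where v: "\<And>n. v n \<in> V"
    "\<And>n. (norm (x - v n))\<^sup>2 < d\<^sup>2 + 1 / real (Suc n)" by metis
  have close: "(norm (v m - v n))\<^sup>2 \<le> 2 / real (Suc m) + 2 / real (Suc n)" for m n
  proof -
    have "(1/2) *\<^sub>R (v m + v n) \<in> V"
      by (intro subspace_scale[OF assms(2)] subspace_add[OF assms(2)] v)
    then have "d \<le> norm (x - (1/2) *\<^sub>R (v m + v n))" by (rule dle)
    then have "d\<^sup>2 \<le> (norm (x - (1/2) *\<^sub>R (v m + v n)))\<^sup>2" using d0 by (intro power_mono)
    moreover have "(norm (v m - v n))\<^sup>2 = 2 * (norm (x - v m))\<^sup>2 + 2 * (norm (x - v n))\<^sup>2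
        - 4 * (norm (x - (1/2) *\<^sub>R (v m + v n)))\<^sup>2"
      by (simp add: power2_norm_eq_inner algebra_simps inner_commute)
    ultimately show ?thesis using v(2)[of m] v(2)[of n] by simp
  qed
  have "Cauchy v"
  proof (rule metric_CauchyI)
    fix e :: real assume e: "e > 0"
    obtain N where N: "inverse (real (Suc N)) < e\<^sup>2 / 4"
      using reals_Archimedean[of "e\<^sup>2 / 4"] e by auto
    have "dist (v m) (v n) < e" if "m \<ge> N" "n \<ge> N" for m n
    proof -
      have "1 / real (Suc m) < e\<^sup>2 / 4" "1 / real (Suc n) < e\<^sup>2 / 4"
        by (auto intro!: le_less_trans[OF frac_le N[unfolded inverse_eq_divide]] simp del: of_nat_Suc less_divide_eq_numeral1 simp: that)
      then have "(norm (v m - v n))\<^sup>2 < e\<^sup>2" using close[of m n] by linarith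
      then show ?thesis using e by (simp add: dist_norm power2_less_imp_less)
    qed
    then show "\<exists>N. \<forall>m\<ge>N. \<forall>n\<ge>N. dist (v m) (v n) < e" by blast
  qed
  then obtain y where y: "v \<longlonglongrightarrow> y" using Cauchy_convergent_iff convergent_def by blast
  have yV: "y \<in> V" using closed_sequentially[OF assms(1)] v(1) y by blast
  have "(\<lambda>n. (norm (x - v n))\<^sup>2) \<longlonglongrightarrow> (norm (x - y))\<^sup>2" by (intro tendsto_intros y)
  moreover have "(\<lambda>n. d\<^sup>2 + 1 / real (Suc n)) \<longlonglongrightarrow> d\<^sup>2 + 0"
    by (intro tendsto_intros LIMSEQ_Suc[OF lim_1_over_n])
  ultimately have yd: "(norm (x - y))\<^sup>2 \<le> d\<^sup>2"
    using v(2) by (intro LIMSEQ_le[of _ _ "\<lambda>n. d\<^sup>2 + 1 / real (Suc n)"]) (auto intro: less_imp_le)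
  have "inner (x - y) w = 0" if w: "w \<in> V" for w
  proof (rule ccontr)
    assume n: "inner (x - y) w \<noteq> 0"
    then have w0: "inner w w > 0" by auto
    \<comment> \<open>The step length that minimizes the distance from \<open>x\<close> along the line \<open>y + t w\<close>.\<close>
    define t where "t = inner (x - y) w / inner w w"
    have "y + t *\<^sub>R w \<in> V" by (intro subspace_add[OF assms(2)] subspace_scale[OF assms(2)] yV w)
    then have "d\<^sup>2 \<le> (norm (x - (y + t *\<^sub>R w)))\<^sup>2" using dle d0 by (intro power_mono) auto
    also have "\<dots> = (norm (x - y))\<^sup>2 - 2 * t * inner (x - y) w + t\<^sup>2 * inner w w"
      unfolding power2_norm_eq_inner by (simp add: algebra_simps inner_commute power2_eq_square)
    also have "\<dots> = (norm (x - y))\<^sup>2 - (inner (x - y) w)\<^sup>2 / inner w w"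
      using w0 by (simp add: t_def field_simps power2_eq_square)
    finally show False using yd n w0 by (smt (verit) divide_pos_pos zero_less_power2)
  qed
  then show ?thesis using yV by blast
qed

lemma orthogonal_component_unique:
  fixes x p y :: "'a::real_inner"
  assumes V: "subspace V" and "p \<in> V" and "y \<in> V"
    and "\<And>v. v \<in> V \<Longrightarrow> inner (x - p) v = 0" and "\<And>v. v \<in> V \<Longrightarrow> inner (x - y) v = 0"
  shows "p = y"
proof -
  have m: "p - y \<in> V" using assms by (intro subspace_diff)
  have "inner (p - y) (p - y) = inner (x - y) (p - y) - inner (x - p) (p - y)"
    by (simp add: algebra_simps)
  then show ?thesis using assms(4,5)[OF m] by simp
qed

lemma orthogonal_projection_exists:
  fixes V :: "'a::{real_inner,complete_space} set"
  assumes "closed V" and "subspace V"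
  shows "\<exists>P::'a \<Rightarrow>\<^sub>L 'a. (\<forall>x. P x \<in> V) \<and> (\<forall>x. \<forall>v\<in>V. inner (x - P x) v = 0)"
proof -
  obtain p where p: "\<And>x. p x \<in> V" "\<And>x v. v \<in> V \<Longrightarrow> inner (x - p x) v = 0"
    using orthogonal_decomposition[OF assms] by metis
  have uniq: "p x = y" if "y \<in> V" "\<And>v. v \<in> V \<Longrightarrow> inner (x - y) v = 0" for x y
    by (rule orthogonal_component_unique[OF assms(2) p(1) that(1) p(2) that(2)])
  have nrm: "norm (p x) \<le> norm x" for x
  proof -
    have "inner (x - p x) (p x) = 0" by (rule p(2)[OF p(1)])
    then have "norm (p x) * norm (p x) = inner x (p x)"
      by (simp add: inner_diff_left power2_norm_eq_inner[symmetric] power2_eq_square)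
    also have "\<dots> \<le> norm x * norm (p x)" by (rule norm_cauchy_schwarz)
    finally show ?thesis by (cases "p x = 0") auto
  qed
  have "bounded_linear p"
  proof (rule bounded_linear_intro[where K = 1])
    show "p (x + y) = p x + p y" for x y
    proof (rule uniq)
      show "p x + p y \<in> V" by (intro subspace_add[OF assms(2)] p)
      show "inner (x + y - (p x + p y)) v = 0" if "v \<in> V" for v
        using p(2)[OF that, of x] p(2)[OF that, of y] by (simp add: algebra_simps)
    qed
    show "p (r *\<^sub>R x) = r *\<^sub>R p x" for r x
    proof (rule uniq)
      show "r *\<^sub>R p x \<in> V" by (intro subspace_scale[OF assms(2)] p)
      show "inner (r *\<^sub>R x - r *\<^sub>R p x) v = 0" if "v \<in> V" for v
        using p(2)[OF that, of x] by (simp add: algebra_simps)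
    qed
  qed (simp add: nrm)
  then show ?thesis using p by (intro exI[of _ "Blinfun p"]) (auto simp: bounded_linear_Blinfun_apply)
qed

text \<open>A nonzero functional is determined up to a factor by its kernel, so the representing vector is a
  multiple of a vector orthogonal to the kernel.\<close>

lemma riesz_representation:
  fixes f :: "'a::{real_inner,complete_space} \<Rightarrow> real"
  assumes "bounded_linear f"
  shows "\<exists>z. \<forall>x. f x = inner z x"
proof (cases "\<forall>x. f x = 0")
  case True
  then show ?thesis by (intro exI[of _ 0]) simp
next
  case False
  then obtain x0 where x0: "f x0 \<noteq> 0" by blast
  interpret f: bounded_linear f by fact
  let ?V = "{x. f x = 0}"
  have "closed ?V"
    by (intro closed_Collect_eq continuous_intros) (auto intro: f.continuous_on continuous_on_id)
  moreover have "subspace ?V" by (auto simp: subspace_def f.add f.scaleR f.zero)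
  ultimately obtain y where y: "f y = 0" "\<And>v. f v = 0 \<Longrightarrow> inner (x0 - y) v = 0"
    using orthogonal_decomposition[of ?V x0] by auto
  define w where "w = x0 - y"
  have fw: "f w = f x0" using y(1) by (simp add: w_def f.diff)
  then have "w \<noteq> 0" using x0 f.zero by auto
  then have ww: "inner w w \<noteq> 0" by simp
  have "f x = inner ((f w / inner w w) *\<^sub>R w) x" for x
  proof -
    have "inner w (x - (f x / f w) *\<^sub>R w) = 0"
      using y(2)[of "x - (f x / f w) *\<^sub>R w"] fw x0 by (simp add: w_def f.diff f.scaleR)
    then have "inner w x = f x / f w * inner w w" by (simp add: inner_diff_right)
    then show ?thesis using ww fw x0 by (simp add: field_simps)
  qed
  then show ?thesis by blast
qed

text \<open>Source of both the adjoint and, later, of the values of a conditional expectation that is only given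
  through its matrix coefficients.\<close>

lemma bounded_bilinear_form_operator:
  fixes b :: "'a::{real_inner,complete_space} \<Rightarrow> 'a \<Rightarrow> real"
  assumes "\<And>x x' y. b (x + x') y = b x y + b x' y" and "\<And>r x y. b (r *\<^sub>R x) y = r * b x y"
    and "\<And>x y y'. b x (y + y') = b x y + b x y'" and "\<And>r x y. b x (r *\<^sub>R y) = r * b x y"
    and bd: "\<And>x y. \<bar>b x y\<bar> \<le> K * norm x * norm y"
  shows "\<exists>T::'a \<Rightarrow>\<^sub>L 'a. \<forall>x y. inner (T x) y = b x y"
proof -
  have "bounded_linear (b x)" for x
    using bd[of x] by (intro bounded_linear_intro[where K = "K * norm x"]) (auto simp: assms mult.commute)
  then have "\<forall>x. \<exists>z. \<forall>y. b x y = inner z y" using riesz_representation by blast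
  then obtain t where t: "\<And>x y. b x y = inner (t x) y" using choice[of "\<lambda>x z. \<forall>y. b x y = inner z y"] by blast
  have "bounded_linear t"
  proof (rule bounded_linear_intro[where K = K])
    show "t (x + y) = t x + t y" for x y by (rule inner_eqI) (simp add: t[symmetric] assms inner_add_left)
    show "t (r *\<^sub>R x) = r *\<^sub>R t x" for r x by (rule inner_eqI) (simp add: t[symmetric] assms)
    show "norm (t x) \<le> norm x * K" for x
    proof (cases "t x = 0")
      case True
      have "0 \<le> K * norm x * norm x" using bd[of x x] by linarith
      then show ?thesis using True by (cases "x = 0") (auto simp: zero_le_mult_iff)
    next
      case False
      have "norm (t x) * norm (t x) = b x (t x)"
        by (simp add: t power2_norm_eq_inner[symmetric] power2_eq_square)
      also have "\<dots> \<le> K * norm x * norm (t x)" using bd[of x "t x"] by linarith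
      finally show ?thesis using False by (simp add: mult.commute)
    qed
  qed
  then show ?thesis using t by (intro exI[of _ "Blinfun t"]) (simp add: bounded_linear_Blinfun_apply)
qed

section \<open>Complex linear operators and adjoints\<close>


lemma scaleC_zero_right [simp]: "a *\<^sub>C (0::'h::complex_inner) = 0"
  using norm_scaleC[of a "0::'h"] by simp

lemma scaleC_minus_right: "a *\<^sub>C (- x) = - (a *\<^sub>C (x::'h::complex_inner))"
  using scaleC_add_right[of a x "- x"] by (simp add: eq_neg_iff_add_eq_0 add.commute)

lemma scaleC_diff_right: "a *\<^sub>C (x - y) = a *\<^sub>C x - a *\<^sub>C (y::'h::complex_inner)"
  using scaleC_add_right[of a x "- y"] by (simp add: scaleC_minus_right)

lemma cinner_scaleC_right: "cinner x (a *\<^sub>C y) = cnj a * cinner x (y::'h::complex_inner)"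
  by (metis cinner_commute cinner_scaleC_left complex_cnj_mult)

lemma inner_scaleC_left: "inner (a *\<^sub>C x) y = inner x (cnj a *\<^sub>C (y::'h::complex_inner))"
  by (simp add: Re_cinner[symmetric] cinner_scaleC_left cinner_scaleC_right)

text \<open>Identities for \<open>cinner\<close> follow from identities for the real inner product: the imaginary part
  is a real part after rotating the second argument.\<close>

lemma Im_cinner: "Im (cinner x y) = inner x (\<i> *\<^sub>C (y::'h::complex_inner))"
  by (simp add: Re_cinner[symmetric] cinner_scaleC_right)

lemma scaleC_tendsto:
  assumes "(f \<longlongrightarrow> (x::'h::chilbert_space)) F"
  shows "((\<lambda>n. a *\<^sub>C f n) \<longlongrightarrow> a *\<^sub>C x) F"
proof -
  have "((\<lambda>n. scaleC_op a id_blinfun (f n)) \<longlongrightarrow> scaleC_op a id_blinfun x) F"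
    by (intro tendsto_intros assms)
  then show ?thesis by (simp add: scaleC_op.rep_eq)
qed

lemma bounded_opsD: "T \<in> bounded_ops \<Longrightarrow> T (c *\<^sub>C x) = c *\<^sub>C T x"
  by (simp add: bounded_ops_def)

lemma bounded_ops_add: "S \<in> bounded_ops \<Longrightarrow> T \<in> bounded_ops \<Longrightarrow> S + T \<in> bounded_ops"
  by (simp add: bounded_ops_def plus_blinfun.rep_eq scaleC_add_right)

lemma bounded_ops_compose: "S \<in> bounded_ops \<Longrightarrow> T \<in> bounded_ops \<Longrightarrow> S o\<^sub>L T \<in> bounded_ops"
  by (simp add: bounded_ops_def)

lemma bounded_ops_scaleC: "T \<in> bounded_ops \<Longrightarrow> scaleC_op c T \<in> bounded_ops"
  by (simp add: bounded_ops_def scaleC_op.rep_eq scaleC_scaleC mult.commute)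

lemma bounded_ops_id: "id_blinfun \<in> bounded_ops"
  by (simp add: bounded_ops_def)

lemma scaleC_op_of_real: "scaleC_op (complex_of_real r) T = r *\<^sub>R T"
  by (intro blinfun_eqI) (simp add: scaleC_op.rep_eq scaleC_of_real scaleR_blinfun.rep_eq)

text \<open>The adjoint can be recognized with the real inner product alone: complex linearity of \<open>T\<close> makes
  \<open>S\<close> commute with multiplication by the imaginary unit, and this restores the imaginary parts.\<close>

lemma adj_eqI:
  assumes T: "T \<in> bounded_ops" and S: "\<And>x y. inner (T x) y = inner x (blinfun_apply S y)"
  shows "adj T = S"
  unfolding adj_def
proof (rule the_equality)
  have ii: "\<i> *\<^sub>C S y = S (\<i> *\<^sub>C y)" for y
  proof (rule inner_eqI)
    fix x
    have "inner (\<i> *\<^sub>C S y) x = inner (S y) (- \<i> *\<^sub>C x)" by (simp add: inner_scaleC_left)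
    also have "\<dots> = inner (T (- \<i> *\<^sub>C x)) y" by (metis S inner_commute)
    also have "\<dots> = inner (- \<i> *\<^sub>C T x) y" by (metis T bounded_opsD)
    also have "\<dots> = inner (T x) (\<i> *\<^sub>C y)" by (simp add: inner_scaleC_left)
    also have "\<dots> = inner (S (\<i> *\<^sub>C y)) x" by (metis S inner_commute)
    finally show "inner (\<i> *\<^sub>C S y) x = inner (S (\<i> *\<^sub>C y)) x" .
  qed
  show "\<forall>x y. cinner (T x) y = cinner x (S y)"
    by (auto intro!: complex_eqI simp: Re_cinner Im_cinner S ii)
next
  fix S' assume *: "\<forall>x y. cinner (blinfun_apply T x) y = cinner x (blinfun_apply S' y)"
  show "S' = S"
  proof (rule blinfun_eqI, rule inner_eqI)
    fix y x
    have "inner x (S' y) = inner x (S y)" using * S by (metis Re_cinner)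
    then show "inner (S' y) x = inner (S y) x" by (simp add: inner_commute)
  qed
qed

lemma inner_adj_right:
  assumes "T \<in> bounded_ops"
  shows "inner x (adj T y) = inner (T x) y"
proof -
  have "\<exists>S::'a \<Rightarrow>\<^sub>L 'a. \<forall>x y. inner (S x) y = inner x (T y)"
  proof (rule bounded_bilinear_form_operator[where K = "norm T"])
    show "\<bar>inner x (T y)\<bar> \<le> norm T * norm x * norm y" for x y
    proof -
      have "\<bar>inner x (T y)\<bar> \<le> norm x * norm (T y)" by (rule Cauchy_Schwarz_ineq2)
      also have "\<dots> \<le> norm x * (norm T * norm y)" by (intro mult_left_mono norm_blinfun) auto
      finally show ?thesis by (simp add: ac_simps)
    qed
  qed (auto simp: inner_add_left inner_add_right blinfun.add_right blinfun.scaleR_right)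
  then obtain S :: "'a \<Rightarrow>\<^sub>L 'a" where "\<And>x y. inner (S x) y = inner x (T y)" by blast
  then have S: "\<And>x y. inner (T x) y = inner x (S y)" by (metis inner_commute)
  show ?thesis using S by (simp add: adj_eqI[OF assms S])
qed

lemma inner_adj_left: "T \<in> bounded_ops \<Longrightarrow> inner (adj T x) y = inner x (T y)"
  by (metis inner_adj_right inner_commute)

lemma bounded_ops_adj:
  assumes "T \<in> bounded_ops"
  shows "adj T \<in> bounded_ops"
  unfolding bounded_ops_def
proof (intro CollectI allI, rule inner_eqI)
  fix c x y
  show "inner (adj T (c *\<^sub>C x)) y = inner (c *\<^sub>C adj T x) y"
    using assms by (simp add: inner_adj_left inner_scaleC_left bounded_opsD)
qed

lemma adj_adj: "T \<in> bounded_ops \<Longrightarrow> adj (adj T) = T"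
  by (rule adj_eqI) (simp_all add: bounded_ops_adj inner_adj_left)

lemma adj_compose:
  "S \<in> bounded_ops \<Longrightarrow> T \<in> bounded_ops \<Longrightarrow> adj (S o\<^sub>L T) = adj T o\<^sub>L adj S"
  by (rule adj_eqI) (simp_all add: bounded_ops_compose inner_adj_right)

lemma adj_scaleC:
  assumes T: "T \<in> bounded_ops"
  shows "adj (scaleC_op c T) = scaleC_op (cnj c) (adj T)"
proof (rule adj_eqI[OF bounded_ops_scaleC[OF T]])
  fix x y
  have "inner (c *\<^sub>C T x) y = inner (T (c *\<^sub>C x)) y" by (metis T bounded_opsD)
  also have "\<dots> = inner x (cnj c *\<^sub>C adj T y)"
    by (simp add: inner_adj_right[OF T, symmetric] inner_scaleC_left)
  finally show "inner (scaleC_op c T x) y = inner x (scaleC_op (cnj c) (adj T) y)"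
    by (simp add: scaleC_op.rep_eq)
qed

definition symmetric :: "('a::real_inner \<Rightarrow>\<^sub>L 'a) \<Rightarrow> bool" where
  "symmetric T \<longleftrightarrow> (\<forall>x y. inner (T x) y = inner x (T y))"

lemma adj_eq_self_iff: "T \<in> bounded_ops \<Longrightarrow> adj T = T \<longleftrightarrow> symmetric T"
  unfolding symmetric_def by (metis adj_eqI inner_adj_right)

lemma closed_bounded_ops: "closed (bounded_ops :: ('h::chilbert_space \<Rightarrow>\<^sub>L 'h) set)"
proof -
  have "closed {T :: 'h \<Rightarrow>\<^sub>L 'h. T (c *\<^sub>C x) = scaleC_op c id_blinfun (T x)}" for c x
    by (intro closed_Collect_eq linear_continuous_on blinfun.bounded_linear_left
        bounded_linear_compose[OF blinfun.bounded_linear_right])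
  then have "closed (\<Inter>c. \<Inter>x. {T :: 'h \<Rightarrow>\<^sub>L 'h. T (c *\<^sub>C x) = scaleC_op c id_blinfun (T x)})" by blast
  moreover have "bounded_ops
      = (\<Inter>c. \<Inter>x. {T :: 'h \<Rightarrow>\<^sub>L 'h. T (c *\<^sub>C x) = scaleC_op c id_blinfun (T x)})"
    by (auto simp: bounded_ops_def scaleC_op.rep_eq)
  ultimately show ?thesis by simp
qed

lemma strong_limit_exists:
  fixes T :: "nat \<Rightarrow> 'a::real_normed_vector \<Rightarrow>\<^sub>L 'b::{real_normed_vector,complete_space}"
  assumes C: "\<And>x. Cauchy (\<lambda>k. T k x)" and K: "\<And>k x. norm (T k x) \<le> K * norm x"
  shows "\<exists>S::'a \<Rightarrow>\<^sub>L 'b. (\<forall>x. (\<lambda>k. T k x) \<longlonglongrightarrow> S x) \<and> (\<forall>x. norm (S x) \<le> K * norm x)"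
proof -
  define s where "s x = lim (\<lambda>k. T k x)" for x
  have s: "(\<lambda>k. T k x) \<longlonglongrightarrow> s x" for x
    using C[of x] Cauchy_convergent_iff convergent_LIMSEQ_iff s_def by metis
  have nrm: "norm (s x) \<le> K * norm x" for x
    by (rule LIMSEQ_le_const2[OF tendsto_norm[OF s]]) (use K in auto)
  have "bounded_linear s"
  proof (rule bounded_linear_intro[where K = K])
    show "s (x + y) = s x + s y" for x y
      by (rule LIMSEQ_unique[OF s]) (simp add: blinfun.add_right tendsto_add s)
    show "s (r *\<^sub>R x) = r *\<^sub>R s x" for r x
      by (rule LIMSEQ_unique[OF s]) (simp add: blinfun.scaleR_right tendsto_scaleR s)
    show "norm (s x) \<le> norm x * K" for x using nrm[of x] by (simp add: mult.commute)
  qed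
  then show ?thesis using s nrm by (intro exI[of _ "Blinfun s"]) (simp add: bounded_linear_Blinfun_apply)
qed

text \<open>Multiplication is jointly strongly continuous on bounded sets.\<close>

lemma strong_limit_compose:
  fixes T :: "nat \<Rightarrow> 'a::real_normed_vector \<Rightarrow>\<^sub>L 'b::real_normed_vector"
  assumes T: "\<And>x. (\<lambda>k. T k x) \<longlonglongrightarrow> S x" and K: "\<And>k x. norm (T k x) \<le> K * norm x"
    and u: "u \<longlonglongrightarrow> x"
  shows "(\<lambda>k. T k (u k)) \<longlonglongrightarrow> S x"
proof -
  have "(\<lambda>k. T k (u k - x)) \<longlonglongrightarrow> 0"
  proof (rule Lim_null_comparison)
    show "\<forall>\<^sub>F k in sequentially. norm (T k (u k - x)) \<le> K * norm (u k - x)" using K by simp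
    have "(\<lambda>k. K * norm (u k - x)) \<longlonglongrightarrow> K * norm (x - x)" by (intro tendsto_intros u)
    then show "(\<lambda>k. K * norm (u k - x)) \<longlonglongrightarrow> 0" by simp
  qed
  then have "(\<lambda>k. T k (u k - x) + T k x) \<longlonglongrightarrow> 0 + S x" by (intro tendsto_add T)
  then show ?thesis by (simp add: blinfun.diff_right)
qed

section \<open>Commutants and von Neumann algebras\<close>


lemma commutantD: "T \<in> commutant S \<Longrightarrow> R \<in> S \<Longrightarrow> T (R x) = R (T x)"
  unfolding commutant_def by (metis (mono_tags, lifting) mem_Collect_eq blinfun_apply_blinfun_compose)

lemma commutant_bounded: "T \<in> commutant S \<Longrightarrow> T \<in> bounded_ops"
  by (simp add: commutant_def)

lemma commutantI:
  "T \<in> bounded_ops \<Longrightarrow> (\<And>R x. R \<in> S \<Longrightarrow> blinfun_apply T (blinfun_apply R x) = R (T x))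
    \<Longrightarrow> T \<in> commutant S"
  by (auto simp: commutant_def intro: blinfun_eqI)

lemma commutant_antimono: "S \<subseteq> S' \<Longrightarrow> commutant S' \<subseteq> commutant S"
  by (auto simp: commutant_def)

lemma subset_double_commutant: "S \<subseteq> bounded_ops \<Longrightarrow> S \<subseteq> commutant (commutant S)"
  by (auto intro!: commutantI) (metis commutantD)

lemma commutant_strong_limit:
  fixes T :: "nat \<Rightarrow> 'h::chilbert_space \<Rightarrow>\<^sub>L 'h" and L :: "'h \<Rightarrow>\<^sub>L 'h"
  assumes "\<And>k. T k \<in> commutant S" and lim: "\<And>x. (\<lambda>k. T k x) \<longlonglongrightarrow> L x"
  shows "L \<in> commutant S"
proof (rule commutantI)
  have "L (c *\<^sub>C x) = c *\<^sub>C L x" for c x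
    using LIMSEQ_unique[OF lim[of "c *\<^sub>C x"]] scaleC_tendsto[OF lim[of x], of c]
    by (simp add: bounded_opsD[OF commutant_bounded[OF assms(1)]])
  then show "L \<in> bounded_ops" by (simp add: bounded_ops_def)
next
  fix R x assume R: "R \<in> S"
  have "(\<lambda>k. R (T k x)) \<longlonglongrightarrow> R (L x)" by (intro tendsto_intros lim)
  then show "L (R x) = R (L x)"
    using LIMSEQ_unique[OF lim[of "R x"]] by (simp add: commutantD[OF assms(1) R])
qed

lemma closed_commutant:
  fixes S :: "('a::chilbert_space \<Rightarrow>\<^sub>L 'a) set"
  shows "closed (commutant S)"
proof -
  have "closed {T :: 'a \<Rightarrow>\<^sub>L 'a. T (blinfun_apply R x) = blinfun_apply R (T x)}" for R :: "'a \<Rightarrow>\<^sub>L 'a" and x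
    by (intro closed_Collect_eq linear_continuous_on blinfun.bounded_linear_left
        bounded_linear_compose[OF blinfun.bounded_linear_right])
  then have "closed (\<Inter>R\<in>S. \<Inter>x. {T :: 'a \<Rightarrow>\<^sub>L 'a. T (blinfun_apply R x) = blinfun_apply R (T x)})" by blast
  moreover have "commutant S
      = bounded_ops \<inter> (\<Inter>R\<in>S. \<Inter>x. {T :: 'a \<Rightarrow>\<^sub>L 'a. T (blinfun_apply R x) = blinfun_apply R (T x)})"
    by (auto intro!: commutantI dest: commutant_bounded commutantD)
  ultimately show ?thesis by (simp add: closed_Int closed_bounded_ops)
qed

definition adjoint_closed :: "('h::chilbert_space \<Rightarrow>\<^sub>L 'h) set \<Rightarrow> bool" where
  "adjoint_closed S \<longleftrightarrow> S \<subseteq> bounded_ops \<and> (\<forall>R\<in>S. adj R \<in> S)"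

lemma commutant_adj:
  assumes S: "adjoint_closed S" and T: "T \<in> commutant S"
  shows "adj T \<in> commutant S"
proof (rule commutantI)
  show "adj T \<in> bounded_ops" using T by (simp add: bounded_ops_adj commutant_bounded)
next
  fix R x assume R: "R \<in> S"
  have b: "T \<in> bounded_ops" "R \<in> bounded_ops" "adj R \<in> S"
    using S R T by (auto simp: adjoint_closed_def commutant_bounded)
  show "adj T (R x) = R (adj T x)"
  proof (rule inner_eqI)
    fix y
    have "inner (adj T (R x)) y = inner x (adj R (T y))"
      using b by (simp add: inner_adj_left inner_adj_right)
    also have "\<dots> = inner x (T (adj R y))" using commutantD[OF T b(3)] by simp
    also have "\<dots> = inner (R (adj T x)) y" using b by (simp add: inner_adj_left[symmetric] inner_adj_right)
    finally show "inner (adj T (R x)) y = inner (R (adj T x)) y" .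
  qed
qed

lemma star_subalgebra_commutant:
  assumes "adjoint_closed S"
  shows "star_subalgebra (commutant S)"
  unfolding star_subalgebra_def
proof (intro conjI ballI allI)
  show "commutant S \<subseteq> bounded_ops" using commutant_bounded by blast
  show "0 \<in> commutant S" by (rule commutantI) (simp_all add: bounded_ops_def)
  fix T U assume T: "T \<in> commutant S" "U \<in> commutant S"
  show "T + U \<in> commutant S" "T o\<^sub>L U \<in> commutant S"
    by (rule commutantI; use T in \<open>simp add: commutant_bounded bounded_ops_add bounded_ops_compose
        blinfun.add_left blinfun.add_right commutantD[OF T(1)] commutantD[OF T(2)]\<close>)+
next
  fix T c assume T: "T \<in> commutant S"
  show "adj T \<in> commutant S" by (rule commutant_adj[OF assms T])
  have R: "R (c *\<^sub>C x) = c *\<^sub>C R x" if "R \<in> S" for R x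
    using that assms by (auto simp: adjoint_closed_def bounded_opsD)
  show "scaleC_op c T \<in> commutant S"
    by (rule commutantI) (simp_all add: bounded_ops_scaleC[OF commutant_bounded[OF T]] scaleC_op.rep_eq commutantD[OF T] R)
qed

lemma adjoint_closed_commutant: "adjoint_closed S \<Longrightarrow> adjoint_closed (commutant S)"
  by (auto simp: adjoint_closed_def[of "commutant S"] commutant_adj commutant_bounded)

lemma von_neumann_commutant:
  assumes "adjoint_closed S"
  shows "von_neumann_algebra (commutant S)"
proof -
  have "S \<subseteq> commutant (commutant S)"
    using assms by (simp add: subset_double_commutant adjoint_closed_def)
  then have "commutant (commutant (commutant S)) = commutant S"
    using commutant_antimono subset_double_commutant[of "commutant S"] commutant_bounded by blast
  then show ?thesis by (simp add: von_neumann_algebra_def star_subalgebra_commutant assms)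
qed

lemma star_subalgebraD:
  assumes "star_subalgebra C"
  shows "S \<in> C \<Longrightarrow> S \<in> bounded_ops" "0 \<in> C" "S \<in> C \<Longrightarrow> T \<in> C \<Longrightarrow> S + T \<in> C"
    "S \<in> C \<Longrightarrow> T \<in> C \<Longrightarrow> S o\<^sub>L T \<in> C" "T \<in> C \<Longrightarrow> scaleC_op c T \<in> C" "T \<in> C \<Longrightarrow> adj T \<in> C"
    "T \<in> C \<Longrightarrow> r *\<^sub>R T \<in> C" "S \<in> C \<Longrightarrow> T \<in> C \<Longrightarrow> S - T \<in> C"
proof -
  show r: "T \<in> C \<Longrightarrow> r *\<^sub>R T \<in> C" for T r
    using assms by (simp add: star_subalgebra_def scaleC_op_of_real[symmetric])
  show "S \<in> C \<Longrightarrow> T \<in> C \<Longrightarrow> S - T \<in> C"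
    using assms r[of T "-1"] by (auto simp: star_subalgebra_def diff_conv_add_uminus simp del: add_uminus_conv_diff)
qed (use assms in \<open>auto simp: star_subalgebra_def\<close>)

lemma star_subalgebra_adjoint_closed: "star_subalgebra C \<Longrightarrow> adjoint_closed C"
  by (auto simp: star_subalgebra_def adjoint_closed_def)

lemma von_neumannD:
  assumes "von_neumann_algebra D"
  shows "star_subalgebra D" "commutant (commutant D) = D" "adjoint_closed D" "closed D" "id_blinfun \<in> D"
proof -
  show "star_subalgebra D" "commutant (commutant D) = D"
    using assms by (auto simp: von_neumann_algebra_def)
  then show "adjoint_closed D" "closed D"
    by (auto intro: star_subalgebra_adjoint_closed) (metis closed_commutant)
  have "id_blinfun \<in> commutant (commutant D)" by (intro commutantI bounded_ops_id) auto
  then show "id_blinfun \<in> D" by (simp add: \<open>commutant (commutant D) = D\<close>)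
qed

text \<open>If a selfadjoint family leaves \<open>V\<close> invariant, it leaves the orthogonal complement invariant too,
  so the projection onto \<open>V\<close> commutes with the family. This is the way in which projections of
  commutants are produced below.\<close>

lemma projection_in_commutant:
  assumes S: "adjoint_closed S" and V: "closed V" "subspace V" "\<And>c x. x \<in> V \<Longrightarrow> c *\<^sub>C x \<in> V"
    and inv: "\<And>R x. R \<in> S \<Longrightarrow> x \<in> V \<Longrightarrow> R x \<in> V"
  shows "\<exists>P\<in>commutant S. symmetric P \<and> P o\<^sub>L P = P \<and> (\<forall>x. P x \<in> V) \<and> (\<forall>x\<in>V. P x = x)"
proof -
  obtain P where P: "\<And>x. blinfun_apply P x \<in> V" "\<And>x v. v \<in> V \<Longrightarrow> inner (x - P x) v = 0"
    using orthogonal_projection_exists[OF V(1,2)] by blast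
  have uniq: "P x = y" if "y \<in> V" "\<And>v. v \<in> V \<Longrightarrow> inner (x - y) v = 0" for x y
    by (rule orthogonal_component_unique[OF V(2) P(1) that(1) P(2) that(2)])
  have fixed: "P x = x" if "x \<in> V" for x using uniq[of x x] that by simp
  have sym: "symmetric P"
    unfolding symmetric_def
  proof (intro allI)
    fix x y
    have "inner (x - P x) (P y) = 0" "inner (y - P y) (P x) = 0" using P by auto
    then show "inner (P x) y = inner x (P y)"
      by (simp add: inner_diff_left) (metis inner_commute)
  qed
  have "P \<in> commutant S"
  proof (rule commutantI)
    have "P (c *\<^sub>C x) = c *\<^sub>C P x" for c x
    proof (rule uniq)
      show "c *\<^sub>C P x \<in> V" by (intro V P)
      show "inner (c *\<^sub>C x - c *\<^sub>C P x) v = 0" if "v \<in> V" for v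
        using P(2)[OF V(3)[OF that], of x] by (simp add: scaleC_diff_right[symmetric] inner_scaleC_left)
    qed
    then show "P \<in> bounded_ops" by (simp add: bounded_ops_def)
    fix R x assume R: "R \<in> S"
    then have aR: "adj R \<in> S" "R \<in> bounded_ops" using S by (auto simp: adjoint_closed_def)
    show "P (R x) = R (P x)"
    proof (rule uniq)
      show "R (P x) \<in> V" by (intro inv R P)
      show "inner (R x - R (P x)) v = 0" if "v \<in> V" for v
        using P(2)[OF inv[OF aR(1) that], of x]
        by (simp add: blinfun.diff_right[symmetric] inner_adj_right[OF aR(2)])
    qed
  qed
  then show ?thesis using P fixed sym by (intro bexI[of _ P]) (auto intro: blinfun_eqI)
qed

section \<open>The sign of a selfadjoint operator\<close>


definition positive :: "('a::real_inner \<Rightarrow>\<^sub>L 'a) \<Rightarrow> bool" where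
  "positive T \<longleftrightarrow> symmetric T \<and> (\<forall>x. 0 \<le> inner (T x) x)"

lemma symmetricD: "symmetric T \<Longrightarrow> inner (T x) y = inner x (T y)"
  by (simp add: symmetric_def)

lemma symmetric_diff: "symmetric S \<Longrightarrow> symmetric T \<Longrightarrow> symmetric (S - T)"
  by (simp add: symmetric_def blinfun.diff_left inner_diff_left inner_diff_right)

lemma symmetric_add: "symmetric S \<Longrightarrow> symmetric T \<Longrightarrow> symmetric (S + T)"
  by (simp add: symmetric_def blinfun.add_left inner_add_left inner_add_right)

lemma symmetric_scaleR: "symmetric T \<Longrightarrow> symmetric (r *\<^sub>R T)"
  by (simp add: symmetric_def blinfun.scaleR_left)

lemma symmetric_id: "symmetric id_blinfun"
  by (simp add: symmetric_def)

lemma symmetric_compose: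
  "symmetric S \<Longrightarrow> symmetric T \<Longrightarrow> (\<And>x. blinfun_apply S (blinfun_apply T x) = T (S x)) \<Longrightarrow> symmetric (S o\<^sub>L T)"
  by (simp add: symmetric_def)

text \<open>The argument of Riesz and Nagy. With \<open>a\<^sub>0 = a\<close> and \<open>a\<^sub>n\<^sub>+\<^sub>1 = a\<^sub>n - a\<^sub>n\<^sup>2\<close> one has
  \<open>a = (\<Sum>i<n. a\<^sub>i\<^sup>2) + a\<^sub>n\<close> and \<open>a\<^sub>n \<rightarrow> 0\<close> strongly, so that \<open>a b\<close> is a strong limit of sums of the
  positive operators \<open>a\<^sub>i b a\<^sub>i\<close>.\<close>

lemma positive_product_contraction:
  fixes a b :: "'a::real_inner \<Rightarrow>\<^sub>L 'a"
  assumes a: "positive a" "\<And>x. inner (a x) x \<le> inner x x" and b: "positive b"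
    and ab: "\<And>x. a (b x) = b (a x)"
  shows "0 \<le> inner (a (b x)) x"
proof -
  define A where "A n = ((\<lambda>t. t - (t o\<^sub>L t)) ^^ n) a" for n
  have A0: "A 0 = a" and AS: "A (Suc n) = A n - (A n o\<^sub>L A n)" for n by (simp_all add: A_def)
  have sym: "symmetric (A n)" and comm: "A n (b x) = b (A n x)" for n x
    by (induction n arbitrary: x)
      (use a ab in \<open>auto simp: A0 AS positive_def symmetric_def blinfun.diff_left blinfun.diff_right inner_diff_left inner_diff_right\<close>)
  have s2: "inner (A n (A n x)) y = inner (A n x) (A n y)" for n x y by (rule symmetricD[OF sym])
  have step: "inner (A (Suc n) x) x = inner (A n x) x - inner (A n x) (A n x)" for n x
  proof -
    have "inner (A (Suc n) x) x = inner (A n x) x - inner (A n (A n x)) x"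
      unfolding AS by (simp add: blinfun.diff_left inner_diff_left)
    then show ?thesis unfolding s2 .
  qed
  have bds: "0 \<le> inner (A n x) x \<and> inner (A n x) x \<le> inner x x" for n x
  proof (induction n arbitrary: x)
    case 0
    then show ?case using a by (simp add: A0 positive_def)
  next
    case (Suc n)
    let ?t = "A n"
    \<comment> \<open>The identity \<open>t - t\<^sup>2 = t (1 - t) t + (1 - t) t (1 - t)\<close>.\<close>
    have "inner (?t x) x - inner (?t x) (?t x)
        = (inner (?t x) (?t x) - inner (?t (?t x)) (?t x)) + inner (?t (x - ?t x)) (x - ?t x)"
      by (simp add: blinfun.diff_right inner_diff_left inner_diff_right s2)
    moreover have "inner (?t (?t x)) (?t x) \<le> inner (?t x) (?t x)" "0 \<le> inner (?t (x - ?t x)) (x - ?t x)"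
      using Suc by blast+
    ultimately show ?case using Suc[of x] inner_ge_zero[of "?t x"] unfolding step by linarith
  qed
  have le: "(\<Sum>i<n. (norm (A i z))\<^sup>2) \<le> inner (a z) z" for n z
  proof -
    have "(\<Sum>i<n. (norm (A i z))\<^sup>2) = inner (a z) z - inner (A n z) z"
      by (induction n) (simp_all add: A0 step power2_norm_eq_inner)
    then show ?thesis using bds[of n z] by simp
  qed
  have "summable (\<lambda>i. (norm (A i z))\<^sup>2)" for z
  proof (rule bounded_imp_summable)
    show "(\<Sum>i\<le>n. (norm (A i z))\<^sup>2) \<le> inner (a z) z" for n
      using le[where n = "Suc n"] by (simp only: lessThan_Suc_atMost)
  qed simp
  then have "(\<lambda>i. (norm (A i z))\<^sup>2) \<longlonglongrightarrow> 0" for z by (rule summable_LIMSEQ_zero)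
  then have "(\<lambda>i. sqrt ((norm (A i z))\<^sup>2)) \<longlonglongrightarrow> sqrt 0" for z by (intro tendsto_real_sqrt)
  then have A_null: "(\<lambda>i. A i z) \<longlonglongrightarrow> 0" for z by (simp add: tendsto_norm_zero_iff)
  have "inner (A n (b x)) x \<le> inner (a (b x)) x" for n
  proof (induction n)
    case (Suc n)
    have "0 \<le> inner (b (A n x)) (A n x)" using b by (simp add: positive_def)
    also have "\<dots> = inner (A n (A n (b x))) x" by (simp only: comm[symmetric] symmetricD[OF sym, symmetric])
    finally show ?case using Suc by (simp add: AS blinfun.diff_left inner_diff_left)
  qed (simp add: A0)
  moreover have "(\<lambda>n. inner (A n (b x)) x) \<longlonglongrightarrow> inner 0 x" by (intro tendsto_inner A_null tendsto_const)
  ultimately show ?thesis by (intro LIMSEQ_le_const2[where X = "\<lambda>n. inner (A n (b x)) x"]) auto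
qed

lemma positive_compose:
  fixes a b :: "'a::real_inner \<Rightarrow>\<^sub>L 'a"
  assumes a: "positive a" and b: "positive b" and ab: "\<And>x. a (b x) = b (a x)"
  shows "positive (a o\<^sub>L b)"
proof -
  define r where "r = 1 / (norm a + 1)"
  have n1: "norm a + 1 > 0" using norm_ge_zero[of a] by linarith
  then have r: "r > 0" by (simp add: r_def)
  have "0 \<le> inner ((r *\<^sub>R a) (b x)) x" for x
  proof (rule positive_product_contraction)
    show "positive (r *\<^sub>R a)" using a r
      by (auto simp: positive_def symmetric_scaleR blinfun.scaleR_left)
    show "inner ((r *\<^sub>R a) x) x \<le> inner x x" for x
    proof -
      have "inner (a x) x \<le> norm (a x) * norm x" by (rule norm_cauchy_schwarz)
      also have "\<dots> \<le> (norm a * norm x) * norm x" by (intro mult_right_mono norm_blinfun) auto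
      also have "\<dots> \<le> (norm a + 1) * inner x x"
        by (simp add: power2_norm_eq_inner[symmetric] power2_eq_square algebra_simps)
      finally show ?thesis using n1 by (simp add: r_def blinfun.scaleR_left field_simps)
    qed
  qed (use b ab in \<open>auto simp: blinfun.scaleR_left blinfun.scaleR_right\<close>)
  then have "0 \<le> inner (a (b x)) x" for x using r by (simp add: blinfun.scaleR_left zero_le_mult_iff)
  then show ?thesis using a b ab by (auto simp: positive_def symmetric_compose)
qed

text \<open>Real polynomials in an operator, in the form that suits inductive proofs that they commute with
  whatever commutes with the argument and lie in every unital algebra containing it.\<close>

inductive_set poly_in :: "('a::real_normed_vector \<Rightarrow>\<^sub>L 'a) \<Rightarrow> ('a \<Rightarrow>\<^sub>L 'a) set" for y where
  poly_id: "id_blinfun \<in> poly_in y"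
| poly_arg: "y \<in> poly_in y"
| poly_add: "S \<in> poly_in y \<Longrightarrow> T \<in> poly_in y \<Longrightarrow> S + T \<in> poly_in y"
| poly_compose: "S \<in> poly_in y \<Longrightarrow> T \<in> poly_in y \<Longrightarrow> S o\<^sub>L T \<in> poly_in y"
| poly_scaleR: "T \<in> poly_in y \<Longrightarrow> r *\<^sub>R T \<in> poly_in y"

lemma poly_in_commute:
  fixes S T y :: "'a::real_normed_vector \<Rightarrow>\<^sub>L 'a"
  assumes "T \<in> poly_in y" and "\<And>x. S (y x) = y (S x)"
  shows "S (T x) = T (S x)"
  using assms(1)
  by (induction arbitrary: x) (simp_all add: assms(2) blinfun.add_left blinfun.add_right
      blinfun.scaleR_left blinfun.scaleR_right)

lemma poly_in_symmetric:
  assumes "T \<in> poly_in y" and "symmetric y"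
  shows "symmetric T"
  using assms(1)
proof induction
  case (poly_compose S T)
  have "S (y x) = y (S x)" for x by (rule poly_in_commute[OF poly_compose(1), symmetric]) simp
  then show ?case
    by (intro symmetric_compose poly_compose poly_in_commute[OF poly_compose(2)])
qed (auto simp: assms symmetric_id symmetric_add symmetric_scaleR)

text \<open>Expanding the square, the second hypothesis gives
  \<open>\<parallel>T\<^sub>k x - T\<^sub>l x\<parallel>\<^sup>2 \<le> \<parallel>T\<^sub>k x\<parallel>\<^sup>2 - \<parallel>T\<^sub>l x\<parallel>\<^sup>2\<close>, and the right hand side comes from a bounded monotone
  sequence of reals. Partial sums of orthogonal series satisfy it with equality.\<close>

lemma monotone_strong_convergence:
  fixes T :: "nat \<Rightarrow> 'a::{real_inner,complete_space} \<Rightarrow>\<^sub>L 'a"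
  assumes bound: "\<And>k x. norm (T k x) \<le> norm x"
    and pyth: "\<And>l k x. l \<le> k \<Longrightarrow> (norm (T l x))\<^sup>2 \<le> inner (T k x) (T l x)"
  shows "\<exists>S::'a \<Rightarrow>\<^sub>L 'a. (\<forall>x. (\<lambda>k. T k x) \<longlonglongrightarrow> S x) \<and> (\<forall>x. norm (S x) \<le> norm x)"
proof -
  have le: "(norm (T k x - T l x))\<^sup>2 \<le> (norm (T k x))\<^sup>2 - (norm (T l x))\<^sup>2" if "l \<le> k" for k l x
    using pyth[OF that, of x] by (simp add: power2_norm_eq_inner inner_diff_left inner_diff_right inner_commute)
  have "Cauchy (\<lambda>k. T k x)" for x
  proof -
    have "(norm (T l x))\<^sup>2 \<le> (norm (T k x))\<^sup>2" if "l \<le> k" for l k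
      using le[OF that, of x] zero_le_power2[of "norm (T k x - T l x)"] by linarith
    then have "incseq (\<lambda>k. (norm (T k x))\<^sup>2)" by (simp add: incseq_def)
    moreover have "\<forall>k. (norm (T k x))\<^sup>2 \<le> (norm x)\<^sup>2" by (simp add: bound power_mono)
    ultimately obtain L where "(\<lambda>k. (norm (T k x))\<^sup>2) \<longlonglongrightarrow> L"
      using incseq_convergent by blast
    then have "convergent (\<lambda>k. (norm (T k x))\<^sup>2)" by (rule convergentI)
    then have C: "Cauchy (\<lambda>k. (norm (T k x))\<^sup>2)" by (simp add: Cauchy_convergent_iff)
    show ?thesis
    proof (rule metric_CauchyI)
      fix e :: real assume e: "e > 0"
      then obtain N where N: "\<And>m n. m \<ge> N \<Longrightarrow> n \<ge> N \<Longrightarrow> dist ((norm (T m x))\<^sup>2) ((norm (T n x))\<^sup>2) < e\<^sup>2"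
        using metric_CauchyD[OF C, of "e\<^sup>2"] by auto
      have *: "dist (T m x) (T n x) < e" if "m \<ge> N" "n \<ge> N" "n \<le> m" for m n
      proof -
        have "(norm (T m x - T n x))\<^sup>2 < e\<^sup>2"
          using le[OF that(3), of x] N[OF that(1,2)] by (simp add: dist_real_def)
        then show ?thesis using e by (simp add: dist_norm power2_less_imp_less)
      qed
      have "dist (T m x) (T n x) < e" if "m \<ge> N" "n \<ge> N" for m n
        using *[of m n] *[of n m] that by (cases "n \<le> m") (auto simp: dist_commute)
      then show "\<exists>N. \<forall>m\<ge>N. \<forall>n\<ge>N. dist (T m x) (T n x) < e" by blast
    qed
  qed
  then show ?thesis using strong_limit_exists[of T 1] bound by simp
qed

text \<open>The partial isometry \<open>s\<close> of the polar decomposition \<open>x = s \<bar>x\<bar>\<close> of a selfadjoint \<open>x\<close>: here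
  \<open>s\<^sup>2\<close> is a projection with \<open>s\<^sup>2 x = x\<close>, and \<open>\<bar>x\<bar> = s x\<close>.\<close>

definition is_sign :: "('a::real_inner \<Rightarrow>\<^sub>L 'a) \<Rightarrow> ('a \<Rightarrow>\<^sub>L 'a) \<Rightarrow> bool" where
  "is_sign x s \<longleftrightarrow> symmetric s \<and> (\<forall>v. norm (s v) \<le> norm v) \<and> (\<forall>v. s (x v) = x (s v))
     \<and> (\<forall>v. s (s (x v)) = x v) \<and> (\<forall>v. s (s (s v)) = s v) \<and> (\<forall>v. 0 \<le> inner (s (x v)) v)"

text \<open>The Newton-Schulz iteration \<open>X\<^sub>k\<^sub>+\<^sub>1 = X\<^sub>k (3 - X\<^sub>k\<^sup>2) / 2\<close>, started at a multiple of \<open>x\<close> of norm at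
  most one, preserves the interval \<open>[-1, 1]\<close>, is odd and moves every nonzero number towards its sign.
  All \<open>X\<^sub>k\<^sup>2\<close> increase with \<open>k\<close>, which gives strong convergence, and the limit satisfies the fixed
  point equation \<open>s = s\<^sup>3\<close>. Writing \<open>X\<^sub>k = x q\<^sub>k\<close> with \<open>q\<^sub>k\<close> a polynomial in \<open>x\<^sup>2\<close> matters later: when
  \<open>x\<close> normalizes an algebra \<open>A\<close>, the operator \<open>x\<close> is in general outside of \<open>A\<close>, but \<open>x\<^sup>2\<close> and with it
  \<open>q\<^sub>k\<close> belong to \<open>A\<close>.\<close>

lemma symmetric_sign:
  fixes x :: "'a::{real_inner,complete_space} \<Rightarrow>\<^sub>L 'a"
  assumes x: "symmetric x"
  shows "\<exists>(s :: 'a \<Rightarrow>\<^sub>L 'a) (q :: nat \<Rightarrow> 'a \<Rightarrow>\<^sub>L 'a). is_sign x s \<and> (\<forall>k. q k \<in> poly_in (x o\<^sub>L x))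
     \<and> (\<forall>v. (\<lambda>k. x (q k v)) \<longlonglongrightarrow> s v) \<and> (\<forall>k v. norm (x (q k v)) \<le> norm v)"
proof -
  define c where "c = 1 / (norm x + 1)"
  have n1: "norm x + 1 > 0" using norm_ge_zero[of x] by linarith
  then have c: "c > 0" by (simp add: c_def)
  define q where "q k = ((\<lambda>t. (1/2) *\<^sub>R (t o\<^sub>L (3 *\<^sub>R id_blinfun + (-1) *\<^sub>R ((x o\<^sub>L x) o\<^sub>L (t o\<^sub>L t))))) ^^ k)
      (c *\<^sub>R id_blinfun)" for k
  have q0: "q 0 = c *\<^sub>R id_blinfun"
    and qS: "q (Suc k) = (1/2) *\<^sub>R (q k o\<^sub>L (3 *\<^sub>R id_blinfun + (-1) *\<^sub>R ((x o\<^sub>L x) o\<^sub>L (q k o\<^sub>L q k))))" for k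
    by (simp_all add: q_def)
  have qpoly: "q k \<in> poly_in (x o\<^sub>L x)" for k
  proof (induction k)
    case 0
    show ?case unfolding q0 by (intro poly_in.intros)
  next
    case (Suc k)
    show ?case unfolding qS by (intro poly_in.intros Suc)
  qed
  have xq: "x (q k v) = q k (x v)" for k v
    by (rule poly_in_commute[OF qpoly]) simp
  have qq: "q k (q l v) = q l (q k v)" for k l v
    by (rule poly_in_commute[OF qpoly]) (simp add: xq)
  have sx: "inner (x u) v = inner u (x v)" for u v by (rule symmetricD[OF x])
  have "symmetric (x o\<^sub>L x)" by (simp add: symmetric_compose x)
  then have qsym: "symmetric (q k)" for k by (rule poly_in_symmetric[OF qpoly])
  have sq: "inner (q k u) v = inner u (q k v)" for k u v by (rule symmetricD[OF qsym])
  define X where "X k = x o\<^sub>L q k" for k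
  have Xv: "X k v = x (q k v)" for k v by (simp add: X_def)
  have sX: "inner (X k u) v = inner u (X k v)" for k u v by (simp add: Xv sx sq xq)
  have Xsym: "symmetric (X k)" for k by (simp add: symmetric_def sX)
  have Xq: "X k (q l v) = q l (X k v)" for k l v by (simp add: Xv xq qq)
  have three: "3 *\<^sub>R u = 2 *\<^sub>R u + u" for u :: 'a using scaleR_add_left[of 2 1 u] by simp
  have qSv: "q (Suc k) v = (1/2) *\<^sub>R (3 *\<^sub>R q k v - q k (X k (X k v)))" for k v
    by (simp add: qS Xv xq blinfun.add_left blinfun.scaleR_left blinfun.diff_left
        blinfun.add_right blinfun.scaleR_right blinfun.minus_right blinfun.diff_right)
  have XSv: "X (Suc k) v = (1/2) *\<^sub>R (3 *\<^sub>R X k v - X k (X k (X k v)))" for k v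
    by (simp add: Xv qSv blinfun.scaleR_right blinfun.diff_right)
  have Xle: "norm (X k v) \<le> norm v" for k v
  proof (induction k arbitrary: v)
    case 0
    have "norm (x v) \<le> norm x * norm v" by (rule norm_blinfun)
    also have "\<dots> \<le> (norm x + 1) * norm v" by (intro mult_right_mono) auto
    finally show ?case using n1 by (simp add: Xv q0 c_def blinfun.scaleR_left blinfun.scaleR_right field_simps)
  next
    case (Suc k)
    have ineq: "p = r - 1/4 * (4 * a - b) \<Longrightarrow> b \<le> a \<Longrightarrow> 0 \<le> a \<Longrightarrow> p \<le> r" for p r a b :: real
      by (simp add: field_simps)
    define u1 u2 u3 where "u1 = X k v" and "u2 = X k u1" and "u3 = X k u2"
    have m: "inner u1 u1 = inner v u2" "inner u1 u3 = inner u2 u2" "inner u1 u2 = inner v u3"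
      by (simp_all add: u1_def u2_def u3_def sX)
    \<comment> \<open>The identity \<open>1 - X\<^sub>k\<^sub>+\<^sub>1\<^sup>2 = (1 - X\<^sub>k\<^sup>2) (4 - X\<^sub>k\<^sup>2) (1 - X\<^sub>k\<^sup>2) / 4\<close>, evaluated at \<open>v\<close>.\<close>
    have "inner (X (Suc k) v) (X (Suc k) v) = inner v v - (1/4) * (4 * inner (v - u2) (v - u2) - inner (u1 - u3) (u1 - u3))"
      using m by (simp add: XSv u1_def[symmetric] u2_def[symmetric] u3_def[symmetric]
          inner_diff_left inner_diff_right inner_commute algebra_simps)
    moreover have "u1 - u3 = X k (v - u2)" by (simp add: u1_def u2_def u3_def blinfun.diff_right)
    then have "inner (u1 - u3) (u1 - u3) \<le> inner (v - u2) (v - u2)" using Suc[of "v - u2"] by (simp add: norm_le)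
    ultimately have "inner (X (Suc k) v) (X (Suc k) v) \<le> inner v v"
      using inner_ge_zero[of "v - u2"] ineq by blast
    then show ?case by (simp add: norm_le)
  qed
  have Xpos: "positive (id_blinfun - (X k o\<^sub>L X k))" for k
    unfolding positive_def
  proof (intro conjI allI)
    show "symmetric (id_blinfun - (X k o\<^sub>L X k))"
      by (intro symmetric_diff symmetric_id symmetric_compose Xsym) simp
    show "0 \<le> inner ((id_blinfun - (X k o\<^sub>L X k)) v) v" for v
      using Xle[of k v] by (simp add: blinfun.diff_left inner_diff_left sX norm_le)
  qed
  have qpos: "positive (q k)" for k
  proof (induction k)
    case 0
    then show ?case using c by (auto simp: q0 positive_def symmetric_scaleR symmetric_id blinfun.scaleR_left)
  next
    case (Suc k)
    have "0 \<le> inner (q (Suc k) v) v" for v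
    proof -
      have "positive (q k o\<^sub>L (id_blinfun - (X k o\<^sub>L X k)))"
        by (intro positive_compose Suc Xpos) (simp add: blinfun.diff_left blinfun.diff_right Xq)
      then have "0 \<le> inner (q k v - q k (X k (X k v))) v"
        unfolding positive_def by (simp add: blinfun.diff_left blinfun.diff_right)
      moreover have "0 \<le> inner (q k v) v" using Suc by (simp add: positive_def)
      ultimately show ?thesis by (simp add: qSv inner_diff_left)
    qed
    then show ?case using qsym by (simp add: positive_def)
  qed
  have pyth: "(norm (X l v))\<^sup>2 \<le> inner (X k v) (X l v)" if "l \<le> k" for l k v
    using that
  proof (induction k rule: dec_induct)
    case base
    then show ?case by (simp add: power2_norm_eq_inner)
  next
    case (step k)
    \<comment> \<open>\<open>2 (X\<^sub>k\<^sub>+\<^sub>1 - X\<^sub>k) X\<^sub>l = x q\<^sub>k q\<^sub>l (1 - X\<^sub>k\<^sup>2) x\<close>, with commuting positive factors in the middle.\<close>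
    have "positive ((q k o\<^sub>L q l) o\<^sub>L (id_blinfun - (X k o\<^sub>L X k)))"
      by (intro positive_compose qpos Xpos)
        (simp_all add: blinfun.diff_left blinfun.diff_right Xq qq[of l k])
    then have "0 \<le> inner (((q k o\<^sub>L q l) o\<^sub>L (id_blinfun - (X k o\<^sub>L X k))) (x v)) (x v)"
      by (simp add: positive_def)
    also have "\<dots> = 2 * inner (X (Suc k) v - X k v) (X l v)"
    proof -
      have "2 *\<^sub>R (X (Suc k) v - X k v) = X k v - X k (X k (X k v))"
        by (simp add: XSv scaleR_diff_right three)
      moreover have "((q k o\<^sub>L q l) o\<^sub>L (id_blinfun - (X k o\<^sub>L X k))) (x v) = q l (X k v - X k (X k (X k v)))"
        by (simp add: blinfun.diff_left blinfun.diff_right Xv xq qq[of k l])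
      ultimately have "((q k o\<^sub>L q l) o\<^sub>L (id_blinfun - (X k o\<^sub>L X k))) (x v) = q l (2 *\<^sub>R (X (Suc k) v - X k v))"
        by simp
      then show ?thesis by (simp add: sq Xv xq blinfun.scaleR_right)
    qed
    finally show ?case using step by (simp add: inner_diff_left)
  qed
  obtain s where s: "\<And>v. (\<lambda>k. X k v) \<longlonglongrightarrow> blinfun_apply s v" and sle: "\<And>v. norm (s v) \<le> norm v"
    using monotone_strong_convergence[of X, OF Xle pyth] by blast
  have ssym: "inner (s u) v = inner u (s v)" for u v
    by (rule LIMSEQ_unique[of "\<lambda>k. inner (X k u) v"]) (intro tendsto_intros s, simp add: sX, intro tendsto_intros s)
  have sx2: "s (x v) = x (s v)" for v
  proof (rule LIMSEQ_unique[OF s])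
    have "(\<lambda>k. x (X k v)) \<longlonglongrightarrow> x (s v)" by (intro tendsto_intros s)
    then show "(\<lambda>k. X k (x v)) \<longlonglongrightarrow> x (s v)" by (simp add: Xv xq)
  qed
  have s2: "(\<lambda>k. X k (X k v)) \<longlonglongrightarrow> s (s v)" for v
    by (rule strong_limit_compose[where K = 1]) (simp_all add: s Xle)
  have s3: "(\<lambda>k. X k (X k (X k v))) \<longlonglongrightarrow> s (s (s v))" for v
    by (rule strong_limit_compose[where K = 1]) (simp_all add: s Xle s2)
  have sss: "s (s (s v)) = s v" for v
  proof -
    have "(\<lambda>k. X (Suc k) v) \<longlonglongrightarrow> (1/2) *\<^sub>R (3 *\<^sub>R s v - s (s (s v)))"
      unfolding XSv by (intro tendsto_intros s s3)
    then have "s v = (1/2) *\<^sub>R (3 *\<^sub>R s v - s (s (s v)))"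
      using LIMSEQ_unique LIMSEQ_Suc[OF s] by blast
    from arg_cong[OF this, of "\<lambda>z. 2 *\<^sub>R z"] have "2 *\<^sub>R s v = 3 *\<^sub>R s v - s (s (s v))" by simp
    then show ?thesis by (simp add: three algebra_simps)
  qed
  have "s (s (x v)) = x v" for v
  proof -
    \<comment> \<open>On the kernel of \<open>s\<close> the increasing sequence \<open>\<parallel>X\<^sub>k w\<parallel>\<close> tends to 0, so already \<open>X\<^sub>0 w = c x w\<close> vanishes.\<close>
    define w where "w = v - s (s v)"
    have "s w = 0" by (simp add: w_def blinfun.diff_right sss)
    then have "(\<lambda>k. norm (X k w)) \<longlonglongrightarrow> 0" using tendsto_norm[OF s[of w]] by simp
    moreover have "norm (X 0 w) \<le> norm (X k w)" for k
    proof -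
      have "norm (X 0 w) * norm (X 0 w) \<le> norm (X k w) * norm (X 0 w)"
        using pyth[of 0 k w] norm_cauchy_schwarz[of "X k w" "X 0 w"] by (simp add: power2_eq_square)
      then show ?thesis by (cases "X 0 w = 0") auto
    qed
    ultimately have "norm (X 0 w) \<le> 0" by (intro LIMSEQ_le_const) auto
    then have "x w = 0" using c by (simp add: Xv q0 blinfun.scaleR_left blinfun.scaleR_right mult_le_0_iff)
    then have "x v = x (s (s v))" by (simp add: w_def blinfun.diff_right)
    then show ?thesis by (metis sx2)
  qed
  moreover have "0 \<le> inner (s (x v)) v" for v
  proof (rule LIMSEQ_le_const)
    show "(\<lambda>k. inner (X k (x v)) v) \<longlonglongrightarrow> inner (s (x v)) v" by (intro tendsto_intros s)
    have "0 \<le> inner (q k (x v)) (x v)" for k using qpos by (simp add: positive_def)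
    then show "\<exists>N. \<forall>k\<ge>N. 0 \<le> inner (X k (x v)) v" by (simp add: Xv sx)
  qed
  ultimately show ?thesis
    by (intro exI[of _ s] exI[of _ q])
      (use qpoly s sle Xle ssym sx2 sss in \<open>auto simp: Xv symmetric_def is_sign_def\<close>)
qed

lemma poly_in_subset:
  assumes "star_subalgebra D" and "id_blinfun \<in> D" and "y \<in> D"
  shows "poly_in y \<subseteq> D"
proof
  fix T assume "T \<in> poly_in y"
  then show "T \<in> D" by induction (use assms in \<open>auto intro: star_subalgebraD\<close>)
qed

lemma sign_in_von_neumann_algebra:
  assumes D: "von_neumann_algebra D" and x: "x \<in> D" "symmetric x"
  shows "\<exists>s\<in>D. is_sign x s"
proof -
  note D' = von_neumannD[OF D]
  obtain s :: "'a \<Rightarrow>\<^sub>L 'a" and q :: "nat \<Rightarrow> 'a \<Rightarrow>\<^sub>L 'a" where s: "is_sign x s"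
    and q: "\<And>k. q k \<in> poly_in (x o\<^sub>L x)" "\<And>v. (\<lambda>k. x (q k v)) \<longlonglongrightarrow> s v"
    using symmetric_sign[OF x(2)] by blast
  have "x o\<^sub>L q k \<in> commutant (commutant D)" for k
    using q(1)[of k] poly_in_subset[OF D'(1,5), of "x o\<^sub>L x"] x(1) D'(1,2) star_subalgebraD(4) by blast
  then have "s \<in> commutant (commutant D)" by (rule commutant_strong_limit[where T = "\<lambda>k. x o\<^sub>L q k"]) (simp add: q(2))
  then show ?thesis using s D'(2) by auto
qed

section \<open>Projections span a von Neumann algebra\<close>


lemma commutativeD: "commutative C \<Longrightarrow> S \<in> C \<Longrightarrow> T \<in> C \<Longrightarrow> S (T x) = T (S x)"
  unfolding commutative_def by (metis blinfun_apply_blinfun_compose)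

lemma projectionsD:
  assumes "p \<in> projections A" and "A \<subseteq> bounded_ops"
  shows "p \<in> A" "p (p x) = p x" "inner (p x) y = inner x (p y)" "norm (p x) \<le> norm x" "p \<in> bounded_ops"
proof -
  have p: "p \<in> A" "p o\<^sub>L p = p" "adj p = p" using assms(1) by (auto simp: projections_def)
  then show "p \<in> A" and b: "p \<in> bounded_ops" using assms(2) by auto
  show pp: "p (p x) = p x" for x using p(2) by (metis blinfun_apply_blinfun_compose)
  show sym: "inner (p x) y = inner x (p y)" for x y
    using inner_adj_right[OF b, of x y] p(3) by simp
  have "norm (p x) * norm (p x) = inner x (p x)"
    by (metis sym pp power2_norm_eq_inner power2_eq_square)
  also have "\<dots> \<le> norm x * norm (p x)" by (rule norm_cauchy_schwarz)
  finally show "norm (p x) \<le> norm x" by (cases "p x = 0") auto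
qed

lemma projectionsI:
  assumes "p \<in> A" and "A \<subseteq> bounded_ops" and "\<And>x. p (p x) = blinfun_apply p x" and "symmetric p"
  shows "p \<in> projections A"
  using assms by (auto simp: projections_def adj_eq_self_iff intro: blinfun_eqI)

text \<open>With \<open>h = \<bar>a\<bar> = s a\<close> one has \<open>(a - r s / 2)\<^sup>2 = h\<^sup>2 - r h + r\<^sup>2 s\<^sup>2 / 4\<close>, and \<open>h\<^sup>2 \<le> r h\<close> because
  \<open>0 \<le> h \<le> r\<close>. The scalar inequality behind it is \<open>\<bar>a - sgn(a) r / 2\<bar> \<le> r / 2\<close> for \<open>\<bar>a\<bar> \<le> r\<close>.\<close>

lemma sign_halves_distance:
  fixes a s :: "'a::{real_inner,complete_space} \<Rightarrow>\<^sub>L 'a"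
  assumes a: "symmetric a" and s: "is_sign a s" and r: "norm a \<le> r"
  shows "norm (a - (r/2) *\<^sub>R s) \<le> r/2"
proof (rule norm_blinfun_bound)
  have r0: "0 \<le> r" using r norm_ge_zero[of a] by linarith
  then show "0 \<le> r / 2" by simp
  fix v
  have s': "symmetric s" "\<And>v. norm (s v) \<le> norm v" "\<And>v. s (a v) = a (s v)"
     "\<And>v. s (s (a v)) = a v" "\<And>v. 0 \<le> inner (s (a v)) v"
    using s by (auto simp: is_sign_def)
  define h where "h = s o\<^sub>L a"
  have hv: "h v = s (a v)" for v by (simp add: h_def)
  have av: "norm (a v) \<le> r * norm v" for v
    using norm_blinfun[of a v] r by (meson mult_right_mono norm_ge_zero order_trans)
  have hsym: "symmetric h" unfolding h_def by (intro symmetric_compose s' a)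
  have h: "positive h" using hsym s'(5) by (simp add: positive_def hv)
  have "positive (r *\<^sub>R id_blinfun - h)"
    unfolding positive_def
  proof (intro conjI allI)
    show "symmetric (r *\<^sub>R id_blinfun - h)"
      by (intro symmetric_diff symmetric_scaleR symmetric_id hsym)
    fix v
    have "inner (h v) v \<le> norm (h v) * norm v" by (rule norm_cauchy_schwarz)
    also have "\<dots> \<le> (r * norm v) * norm v"
      by (intro mult_right_mono) (use s'(2)[of "a v"] av[of v] in \<open>auto simp: hv\<close>)
    finally show "0 \<le> inner ((r *\<^sub>R id_blinfun - h) v) v"
      by (simp add: blinfun.diff_left blinfun.scaleR_left inner_diff_left
          power2_norm_eq_inner[symmetric] power2_eq_square)
  qed
  then have "positive (h o\<^sub>L (r *\<^sub>R id_blinfun - h))"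
    by (intro positive_compose h) (simp_all add: blinfun.diff_left blinfun.diff_right
        blinfun.scaleR_left blinfun.scaleR_right)
  then have "0 \<le> inner (h (r *\<^sub>R v - h v)) v"
    by (simp add: positive_def blinfun.diff_left blinfun.scaleR_left)
  moreover have "h (h v) = a (a v)" by (simp add: hv s'(3)[symmetric] s'(4))
  ultimately have "inner (a (a v)) v \<le> r * inner (h v) v"
    by (simp add: blinfun.diff_right blinfun.scaleR_right inner_diff_left)
  then have "inner (a v) (a v) \<le> r * inner (a v) (s v)"
    by (simp add: symmetricD[OF a] hv symmetricD[OF s'(1)])
  moreover have "inner (s v) (s v) \<le> inner v v" using s'(2)[of v] by (simp add: norm_le)
  then have "r * r * inner (s v) (s v) \<le> r * r * inner v v" by (intro mult_left_mono) auto
  moreover have "inner (a v - (r/2) *\<^sub>R s v) (a v - (r/2) *\<^sub>R s v)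
      = inner (a v) (a v) - r * inner (a v) (s v) + r * r * inner (s v) (s v) / 4"
    by (simp add: inner_diff_left inner_diff_right inner_commute[of "s v" "a v"]) (simp add: field_simps)
  ultimately have "inner (a v - (r/2) *\<^sub>R s v) (a v - (r/2) *\<^sub>R s v) \<le> (r * r * inner v v) / 4"
    by linarith
  also have "\<dots> = (r / 2 * norm v)\<^sup>2"
    by (simp add: power2_norm_eq_inner[symmetric] power2_eq_square)
  finally have "(norm (a v - (r/2) *\<^sub>R s v))\<^sup>2 \<le> (r / 2 * norm v)\<^sup>2"
    by (simp add: power2_norm_eq_inner)
  then have "norm (a v - (r/2) *\<^sub>R s v) \<le> r / 2 * norm v"
    by (rule power2_le_imp_le) (use r0 in simp)
  then show "norm ((a - (r/2) *\<^sub>R s) v) \<le> r / 2 * norm v"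
    by (simp add: blinfun.diff_left blinfun.scaleR_left)
qed

text \<open>A sign is the difference of the spectral projections of the positive and of the negative half line,
  which are \<open>(s\<^sup>2 + s) / 2\<close> and \<open>(s\<^sup>2 - s) / 2\<close>.\<close>

lemma sign_in_span_of_projections:
  assumes D: "von_neumann_algebra D" and s: "s \<in> D" "is_sign a s"
    and V: "\<And>S T. S \<in> V \<Longrightarrow> T \<in> V \<Longrightarrow> S + T \<in> V" "\<And>c T. T \<in> V \<Longrightarrow> scaleC_op c T \<in> V"
      "projections D \<subseteq> V"
  shows "s \<in> V"
proof -
  note D' = von_neumannD[OF D] star_subalgebraD[OF von_neumannD(1)[OF D]]
  have s': "symmetric s" "\<And>v. s (s (s v)) = s v" using s by (auto simp: is_sign_def)
  have ss: "symmetric (s o\<^sub>L s)" by (intro symmetric_compose s') simp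
  define p q where "p = (1/2) *\<^sub>R ((s o\<^sub>L s) + s)" and "q = (1/2) *\<^sub>R ((s o\<^sub>L s) - s)"
  have b: "D \<subseteq> bounded_ops" using D'(6) by blast
  have quarter: "(1/4) *\<^sub>R (u + w + (w + u)) = (1/2) *\<^sub>R (u + w)"
    "(1/4) *\<^sub>R (u - w - (w - u)) = (1/2) *\<^sub>R (u - w)" for u w :: 'a
    using scaleR_2[of "u + w"] scaleR_2[of "u - w"]
    by (simp_all add: algebra_simps scaleR_2[symmetric])
  have "p \<in> projections D"
  proof (rule projectionsI[OF _ b])
    show "p \<in> D" unfolding p_def by (intro D' s)
    show "symmetric p" unfolding p_def by (intro symmetric_scaleR symmetric_add ss s')
    show "p (p x) = p x" for x
      by (simp add: p_def s' blinfun.scaleR_left blinfun.scaleR_right blinfun.add_left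
          blinfun.add_right scaleR_add_right[symmetric] quarter)
  qed
  moreover have "q \<in> projections D"
  proof (rule projectionsI[OF _ b])
    show "q \<in> D" unfolding q_def by (intro D' s)
    show "symmetric q" unfolding q_def by (intro symmetric_scaleR symmetric_diff ss s')
    show "q (q x) = q x" for x
      by (simp add: q_def s' blinfun.scaleR_left blinfun.scaleR_right blinfun.diff_left
          blinfun.diff_right scaleR_diff_right[symmetric] quarter)
  qed
  moreover have "s = p + scaleC_op (-1) q"
    by (intro blinfun_eqI)
      (simp add: p_def q_def blinfun.add_left blinfun.diff_left blinfun.scaleR_left scaleC_op.rep_eq
        scaleR_add_right scaleR_diff_right scaleR_add_left[symmetric])
  ultimately show ?thesis using V by (metis (no_types) subsetD)
qed

text \<open>Subtracting \<open>r / 2\<close> times the sign halves the norm bound \<open>r\<close> of a selfadjoint element, so iterating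
  it expands the element into a norm convergent binary series \<open>\<Sum>k. r s\<^sub>k / 2 ^ (k+1)\<close> of signs.\<close>

theorem projections_span_von_neumann_algebra:
  assumes D: "von_neumann_algebra D" and clV: "closed V"
    and V: "\<And>S T. S \<in> V \<Longrightarrow> T \<in> V \<Longrightarrow> S + T \<in> V" "\<And>c T. T \<in> V \<Longrightarrow> scaleC_op c T \<in> V"
      "projections D \<subseteq> V"
  shows "D \<subseteq> V"
proof
  note D' = von_neumannD[OF D] star_subalgebraD[OF von_neumannD(1)[OF D]]
  have b: "D \<subseteq> bounded_ops" using D'(6) by blast
  have V0: "0 \<in> V"
    using V(3) projectionsI[OF D'(7) b] by (auto simp: symmetric_def)
  have VR: "r *\<^sub>R T \<in> V" if "T \<in> V" for r T
    using V(2)[OF that, of "complex_of_real r"] by (simp add: scaleC_op_of_real)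
  have approx: "\<exists>v\<in>V. norm (a - v) \<le> r / 2 ^ k" if "a \<in> D" "symmetric a" "norm a \<le> r" for a r k
    using that
  proof (induction k arbitrary: a r)
    case 0
    then show ?case by (intro bexI[of _ 0] V0) simp
  next
    case (Suc k)
    obtain s where s: "s \<in> D" "is_sign a s" using sign_in_von_neumann_algebra[OF D Suc.prems(1,2)] by blast
    have sV: "s \<in> V" by (rule sign_in_span_of_projections[OF D s V])
    have "norm (a - (r/2) *\<^sub>R s) \<le> r/2" by (rule sign_halves_distance[OF Suc.prems(2) s(2) Suc.prems(3)])
    moreover have "a - (r/2) *\<^sub>R s \<in> D" by (intro D' Suc.prems s)
    moreover have "symmetric (a - (r/2) *\<^sub>R s)"
      using s by (intro symmetric_diff symmetric_scaleR Suc.prems) (simp add: is_sign_def)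
    ultimately obtain v where v: "v \<in> V" "norm (a - (r/2) *\<^sub>R s - v) \<le> r / 2 / 2 ^ k" using Suc.IH by blast
    have "(r/2) *\<^sub>R s + v \<in> V" by (intro V v VR sV)
    moreover have "norm (a - ((r/2) *\<^sub>R s + v)) \<le> r / 2 ^ Suc k" using v(2) by (simp add: algebra_simps)
    ultimately show ?case by blast
  qed
  have sa: "a \<in> V" if a: "a \<in> D" "symmetric a" for a
  proof -
    have "a \<in> closure V"
      unfolding closure_approachable
    proof (intro allI impI)
      fix e :: real assume e: "e > 0"
      have "0 < e / (norm a + 1)"
        by (intro divide_pos_pos e) (use norm_ge_zero[of a] in linarith)
      then obtain k where k: "(1/2) ^ k < e / (norm a + 1)"
        using real_arch_pow_inv[of "e / (norm a + 1)" "1/2"] by auto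
      obtain v where v: "v \<in> V" "norm (a - v) \<le> norm a / 2 ^ k" using approx[OF a order_refl] by blast
      have "norm a / 2 ^ k \<le> (norm a + 1) * (1/2) ^ k" by (simp add: power_one_over divide_simps)
      also have "\<dots> < e" using k norm_ge_zero[of a] by (simp add: field_simps)
      finally show "\<exists>y\<in>V. dist y a < e" using v by (intro bexI[of _ v]) (auto simp: dist_norm norm_minus_commute)
    qed
    then show ?thesis using clV by simp
  qed
  fix T assume T: "T \<in> D"
  then have Tb: "T \<in> bounded_ops" "adj T \<in> D" using b D' by auto
  define S1 S2 where "S1 = (1/2) *\<^sub>R (T + adj T)" and "S2 = scaleC_op (- \<i> / 2) (T - adj T)"
  have "S1 \<in> V"
  proof (rule sa)
    show "S1 \<in> D" unfolding S1_def by (intro D' T Tb)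
    show "symmetric S1" unfolding S1_def symmetric_def
      by (simp add: blinfun.scaleR_left blinfun.add_left inner_add_left inner_add_right inner_adj_left inner_adj_right Tb)
  qed
  moreover have "S2 \<in> V"
  proof (rule sa)
    show "S2 \<in> D" unfolding S2_def by (intro D' T Tb)
    have "adj S2 = S2"
    proof -
      have "adj (T - adj T) = adj T - T"
        by (rule adj_eqI) (use D'(13)[OF T Tb(2)] b Tb in \<open>auto simp: blinfun.diff_left
            inner_diff_left inner_diff_right inner_adj_left inner_adj_right\<close>)
      also have "\<dots> = - (T - adj T)" by simp
      finally show ?thesis unfolding S2_def using D'(13)[OF T Tb(2)] b
        by (subst adj_scaleC) (auto simp: cop.scale_right_diff_distrib)
    qed
    then show "symmetric S2" using \<open>S2 \<in> D\<close> b by (simp add: adj_eq_self_iff subset_iff)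
  qed
  moreover have "T = S1 + scaleC_op \<i> S2"
  proof -
    have "scaleC_op \<i> S2 = scaleC_op (complex_of_real (1/2)) (T - adj T)" by (simp add: S2_def)
    also have "\<dots> = (1/2) *\<^sub>R (T - adj T)" by (rule scaleC_op_of_real)
    finally show ?thesis by (simp add: S1_def scaleR_add_right[symmetric] scaleR_half_double)
  qed
  ultimately show "T \<in> V" using V by auto
qed

section \<open>Density in the double commutant\<close>


lemma closure_subspace:
  fixes V :: "'a::real_normed_vector set"
  assumes "subspace V"
  shows "subspace (closure V)"
  unfolding subspace_def
proof (intro conjI ballI allI)
  show "0 \<in> closure V" using subspace_0[OF assms] closure_subset by blast
next
  fix x y assume "x \<in> closure V" "y \<in> closure V"
  then obtain f g where "\<And>n. f n \<in> V" "f \<longlonglongrightarrow> x" "\<And>n. g n \<in> V" "g \<longlonglongrightarrow> y"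
    by (auto simp: closure_sequential)
  then show "x + y \<in> closure V"
    unfolding closure_sequential
    by (intro exI[of _ "\<lambda>n. f n + g n"]) (auto intro: subspace_add[OF assms] tendsto_add)
next
  fix r x assume "x \<in> closure V"
  then obtain f where "\<And>n. f n \<in> V" "f \<longlonglongrightarrow> x" by (auto simp: closure_sequential)
  then show "r *\<^sub>R x \<in> closure V"
    unfolding closure_sequential
    by (intro exI[of _ "\<lambda>n. r *\<^sub>R f n"]) (auto intro: subspace_scale[OF assms] tendsto_scaleR)
qed

text \<open>The double commutant theorem for two vectors at a time, which is what conjugation by an operator
  calls for. Let \<open>K\<close> be the closure of the orbit of \<open>(x, y)\<close> under the diagonal action of \<open>C\<close> on the
  direct sum of two copies of the space. The matrix entries of the projection onto \<open>K\<close> commute with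
  \<open>C\<close>, hence with \<open>T\<close>, so \<open>K\<close> is invariant under the diagonal action of \<open>T\<close>. The part of \<open>(x, y)\<close>
  orthogonal to \<open>K\<close> is killed by \<open>C\<close>, so nondegeneracy puts \<open>(x, y)\<close> itself into \<open>K\<close>.\<close>

lemma double_commutant_density:
  fixes C :: "('h::chilbert_space \<Rightarrow>\<^sub>L 'h) set"
  assumes C: "star_subalgebra C" and nondeg: "\<And>x. (\<And>c. c \<in> C \<Longrightarrow> blinfun_apply c x = 0) \<Longrightarrow> x = 0"
    and T: "T \<in> commutant (commutant C)"
  shows "(T x, T y) \<in> closure ((\<lambda>c. (blinfun_apply c x, blinfun_apply c y)) ` C)"
proof -
  note C' = star_subalgebraD[OF C]
  let ?K0 = "(\<lambda>c. (blinfun_apply c x, blinfun_apply c y)) ` C"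
  define K where "K = closure ?K0"
  have "subspace ?K0"
    unfolding subspace_def
  proof (intro conjI ballI allI)
    show "0 \<in> ?K0" using C'(2) by (force simp: zero_prod_def)
    show "u + v \<in> ?K0" if "u \<in> ?K0" "v \<in> ?K0" for u v
      using that C'(3) by (force simp: blinfun.add_left[symmetric])
    show "r *\<^sub>R u \<in> ?K0" if "u \<in> ?K0" for r u
      using that C'(7) by (force simp: blinfun.scaleR_left[symmetric])
  qed
  then have sub: "subspace K" unfolding K_def by (rule closure_subspace)
  have clK: "closed K" by (simp add: K_def)
  \<comment> \<open>Adjoining the scalars makes the operators commuting with \<open>S\<close> complex linear automatically.\<close>
  define S where "S = C \<union> range (\<lambda>a. scaleC_op a id_blinfun)"
  have aS: "scaleC_op a id_blinfun \<in> S" for a unfolding S_def by blast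
  have Sb: "R \<in> bounded_ops" if "R \<in> S" for R
    using that C'(1) by (auto simp: S_def bounded_ops_scaleC bounded_ops_id)
  have Sadj: "adj R \<in> S" if R: "R \<in> S" for R
  proof (cases "R \<in> C")
    case True
    then show ?thesis using C'(6) by (simp add: S_def)
  next
    case False
    then obtain a where "R = scaleC_op a id_blinfun" using R by (auto simp: S_def)
    moreover have "adj (id_blinfun :: 'h \<Rightarrow>\<^sub>L 'h) = id_blinfun"
      by (simp add: adj_eq_self_iff bounded_ops_id symmetric_id)
    ultimately have "adj R = scaleC_op (cnj a) id_blinfun" by (simp add: adj_scaleC bounded_ops_id)
    then show ?thesis unfolding S_def by blast
  qed
  have inv: "(R (fst u), R (snd u)) \<in> K" if R: "R \<in> S" and u: "u \<in> K" for R u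
  proof -
    have "(\<lambda>u. (blinfun_apply R (fst u), blinfun_apply R (snd u))) ` K \<subseteq> K"
      unfolding K_def
    proof (rule image_closure_subset)
      show "continuous_on (closure ?K0) (\<lambda>u. (blinfun_apply R (fst u), blinfun_apply R (snd u)))"
        by (intro continuous_intros)
      show "(\<lambda>u. (blinfun_apply R (fst u), blinfun_apply R (snd u))) ` ?K0 \<subseteq> closure ?K0"
      proof -
        have "\<exists>d\<in>C. R (c z) = d z \<and> R (c w) = d w" if "c \<in> C" for c z w
        proof (cases "R \<in> C")
          case True
          then show ?thesis using C'(4)[OF True that] by (intro bexI[of _ "R o\<^sub>L c"]) auto
        next
          case False
          then obtain a where "R = scaleC_op a id_blinfun" using R by (auto simp: S_def)
          then show ?thesis using C'(5)[OF that, of a] by (intro bexI[of _ "scaleC_op a c"]) (auto simp: scaleC_op.rep_eq)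
        qed
        then have "(\<lambda>u. (blinfun_apply R (fst u), blinfun_apply R (snd u))) ` ?K0 \<subseteq> ?K0" by fastforce
        then show ?thesis using closure_subset by blast
      qed
    qed simp
    then show ?thesis using u by auto
  qed
  obtain P where P: "\<And>u. blinfun_apply P u \<in> K" "\<And>u v. v \<in> K \<Longrightarrow> inner (u - P u) v = 0"
    using orthogonal_projection_exists[OF clK sub] by blast
  have uniq: "P u = w" if "w \<in> K" "\<And>v. v \<in> K \<Longrightarrow> inner (u - w) v = 0" for u w
    by (rule orthogonal_component_unique[OF sub P(1) that(1) P(2) that(2)])
  have PR: "P (R (fst u), R (snd u)) = (R (fst (P u)), R (snd (P u)))" if R: "R \<in> S" for R u
  proof (rule uniq)
    show "(R (fst (P u)), R (snd (P u))) \<in> K" by (intro inv R P)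
    fix v assume "v \<in> K"
    then have "(adj R (fst v), adj R (snd v)) \<in> K" by (intro inv Sadj R)
    then have "inner (u - P u) (adj R (fst v), adj R (snd v)) = 0" by (rule P(2))
    then show "inner ((R (fst u), R (snd u)) - (R (fst (P u)), R (snd (P u)))) v = 0"
      by (simp add: inner_prod_def inner_adj_right[OF Sb[OF R]] blinfun.diff_right fst_diff snd_diff)
  qed
  have comm: "Q \<in> commutant C" if "\<And>R v. R \<in> S \<Longrightarrow> Q (R v) = R (Q v)" for Q :: "'h \<Rightarrow>\<^sub>L 'h"
  proof (rule commutantI)
    have "Q (a *\<^sub>C v) = a *\<^sub>C Q v" for a v
      using that[OF aS[of a], of v] by (simp add: scaleC_op.rep_eq)
    then show "Q \<in> bounded_ops" by (simp add: bounded_ops_def)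
  qed (use that in \<open>simp add: S_def\<close>)
  have PT: "P (T u, T v) = (T (fst (P (u, v))), T (snd (P (u, v))))" for u v
  proof -
    define E1 E2 F1 F2 where "E1 = Blinfun (\<lambda>w::'h. (w, 0::'h))" and "E2 = Blinfun (\<lambda>w::'h. (0::'h, w))"
      and "F1 = Blinfun (fst :: 'h \<times> 'h \<Rightarrow> 'h)" and "F2 = Blinfun (snd :: 'h \<times> 'h \<Rightarrow> 'h)"
    have EF: "E1 w = (w, 0)" "E2 w = (0, w)" "F1 z = fst z" "F2 z = snd z" for w z
      unfolding E1_def E2_def F1_def F2_def
      by (simp_all add: bounded_linear_Blinfun_apply bounded_linear_Pair bounded_linear_zero
          bounded_linear_ident bounded_linear_fst bounded_linear_snd)
    have ent: "F o\<^sub>L P o\<^sub>L E \<in> commutant C" if "E \<in> {E1, E2}" "F \<in> {F1, F2}" for E F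
    proof (rule comm)
      fix R v assume R: "R \<in> S"
      show "(F o\<^sub>L P o\<^sub>L E) (R v) = R ((F o\<^sub>L P o\<^sub>L E) v)"
        using that PR[OF R, of "(v, 0)"] PR[OF R, of "(0, v)"] by (auto simp: EF)
    qed
    have TP: "F (P (E (T w))) = T (F (P (E w)))" if "E \<in> {E1, E2}" "F \<in> {F1, F2}" for E F w
      using commutantD[OF T ent[OF that], of w] by simp
    have split: "P (a, b) = P (a, 0) + P (0, b)" for a b by (simp add: blinfun.add_right[symmetric])
    have "P (T u, 0) = (T (fst (P (u, 0))), T (snd (P (u, 0))))"
      using TP[of E1 F1 u] TP[of E1 F2 u] by (simp add: EF prod_eq_iff)
    moreover have "P (0, T v) = (T (fst (P (0, v))), T (snd (P (0, v))))"
      using TP[of E2 F1 v] TP[of E2 F2 v] by (simp add: EF prod_eq_iff)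
    ultimately show ?thesis
      by (simp only: split[of "T u" "T v"] split[of u v] fst_add snd_add add_Pair blinfun.add_right)
  qed
  have "P (x, y) = (x, y)"
  proof -
    define z where "z = (x, y) - P (x, y)"
    have "c (fst z) = 0 \<and> c (snd z) = 0" if c: "c \<in> C" for c
    proof -
      have cS: "c \<in> S" using c by (simp add: S_def)
      have "(blinfun_apply c x, blinfun_apply c y) \<in> K" unfolding K_def by (intro subsetD[OF closure_subset] imageI c)
      then have m: "(c (fst z), c (snd z)) \<in> K"
        using subspace_diff[OF sub \<open>(c x, c y) \<in> K\<close> inv[OF cS P(1)[of "(x, y)"]]]
        by (simp add: z_def blinfun.diff_right)
      then have "(adj c (c (fst z)), adj c (c (snd z))) \<in> K" using inv[OF Sadj[OF cS] m] by simp
      then have "inner z (adj c (c (fst z)), adj c (c (snd z))) = 0" unfolding z_def by (rule P(2))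
      then have "inner (c (fst z)) (c (fst z)) + inner (c (snd z)) (c (snd z)) = 0"
        by (simp add: inner_prod_def inner_adj_right[OF Sb[OF cS]])
      then show ?thesis by (simp add: add_nonneg_eq_0_iff)
    qed
    then have "fst z = 0" "snd z = 0" using nondeg by blast+
    then have "z = 0" by (simp add: prod_eq_iff)
    then show ?thesis by (simp add: z_def)
  qed
  then show ?thesis using P(1)[of "(T x, T y)"] PT[of x y] by (simp add: K_def)
qed

text \<open>The relation \<open>n c m S = S n c m\<close> holds for \<open>c\<close> in \<open>C\<close>. Evaluated at \<open>v\<close>, it involves \<open>c\<close> only
  through its values at the two vectors \<open>m S v\<close> and \<open>m v\<close>, so it passes to \<open>T\<close> by density.\<close>

lemma double_commutant_conjugation:
  assumes C: "star_subalgebra C" and nondeg: "\<And>x. (\<And>c. c \<in> C \<Longrightarrow> blinfun_apply c x = 0) \<Longrightarrow> x = 0"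
    and n: "n \<in> bounded_ops" and m: "m \<in> bounded_ops" "\<And>c. c \<in> C \<Longrightarrow> n o\<^sub>L c o\<^sub>L m \<in> C"
    and T: "T \<in> commutant (commutant C)"
  shows "n o\<^sub>L T o\<^sub>L m \<in> commutant (commutant C)"
proof (rule commutantI)
  show "n o\<^sub>L T o\<^sub>L m \<in> bounded_ops" by (intro bounded_ops_compose n m commutant_bounded[OF T])
  fix S v assume S: "S \<in> commutant C"
  let ?Z = "{u. n (fst u) = S (n (snd u))}"
  have "closed ?Z" by (intro closed_Collect_eq continuous_intros)
  moreover have "(\<lambda>c. (blinfun_apply c (m (S v)), blinfun_apply c (m v))) ` C \<subseteq> ?Z"
    using commutantD[OF S m(2)] by auto
  ultimately have "closure ((\<lambda>c. (blinfun_apply c (m (S v)), blinfun_apply c (m v))) ` C) \<subseteq> ?Z"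
    by (rule closure_minimal[rotated])
  then show "(n o\<^sub>L T o\<^sub>L m) (S v) = S ((n o\<^sub>L T o\<^sub>L m) v)"
    using double_commutant_density[OF C nondeg T, of "m (S v)" "m v"] by auto
qed

section \<open>Abelian von Neumann algebras are amenable\<close>

text \<open>A linear contraction into the corner \<open>A p\<close> that sees only the compression of its argument to the
  range of \<open>p\<close>. The bound by \<open>\<parallel>p x\<parallel>\<close> encodes that the values live in this corner, and it is the form
  in which contractions on orthogonal corners can be added.\<close>

definition corner_map ::
  "('h::chilbert_space \<Rightarrow>\<^sub>L 'h) set \<Rightarrow> ('h \<Rightarrow>\<^sub>L 'h) \<Rightarrow> (('h \<Rightarrow>\<^sub>L 'h) \<Rightarrow> ('h \<Rightarrow>\<^sub>L 'h)) \<Rightarrow> bool" where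
  "corner_map A p E \<longleftrightarrow>
     (\<forall>S\<in>bounded_ops. \<forall>T\<in>bounded_ops. E (S + T) = E S + E T) \<and>
     (\<forall>c. \<forall>T\<in>bounded_ops. E (scaleC_op c T) = scaleC_op c (E T)) \<and>
     (\<forall>T\<in>bounded_ops. E T \<in> A \<and> (\<forall>x. norm (E T x) \<le> norm T * norm (p x)) \<and> E T = E (p o\<^sub>L T o\<^sub>L p)) \<and>
     E p = p"

lemma corner_mapD:
  assumes "corner_map A p E"
  shows "S \<in> bounded_ops \<Longrightarrow> T \<in> bounded_ops \<Longrightarrow> E (S + T) = E S + E T"
    "T \<in> bounded_ops \<Longrightarrow> E (scaleC_op c T) = scaleC_op c (E T)"
    "T \<in> bounded_ops \<Longrightarrow> E T \<in> A" "T \<in> bounded_ops \<Longrightarrow> norm (E T x) \<le> norm T * norm (p x)"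
    "T \<in> bounded_ops \<Longrightarrow> E T = E (p o\<^sub>L T o\<^sub>L p)" "E p = p"
  using assms unfolding corner_map_def by blast+

text \<open>Take \<open>T \<mapsto> \<langle>T e, e\<rangle> p\<close> for a unit vector \<open>e\<close> in the range of \<open>p\<close>.\<close>

lemma corner_map_vector_state:
  assumes A: "von_neumann_algebra A" and p: "p \<in> projections A"
  shows "\<exists>E. corner_map A p E"
proof -
  note A' = star_subalgebraD[OF von_neumannD(1)[OF A]]
  have b: "A \<subseteq> bounded_ops" using A'(1) by blast
  note p' = projectionsD[OF p b]
  \<comment> \<open>The zero vector serves as \<open>e\<close> for \<open>p = 0\<close>, since splitting corners can produce zero projections.\<close>
  obtain e where e: "p e = e" "p \<noteq> 0 \<Longrightarrow> norm e = 1" "norm e \<le> 1"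
  proof (cases "p = 0")
    case False
    then obtain x where x: "p x \<noteq> 0" by (metis blinfun_eqI zero_blinfun.rep_eq)
    show ?thesis
      by (rule that[of "(1 / norm (p x)) *\<^sub>R p x"]) (use x in \<open>auto simp: blinfun.scaleR_right p'\<close>)
  qed (use that[of 0] in auto)
  have ee: "cinner e e = 1" if "p \<noteq> 0"
  proof (rule complex_eqI)
    show "Re (cinner e e) = Re 1" using e(2)[OF that] by (simp add: Re_cinner power2_norm_eq_inner[symmetric])
    show "Im (cinner e e) = Im 1" using arg_cong[OF cinner_commute[of e e], of Im] by simp
  qed
  define E where "E T = scaleC_op (cinner (blinfun_apply T e) e) p" for T
  have cb: "cmod (cinner (T e) e) \<le> norm T" for T :: "'a \<Rightarrow>\<^sub>L 'a"
  proof -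
    define z where "z = cinner (T e) e"
    have "cmod z * cmod z = Re (cnj z * z)" by (simp add: complex_norm_square[symmetric] power2_eq_square[symmetric] mult.commute)
    also have "\<dots> = inner (cnj z *\<^sub>C T e) e" by (simp add: Re_cinner[symmetric] cinner_scaleC_left z_def)
    also have "\<dots> \<le> norm (cnj z *\<^sub>C T e) * norm e" by (rule norm_cauchy_schwarz)
    also have "\<dots> \<le> norm (cnj z *\<^sub>C T e) * 1" by (intro mult_left_mono e) auto
    also have "\<dots> = cmod z * norm (T e)" by (simp add: norm_scaleC)
    also have "\<dots> \<le> cmod z * norm T"
      using norm_blinfun[of T e] mult_left_mono[OF e(3), of "norm T"] by (intro mult_left_mono) auto
    finally show ?thesis unfolding z_def[symmetric] by (cases "z = 0") auto
  qed
  have "corner_map A p E"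
    unfolding corner_map_def
  proof (intro conjI ballI allI)
    show "E (S + T) = E S + E T" for S T
      by (simp add: E_def blinfun.add_left cinner_add_left cop.scale_left_distrib)
    show "E (scaleC_op c T) = scaleC_op c (E T)" for c T
      by (simp add: E_def scaleC_op.rep_eq cinner_scaleC_left)
    show "E T \<in> A" for T unfolding E_def by (intro A' p')
    show "norm (E T x) \<le> norm T * norm (p x)" for T x
      using cb by (auto simp: E_def scaleC_op.rep_eq norm_scaleC intro!: mult_right_mono)
    show "E T = E (p o\<^sub>L T o\<^sub>L p)" for T
    proof -
      have "p (\<i> *\<^sub>C e) = \<i> *\<^sub>C e" using bounded_opsD[OF p'(5), of \<i> e] e(1) by simp
      then have "cinner (p u) e = cinner u e" for u
        by (intro complex_eqI) (simp_all add: Re_cinner Im_cinner p'(3) e(1))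
      then show ?thesis by (simp add: E_def e(1))
    qed
    show "E p = p" using ee by (cases "p = 0") (auto simp: E_def e(1))
  qed
  then show ?thesis by blast
qed

text \<open>To fix one more projection \<open>f\<close>, split the corner of \<open>p\<close> into those of \<open>p f\<close> and \<open>p (1 - f)\<close> and
  add the maps given by induction on both. The values of the two summands have orthogonal ranges, so
  the sum is again a contraction. Compression makes \<open>f\<close> act as the identity on the first corner and as 0
  on the second.\<close>

lemma corner_map_fixing_projections:
  assumes A: "von_neumann_algebra A" and comm: "commutative A"
    and "finite F" and "F \<subseteq> projections A" and "p \<in> projections A"
  shows "\<exists>E. corner_map A p E \<and> (\<forall>q\<in>F. E q = q o\<^sub>L p)"
  using assms(3-5)
proof (induction F arbitrary: p)
  case empty
  then show ?case using corner_map_vector_state[OF A] by simp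
next
  case (insert f F)
  note A' = star_subalgebraD[OF von_neumannD(1)[OF A]]
  have b: "A \<subseteq> bounded_ops" using A'(1) by blast
  have f: "f \<in> projections A" using insert by simp
  note f' = projectionsD[OF f b] and p' = projectionsD[OF insert.prems(2) b]
  have c: "S (T x) = T (S x)" if "S \<in> A" "T \<in> A" for S T x
    using commutativeD[OF comm that] .
  define g h where "g = p o\<^sub>L f" and "h = p - (p o\<^sub>L f)"
  have gh: "g x = p (f x)" "h x = p x - p (f x)" for x by (simp_all add: g_def h_def blinfun.diff_left)
  have fp: "f (p x) = p (f x)" for x by (rule c) (use f' p' in auto)
  have g: "g \<in> projections A"
    by (rule projectionsI[OF _ b]) (auto simp: g_def A' f' p' fp symmetric_def)
  have h: "h \<in> projections A"
    by (rule projectionsI[OF _ b]) (auto simp: h_def A' f' p' fp symmetric_def blinfun.diff_left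
        blinfun.diff_right inner_diff_left inner_diff_right)
  obtain E1 where E1: "corner_map A g E1" "\<forall>q\<in>F. E1 q = q o\<^sub>L g" using insert.IH[OF _ g] insert.prems by auto
  obtain E2 where E2: "corner_map A h E2" "\<forall>q\<in>F. E2 q = q o\<^sub>L h" using insert.IH[OF _ h] insert.prems by auto
  have compress: "E1 T = E1 U" if "T \<in> bounded_ops" "U \<in> bounded_ops" "g o\<^sub>L T o\<^sub>L g = g o\<^sub>L U o\<^sub>L g" for T U
    using E1(1) that unfolding corner_map_def by metis
  have compress2: "E2 T = E2 U" if "T \<in> bounded_ops" "U \<in> bounded_ops" "h o\<^sub>L T o\<^sub>L h = h o\<^sub>L U o\<^sub>L h" for T U
    using E2(1) that unfolding corner_map_def by metis
  have gb: "g \<in> bounded_ops" "h \<in> bounded_ops" using projectionsD(5)[OF g b] projectionsD(5)[OF h b] by auto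
  define E where "E T = E1 T + E2 T" for T
  have "corner_map A p E"
    unfolding corner_map_def
  proof (intro conjI ballI allI)
    show "E (S + T) = E S + E T" if "S \<in> bounded_ops" "T \<in> bounded_ops" for S T
      using that E1(1) E2(1) by (simp add: corner_map_def E_def)
    show "E (scaleC_op c T) = scaleC_op c (E T)" if "T \<in> bounded_ops" for c T
      using that E1(1) E2(1) by (simp add: corner_map_def E_def cop.scale_right_distrib)
    show "E p = p"
    proof -
      have "E1 p = E1 g"
        by (rule compress) (auto simp: gb p' gh f' fp intro!: blinfun_eqI)
      moreover have "E2 p = E2 h"
        by (rule compress2) (auto simp: gb p' gh f' fp blinfun.diff_right intro!: blinfun_eqI)
      ultimately show ?thesis using E1(1) E2(1) by (simp add: corner_map_def E_def g_def h_def)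
    qed
    fix T :: "'a \<Rightarrow>\<^sub>L 'a" assume T: "T \<in> bounded_ops"
    have T12: "E1 T \<in> A" "E2 T \<in> A" "\<And>x. norm (E1 T x) \<le> norm T * norm (g x)" "\<And>x. norm (E2 T x) \<le> norm T * norm (h x)"
      using T E1(1) E2(1) by (auto simp: corner_map_def)
    show "E T \<in> A" unfolding E_def by (intro A' T12)
    show "E T = E (p o\<^sub>L T o\<^sub>L p)"
    proof -
      have "E1 T = E1 (p o\<^sub>L T o\<^sub>L p)"
        by (rule compress) (auto simp: T p' gh f' fp bounded_ops_compose intro!: blinfun_eqI)
      moreover have "E2 T = E2 (p o\<^sub>L T o\<^sub>L p)"
        by (rule compress2) (auto simp: T p' gh f' fp bounded_ops_compose blinfun.diff_right intro!: blinfun_eqI)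
      ultimately show ?thesis by (simp add: E_def)
    qed
    fix x
    have "E1 T (x - g x) = 0" using T12(3)[of "x - g x"] projectionsD(2)[OF g b] by (simp add: blinfun.diff_right)
    then have u: "E1 T x = g (E1 T x)" using c[OF T12(1) projectionsD(1)[OF g b], of x] by (simp add: blinfun.diff_right)
    have "E2 T (x - h x) = 0" using T12(4)[of "x - h x"] projectionsD(2)[OF h b] by (simp add: blinfun.diff_right)
    then have w: "E2 T x = h (E2 T x)" using c[OF T12(2) projectionsD(1)[OF h b], of x] by (simp add: blinfun.diff_right)
    have hg: "h (g z) = 0" for z by (simp add: gh p' f' fp blinfun.diff_right)
    have orth: "inner (g y) (h z) = 0" for y z
      using projectionsD(3)[OF h b, of "g y" z] by (simp add: hg)
    have "inner (E1 T x) (E2 T x) = 0" using orth[of "E1 T x" "E2 T x"] u w by simp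
    then have "(norm (E T x))\<^sup>2 = (norm (E1 T x))\<^sup>2 + (norm (E2 T x))\<^sup>2"
      by (simp add: E_def blinfun.add_left power2_norm_eq_inner inner_add_left inner_add_right inner_commute)
    also have "\<dots> \<le> (norm T * norm (g x))\<^sup>2 + (norm T * norm (h x))\<^sup>2"
      by (intro add_mono power_mono T12) auto
    also have "\<dots> = (norm T)\<^sup>2 * ((norm (g x))\<^sup>2 + (norm (h x))\<^sup>2)"
      by (simp add: power_mult_distrib distrib_left)
    also have "(norm (g x))\<^sup>2 + (norm (h x))\<^sup>2 = (norm (g x + h x))\<^sup>2"
      using orth[of x x] by (simp add: power2_norm_eq_inner inner_add_left inner_add_right inner_commute)
    also have "g x + h x = p x" by (simp add: gh)
    finally have "(norm (E T x))\<^sup>2 \<le> (norm T * norm (p x))\<^sup>2" by (simp add: power_mult_distrib)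
    then show "norm (E T x) \<le> norm T * norm (p x)" by (rule power2_le_imp_le) simp
  qed
  moreover have "E q = q o\<^sub>L p" if "q \<in> insert f F" for q
  proof (cases "q = f")
    case True
    have "E1 f = E1 g"
      by (rule compress) (auto simp: gb p' gh f' fp intro!: blinfun_eqI)
    moreover have "E2 f = E2 0"
      by (rule compress2) (auto simp: A'(1)[OF A'(2)] p' gh f' fp blinfun.diff_right blinfun.diff_left intro!: blinfun_eqI)
    moreover have "E2 0 = 0"
      using E2(1) A'(1)[OF A'(2)] unfolding corner_map_def by (metis add_cancel_right_right add_0)
    ultimately show ?thesis using True E1(1) by (auto simp: E_def corner_map_def g_def fp intro!: blinfun_eqI)
  next
    case False
    then have "E q = (q o\<^sub>L g) + (q o\<^sub>L h)" using that E1(2) E2(2) by (simp add: E_def)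
    then show ?thesis by (auto simp: gh blinfun.add_left blinfun.diff_right intro!: blinfun_eqI)
  qed
  ultimately show ?case by blast
qed

text \<open>A map on operators is encoded by its real matrix coefficients, a point in a product of compact
  intervals. The sets of coefficient functions of contractions fixing a given finite set of projections
  have the finite intersection property, so their closures have a common point. Everything asked of a
  conditional expectation is a closed condition on finitely many coefficients at a time and survives.\<close>

lemma abelian_amenable:
  fixes A :: "('h::chilbert_space \<Rightarrow>\<^sub>L 'h) set"
  assumes A: "von_neumann_algebra A" and comm: "commutative A"
  shows "amenable A"
proof -
  note A' = star_subalgebraD[OF von_neumannD(1)[OF A]] and A'' = von_neumannD[OF A]
  have b: "A \<subseteq> bounded_ops" using A'(1) by blast
  have id: "id_blinfun \<in> projections A"
    by (rule projectionsI[OF A''(5) b]) (simp_all add: symmetric_id)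
  define form :: "(('h \<Rightarrow>\<^sub>L 'h) \<Rightarrow> ('h \<Rightarrow>\<^sub>L 'h)) \<Rightarrow> ('h \<Rightarrow>\<^sub>L 'h) \<times> 'h \<times> 'h \<Rightarrow> real" where
    "form E = (\<lambda>(T, x, y). if T \<in> bounded_ops then inner (E T x) y else 0)" for E
  define G where "G Q = form ` {E. corner_map A id_blinfun E \<and> (\<forall>q\<in>Q. E q = q)}" for Q
  define K :: "(('h \<Rightarrow>\<^sub>L 'h) \<times> 'h \<times> 'h \<Rightarrow> real) set" where
    "K = PiE UNIV (\<lambda>(T, x, y). cball 0 (norm T * norm x * norm y))"
  have "compactin (product_topology (\<lambda>i. euclidean) UNIV) K"
    unfolding K_def by (subst compactin_PiE) (auto simp: split_def)
  then have "compact K" by (simp add: euclidean_product_topology)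
  have GK: "G Q \<subseteq> K" for Q
  proof
    fix \<phi> assume "\<phi> \<in> G Q"
    then obtain E where E: "\<phi> = form E" "corner_map A id_blinfun E" by (auto simp: G_def)
    have "\<bar>inner (E T x) y\<bar> \<le> norm T * norm x * norm y" if "T \<in> bounded_ops" for T x y
    proof -
      have "\<bar>inner (E T x) y\<bar> \<le> norm (E T x) * norm y" by (rule Cauchy_Schwarz_ineq2)
      also have "\<dots> \<le> norm T * norm x * norm y"
        using E(2) that by (intro mult_right_mono) (auto simp: corner_map_def)
      finally show ?thesis .
    qed
    then show "\<phi> \<in> K" by (auto simp: K_def E(1) form_def)
  qed
  let ?I = "{Q. finite Q \<and> Q \<subseteq> projections A}"
  have "K \<inter> (\<Inter>Q\<in>?I. closure (G Q)) \<noteq> {}"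
  proof (rule compact_imp_fip_image[OF \<open>compact K\<close>])
    fix I' assume I': "finite I'" "I' \<subseteq> ?I"
    then have "finite (\<Union>I')" "\<Union>I' \<subseteq> projections A" by auto
    then obtain E where "corner_map A id_blinfun E" "\<forall>q\<in>\<Union>I'. E q = q o\<^sub>L id_blinfun"
      using corner_map_fixing_projections[OF A comm _ _ id] by blast
    then have "form E \<in> G Q" if "Q \<in> insert {} I'" for Q
      using that unfolding G_def by (intro imageI CollectI conjI) (auto simp: blinfun_eqI)
    then show "K \<inter> (\<Inter>Q\<in>I'. closure (G Q)) \<noteq> {}" using GK closure_subset by blast
  qed simp
  then obtain \<phi> where \<phi>: "\<phi> \<in> K" "\<And>Q. finite Q \<Longrightarrow> Q \<subseteq> projections A \<Longrightarrow> \<phi> \<in> closure (G Q)" by blast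
  \<comment> \<open>A closed condition holds for the limit point if it holds for all maps fixing some finite set of projections.\<close>
  have closed_prop: "\<phi> \<in> Z" if "closed Z" "finite Q" "Q \<subseteq> projections A"
    "\<And>E. corner_map A id_blinfun E \<Longrightarrow> \<forall>q\<in>Q. E q = q \<Longrightarrow> form E \<in> Z" for Z Q
    using closure_minimal[of "G Q" Z] that \<phi>(2)[of Q] by (auto simp: G_def)
  have lin: "\<phi> i = \<phi> j + r * \<phi> k"
    if "\<And>E. corner_map A id_blinfun E \<Longrightarrow> form E i = form E j + r * form E k" for i j k r
  proof -
    have "closed {\<phi> :: ('h \<Rightarrow>\<^sub>L 'h) \<times> 'h \<times> 'h \<Rightarrow> real. \<phi> i = \<phi> j + r * \<phi> k}"
      by (intro closed_Collect_eq continuous_intros continuous_on_product_coordinates)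
    from closed_prop[OF this, of "{}"] that show ?thesis by auto
  qed
  have eq: "\<phi> i = \<phi> j" if "\<And>E. corner_map A id_blinfun E \<Longrightarrow> form E i = form E j" for i j
    using lin[of i j 0 i] that by simp
  have form: "form E (T, x, y) = inner (E T x) y" if "T \<in> bounded_ops" for E T x y
    using that by (simp add: form_def)
  have bound: "\<bar>\<phi> (T, x, y)\<bar> \<le> norm T * norm x * norm y" for T x y
    using \<phi>(1) by (auto simp: K_def PiE_def Pi_def dest: spec[of _ T])
  have add: "\<phi> (T, x + x', y) = \<phi> (T, x, y) + \<phi> (T, x', y)" "\<phi> (T, x, y + y') = \<phi> (T, x, y) + \<phi> (T, x, y')"
    "\<phi> (T, r *\<^sub>R x, y) = r * \<phi> (T, x, y)" "\<phi> (T, x, r *\<^sub>R y) = r * \<phi> (T, x, y)" if T: "T \<in> bounded_ops" for T x x' y y' r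
  proof -
    have "\<phi> (T, x + x', y) = \<phi> (T, x, y) + 1 * \<phi> (T, x', y)" "\<phi> (T, x, y + y') = \<phi> (T, x, y) + 1 * \<phi> (T, x, y')"
      by (rule lin; simp add: form[OF T] blinfun.add_right inner_add_left inner_add_right)+
    then show "\<phi> (T, x + x', y) = \<phi> (T, x, y) + \<phi> (T, x', y)" "\<phi> (T, x, y + y') = \<phi> (T, x, y) + \<phi> (T, x, y')"
      by simp_all
    have "\<phi> (T, 0, y) = \<phi> (T, 0, y) + 1 * \<phi> (T, 0, y)"
      by (rule lin) (simp add: form[OF T] blinfun.zero_right)
    moreover have "\<phi> (T, r *\<^sub>R x, y) = \<phi> (T, 0, y) + r * \<phi> (T, x, y)" "\<phi> (T, x, r *\<^sub>R y) = \<phi> (T, 0, y) + r * \<phi> (T, x, y)"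
      by (rule lin; simp add: form[OF T] blinfun.zero_right blinfun.scaleR_right)+
    ultimately show "\<phi> (T, r *\<^sub>R x, y) = r * \<phi> (T, x, y)" "\<phi> (T, x, r *\<^sub>R y) = r * \<phi> (T, x, y)"
      by simp_all
  qed
  have "\<forall>T. \<exists>S::'h \<Rightarrow>\<^sub>L 'h. T \<in> bounded_ops \<longrightarrow> (\<forall>x y. inner (S x) y = \<phi> (T, x, y))"
  proof
    fix T :: "'h \<Rightarrow>\<^sub>L 'h"
    show "\<exists>S::'h \<Rightarrow>\<^sub>L 'h. T \<in> bounded_ops \<longrightarrow> (\<forall>x y. inner (S x) y = \<phi> (T, x, y))"
    proof (cases "T \<in> bounded_ops")
      case True
      have "\<exists>S::'h \<Rightarrow>\<^sub>L 'h. \<forall>x y. inner (S x) y = \<phi> (T, x, y)"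
        by (rule bounded_bilinear_form_operator[where K = "norm T"]) (use add[OF True] bound in auto)
      then show ?thesis by blast
    qed auto
  qed
  then obtain E :: "('h \<Rightarrow>\<^sub>L 'h) \<Rightarrow> ('h \<Rightarrow>\<^sub>L 'h)"
    where E: "\<And>T x y. T \<in> bounded_ops \<Longrightarrow> inner (E T x) y = \<phi> (T, x, y)"
    using choice[of "\<lambda>T (S::'h \<Rightarrow>\<^sub>L 'h). T \<in> bounded_ops \<longrightarrow> (\<forall>x y. inner (S x) y = \<phi> (T, x, y))"] by blast
  have opI: "S = U" if "\<And>x y. inner (S x) y = inner (blinfun_apply U x) y" for S U :: "'h \<Rightarrow>\<^sub>L 'h"
    by (rule blinfun_eqI, rule inner_eqI, rule that)
  have Eadd: "E (S + T) = E S + E T" if "S \<in> bounded_ops" "T \<in> bounded_ops" for S T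
  proof (rule opI)
    fix x y
    have "\<phi> (S + T, x, y) = \<phi> (S, x, y) + 1 * \<phi> (T, x, y)"
      by (rule lin) (use that in \<open>simp add: form bounded_ops_add corner_mapD(1) blinfun.add_left inner_add_left\<close>)
    then show "inner (E (S + T) x) y = inner ((E S + E T) x) y"
      using that by (simp add: E bounded_ops_add blinfun.add_left inner_add_left)
  qed
  have Escale: "E (scaleC_op c T) = scaleC_op c (E T)" if "T \<in> bounded_ops" for c T
  proof (rule opI)
    fix x y
    have "\<phi> (scaleC_op c T, x, y) = \<phi> (T, x, cnj c *\<^sub>C y)"
      by (rule eq) (use that in \<open>simp add: form bounded_ops_scaleC corner_mapD(2) scaleC_op.rep_eq inner_scaleC_left\<close>)
    then show "inner (E (scaleC_op c T) x) y = inner (scaleC_op c (E T) x) y"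
      using that by (simp add: E bounded_ops_scaleC scaleC_op.rep_eq inner_scaleC_left)
  qed
  have Ecomm: "E T (S x) = S (E T x)" if T: "T \<in> bounded_ops" and S: "S \<in> commutant A" for T S x
  proof (rule inner_eqI)
    fix y
    have Sb: "S \<in> bounded_ops" using S by (rule commutant_bounded)
    \<comment> \<open>Commuting with \<open>A'\<close> is a condition on coefficients; it forces the limit values into \<open>A'' = A\<close>.\<close>
    have "\<phi> (T, S x, y) = \<phi> (T, x, adj S y)"
    proof (rule eq)
      fix E' assume "corner_map A id_blinfun E'"
      then have "E' T \<in> A" using T by (simp add: corner_mapD(3))
      then show "form E' (T, S x, y) = form E' (T, x, adj S y)"
        by (simp add: form T inner_adj_right[OF Sb] commutantD[OF S])
    qed
    then show "inner (E T (S x)) y = inner (S (E T x)) y"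
      using T by (simp add: E[symmetric] inner_adj_right[OF Sb])
  qed
  have EA: "E T \<in> A" if T: "T \<in> bounded_ops" for T
  proof -
    have "E T \<in> commutant (commutant A)"
    proof (rule commutantI)
      have "scaleC_op c id_blinfun \<in> commutant A" for c
        using A'(1) by (intro commutantI bounded_ops_scaleC bounded_ops_id) (simp add: scaleC_op.rep_eq bounded_opsD)
      from Ecomm[OF T this] show "E T \<in> bounded_ops" by (simp add: bounded_ops_def scaleC_op.rep_eq)
    qed (rule Ecomm[OF T])
    then show ?thesis using A''(2) by simp
  qed
  have Enorm: "norm (E T) \<le> norm T" if T: "T \<in> bounded_ops" for T
  proof (rule norm_blinfun_bound)
    fix x
    have "norm (E T x) * norm (E T x) = \<phi> (T, x, E T x)"
      using T by (simp add: E[symmetric] power2_norm_eq_inner[symmetric] power2_eq_square)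
    also have "\<dots> \<le> norm T * norm x * norm (E T x)" using bound[of T x "E T x"] by linarith
    finally show "norm (E T x) \<le> norm T * norm x" by (cases "E T x = 0") auto
  qed simp
  have Eproj: "E q = q" if q: "q \<in> projections A" for q
  proof (rule opI)
    fix x y
    have qb: "q \<in> bounded_ops" using projectionsD(5)[OF q b] .
    have "closed {\<phi> :: ('h \<Rightarrow>\<^sub>L 'h) \<times> 'h \<times> 'h \<Rightarrow> real. \<phi> (q, x, y) = inner (q x) y}"
      by (intro closed_Collect_eq continuous_intros continuous_on_product_coordinates)
    from closed_prop[OF this, of "{q}"] have "\<phi> (q, x, y) = inner (q x) y" using q qb by (auto simp: form)
    then show "inner (E q x) y = inner (q x) y" using E[OF qb] by simp
  qed
  have "A \<subseteq> {T\<in>A. E T = T}"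
  proof (rule projections_span_von_neumann_algebra[OF A])
    show "closed {T \<in> A. E T = T}"
      unfolding closed_sequential_limits
    proof (intro allI impI, elim conjE)
      fix f T assume f: "\<forall>n. f n \<in> {T \<in> A. E T = T}" and lim: "f \<longlonglongrightarrow> T"
      then have T: "T \<in> A" using closed_sequentially[OF A''(4)] by auto
      have neg: "E (- T) = - E T" using Escale[of T "-1"] T b by auto
      have "norm (f n - E T) \<le> norm (f n - T)" for n
      proof -
        have "E (f n + (- T)) = E (f n) + E (- T)"
          using f b T A'(7)[of T "-1"] by (intro Eadd) auto
        then have "f n - E T = E (f n - T)" using f neg by simp
        then show ?thesis using Enorm[of "f n - T"] A'(8)[of "f n" T] f T b by auto
      qed
      moreover have "(\<lambda>n. norm (f n - T)) \<longlonglongrightarrow> 0" using lim by (simp add: LIM_zero tendsto_norm_zero)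
      ultimately have "(\<lambda>n. f n - E T) \<longlonglongrightarrow> 0"
        by (rule Lim_null_comparison[OF always_eventually, OF allI])
      then have "f \<longlonglongrightarrow> E T" by (simp add: LIM_zero_iff)
      then have "E T = T" using lim LIMSEQ_unique by blast
      then show "T \<in> {T \<in> A. E T = T}" using T by simp
    qed
    show "projections A \<subseteq> {T \<in> A. E T = T}" using Eproj by (auto simp: projections_def)
  qed (use A' b Eadd Escale in auto)
  then have "conditional_expectation E A"
    unfolding conditional_expectation_def using Eadd Escale EA Enorm by auto
  then show ?thesis using A by (auto simp: amenable_def)
qed

section \<open>The unitary normalizer and the normalizing operators\<close>


definition normalizing :: "('h::chilbert_space \<Rightarrow>\<^sub>L 'h) set \<Rightarrow> ('h \<Rightarrow>\<^sub>L 'h) \<Rightarrow> bool" where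
  "normalizing A n \<longleftrightarrow>
     n \<in> bounded_ops \<and> (\<forall>a\<in>A. n o\<^sub>L a o\<^sub>L adj n \<in> A \<and> adj n o\<^sub>L a o\<^sub>L n \<in> A)"

lemma normalizing_adj: "normalizing A n \<Longrightarrow> normalizing A (adj n)"
  by (simp add: normalizing_def adj_adj bounded_ops_adj)

lemma blinfun_compose_assoc_right: "(R o\<^sub>L S) o\<^sub>L T = R o\<^sub>L (S o\<^sub>L T)"
  by (rule blinfun_eqI) simp

lemma normalizing_compose:
  assumes "normalizing A n" and "normalizing A m"
  shows "normalizing A (n o\<^sub>L m)"
proof -
  have b: "n \<in> bounded_ops" "m \<in> bounded_ops" using assms by (auto simp: normalizing_def)
  have "n o\<^sub>L (m o\<^sub>L a o\<^sub>L adj m) o\<^sub>L adj n \<in> A" "adj m o\<^sub>L (adj n o\<^sub>L a o\<^sub>L n) o\<^sub>L m \<in> A" if "a \<in> A" for a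
    using assms that by (auto simp: normalizing_def)
  then show ?thesis
    using b by (simp add: normalizing_def adj_compose bounded_ops_compose blinfun_compose_assoc_right)
qed

lemma normalizing_self:
  assumes "star_subalgebra A" and "a \<in> A"
  shows "normalizing A a"
  using assms by (auto simp: normalizing_def star_subalgebraD)

lemma blinfun_compose_id_right: "S o\<^sub>L id_blinfun = S"
  by (rule blinfun_eqI) simp

lemma closed_commuting:
  fixes T :: "'a::real_normed_vector \<Rightarrow>\<^sub>L 'a"
  shows "closed {S :: 'a \<Rightarrow>\<^sub>L 'a. \<forall>x. T (blinfun_apply S x) = S (T x)}"
proof -
  have "closed {S :: 'a \<Rightarrow>\<^sub>L 'a. T (blinfun_apply S x) = S (T x)}" for x
    by (intro closed_Collect_eq linear_continuous_on blinfun.bounded_linear_left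
        bounded_linear_compose[OF blinfun.bounded_linear_right])
  then show ?thesis by (simp add: closed_Collect_all)
qed

text \<open>The operators commuting with \<open>T\<close> form a norm closed subspace.\<close>

lemma commutes_if_commutes_with_projections:
  fixes S T :: "'h::chilbert_space \<Rightarrow>\<^sub>L 'h"
  assumes D: "von_neumann_algebra D" and T: "T \<in> bounded_ops"
    and p: "\<And>p x. p \<in> projections D \<Longrightarrow> T (p x) = p (T x)"
    and S: "S \<in> D"
  shows "T (S x) = S (T x)"
proof -
  have "D \<subseteq> {S :: 'h \<Rightarrow>\<^sub>L 'h. \<forall>x. T (blinfun_apply S x) = S (T x)}"
    by (rule projections_span_von_neumann_algebra[OF D closed_commuting])
      (auto simp: p blinfun.add_left blinfun.add_right scaleC_op.rep_eq bounded_opsD[OF T])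
  then show ?thesis using S by blast
qed

text \<open>In this context \<open>T\<close> is a fixed operator commuting with the unitary normalizer of \<open>A\<close> in \<open>M\<close>; the
  aim is to show that it commutes with all normalizing operators of \<open>M\<close>.\<close>

context
  fixes M A :: "('h::chilbert_space \<Rightarrow>\<^sub>L 'h) set" and T :: "'h \<Rightarrow>\<^sub>L 'h"
  assumes M: "von_neumann_algebra M" and A: "von_neumann_algebra A" and AM: "A \<subseteq> M"
    and comm: "commutative A" and T: "T \<in> commutant (unitary_normalizer M A)"
begin

lemma subalgebra_commute: "S \<in> A \<Longrightarrow> R \<in> A \<Longrightarrow> S (R x) = R (S x)"
  by (rule commutativeD[OF comm])

lemma symmetric_unitary_commute:
  assumes u: "u \<in> M" "symmetric u" "\<And>x. u (u x) = x" and n: "\<And>a. a \<in> A \<Longrightarrow> u o\<^sub>L a o\<^sub>L u \<in> A"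
  shows "T (u x) = u (T x)"
proof -
  have ub: "u \<in> bounded_ops" using star_subalgebraD(1)[OF von_neumannD(1)[OF M] u(1)] .
  then have adj: "adj u = u" by (simp add: adj_eq_self_iff u)
  have uu: "u o\<^sub>L u = id_blinfun" by (rule blinfun_eqI) (simp add: u)
  have "(\<lambda>a. u o\<^sub>L a o\<^sub>L u) ` A = A"
  proof
    show "(\<lambda>a. u o\<^sub>L a o\<^sub>L u) ` A \<subseteq> A" using n by blast
    show "A \<subseteq> (\<lambda>a. u o\<^sub>L a o\<^sub>L u) ` A"
    proof
      fix a assume a: "a \<in> A"
      have "a = u o\<^sub>L (u o\<^sub>L a o\<^sub>L u) o\<^sub>L u" by (rule blinfun_eqI) (simp add: u)
      then show "a \<in> (\<lambda>a. u o\<^sub>L a o\<^sub>L u) ` A" using n[OF a] by blast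
    qed
  qed
  then have "u \<in> unitary_normalizer M A" using u uu adj by (simp add: unitary_normalizer_def unitaries_def)
  then show ?thesis by (rule commutantD[OF T])
qed

text \<open>For a projection \<open>p\<close> of \<open>A' \<inter> M\<close> the symmetry \<open>2 p - 1\<close> is a unitary acting trivially on \<open>A\<close>.
  Such projections span \<open>A' \<inter> M\<close>, which contains \<open>A\<close> since \<open>A\<close> is abelian.\<close>

lemma relative_commutant_commute:
  assumes S: "S \<in> M" "\<And>a x. a \<in> A \<Longrightarrow> S (a x) = a (blinfun_apply S x)"
  shows "T (S x) = S (T x)"
proof -
  note M' = von_neumannD[OF M] star_subalgebraD[OF von_neumannD(1)[OF M]]
  note A' = star_subalgebraD[OF von_neumannD(1)[OF A]]
  define D where "D = commutant (commutant M \<union> A)"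
  have ac: "adjoint_closed (commutant M \<union> A)"
    using adjoint_closed_commutant[OF M'(3)] von_neumannD(3)[OF A] by (auto simp: adjoint_closed_def)
  have DM: "D \<subseteq> M" unfolding D_def using commutant_antimono[of "commutant M" "commutant M \<union> A"] M'(2) by auto
  have Db: "D \<subseteq> bounded_ops" unfolding D_def using commutant_bounded by blast
  have D: "von_neumann_algebra D" unfolding D_def by (rule von_neumann_commutant[OF ac])
  note D' = von_neumannD[OF D] star_subalgebraD[OF von_neumannD(1)[OF D]]
  have "S \<in> D" unfolding D_def
  proof (rule commutantI)
    show "S \<in> bounded_ops" using S M' by blast
    fix R x assume "R \<in> commutant M \<union> A"
    then show "S (R x) = R (S x)" using S commutantD[of R M S x] by auto
  qed
  moreover have "T (p x) = p (T x)" if p: "p \<in> projections D" for p x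
  proof -
    note p' = projectionsD[OF p Db]
    define u where "u = 2 *\<^sub>R p - id_blinfun"
    have uv: "u z = 2 *\<^sub>R p z - z" for z by (simp add: u_def blinfun.diff_left blinfun.scaleR_left)
    have uD: "u \<in> D" unfolding u_def by (intro D' p')
    have uu: "u (u z) = z" for z by (simp add: uv blinfun.diff_right blinfun.add_right p' scaleR_2)
    have ua: "u (a z) = a (u z)" if "a \<in> A" for a z using commutantD[of u "commutant M \<union> A" a z] uD that unfolding D_def by auto
    have "T (u x) = u (T x)"
    proof (rule symmetric_unitary_commute)
      show "u \<in> M" using uD DM by blast
      show "symmetric u" unfolding u_def
        by (intro symmetric_diff symmetric_scaleR symmetric_id) (simp add: symmetric_def p')
      show "u (u z) = z" for z by (rule uu)
      show "u o\<^sub>L a o\<^sub>L u \<in> A" if a: "a \<in> A" for a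
      proof -
        have "u o\<^sub>L a o\<^sub>L u = a" by (rule blinfun_eqI) (simp add: ua[OF a] uu)
        then show ?thesis using a by simp
      qed
    qed
    then show ?thesis by (simp add: uv blinfun.diff_right blinfun.scaleR_right)
  qed
  ultimately show ?thesis
    using commutes_if_commutes_with_projections[OF D commutant_bounded[OF T]] by blast
qed

lemma commutes_with_subalgebra: "a \<in> A \<Longrightarrow> T (a x) = a (T x)"
  using relative_commutant_commute[of a x] AM subalgebra_commute by blast

text \<open>Let \<open>s\<close> be the sign of \<open>x\<close> and \<open>f = 1 - s\<^sup>2\<close>. As \<open>s\<close> is a strong limit of \<open>x q\<^sub>k\<close> with \<open>q\<^sub>k\<close> in
  \<open>A\<close>, the operators \<open>s a s\<close> and \<open>s x\<close> are strong limits of elements \<open>x b x\<close> with \<open>b\<close> in \<open>A\<close>, hence lie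
  in \<open>A\<close>. So \<open>s + f\<close> is a selfadjoint unitary normalizing \<open>A\<close>; it commutes with \<open>T\<close>, and then so does
  \<open>x = s (s x)\<close>.\<close>

lemma symmetric_normalizing_commute:
  assumes x: "x \<in> M" "symmetric x" and n: "normalizing A x"
  shows "T (x v) = x (T v)"
proof -
  note M' = von_neumannD[OF M] star_subalgebraD[OF von_neumannD(1)[OF M]]
  note A' = von_neumannD[OF A] star_subalgebraD[OF von_neumannD(1)[OF A]]
  have xb: "x \<in> bounded_ops" using x M' by blast
  have xax: "x o\<^sub>L a o\<^sub>L x \<in> A" if "a \<in> A" for a
    using n that adj_eq_self_iff[OF xb] x(2) by (simp add: normalizing_def)
  obtain s :: "'h \<Rightarrow>\<^sub>L 'h" and q :: "nat \<Rightarrow> 'h \<Rightarrow>\<^sub>L 'h" where s: "is_sign x s"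
    and q: "\<And>k. q k \<in> poly_in (x o\<^sub>L x)" "\<And>v. (\<lambda>k. x (q k v)) \<longlonglongrightarrow> s v" "\<And>k v. norm (x (q k v)) \<le> norm v"
    using symmetric_sign[OF x(2)] by blast
  have s': "symmetric s" "\<And>v. s (x v) = x (s v)" "\<And>v. s (s (x v)) = x v" "\<And>v. s (s (s v)) = s v"
    using s by (auto simp: is_sign_def)
  have "x o\<^sub>L id_blinfun o\<^sub>L x \<in> A" by (intro xax A')
  then have xx: "x o\<^sub>L x \<in> A" by (simp add: blinfun_compose_id_right)
  have qA: "q k \<in> A" for k using q(1)[of k] poly_in_subset[OF A'(1,5) xx] by blast
  have qx: "q k (x v) = x (q k v)" for k v
    by (rule poly_in_commute[OF q(1), symmetric]) simp
  have limA: "L \<in> A" if "\<And>k. t k \<in> A" "\<And>v. (\<lambda>k. t k v) \<longlonglongrightarrow> L v" for t :: "nat \<Rightarrow> 'h \<Rightarrow>\<^sub>L 'h" and L :: "'h \<Rightarrow>\<^sub>L 'h"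
    using commutant_strong_limit[of t "commutant A" L] that A'(2) by simp
  have sM: "s \<in> M"
  proof -
    have "x o\<^sub>L q k \<in> commutant (commutant M)" for k using x qA[of k] AM M' by auto
    then have "s \<in> commutant (commutant M)"
      by (rule commutant_strong_limit[where T = "\<lambda>k. x o\<^sub>L q k"]) (simp add: q(2))
    then show ?thesis using M'(2) by simp
  qed
  have sas: "s o\<^sub>L a o\<^sub>L s \<in> A" if a: "a \<in> A" for a
  proof (rule limA)
    show "x o\<^sub>L (q k o\<^sub>L a o\<^sub>L q k) o\<^sub>L x \<in> A" for k by (intro xax A' qA a)
    fix v
    have "(\<lambda>k. a (x (q k v))) \<longlonglongrightarrow> a (s v)" by (intro tendsto_intros q)
    then have "(\<lambda>k. (x o\<^sub>L q k) (a (x (q k v)))) \<longlonglongrightarrow> s (a (s v))"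
      by (rule strong_limit_compose[where T = "\<lambda>k. x o\<^sub>L q k" and K = 1, rotated 2])
        (simp_all add: q(2,3))
    then show "(\<lambda>k. (x o\<^sub>L (q k o\<^sub>L a o\<^sub>L q k) o\<^sub>L x) v) \<longlonglongrightarrow> (s o\<^sub>L a o\<^sub>L s) v" by (simp add: qx)
  qed
  have sxA: "s o\<^sub>L x \<in> A"
  proof (rule limA)
    show "x o\<^sub>L q k o\<^sub>L x \<in> A" for k by (intro xax qA)
    show "(\<lambda>k. (x o\<^sub>L q k o\<^sub>L x) v) \<longlonglongrightarrow> (s o\<^sub>L x) v" for v using q(2)[of "x v"] by simp
  qed
  have "s o\<^sub>L id_blinfun o\<^sub>L s \<in> A" by (intro sas A')
  then have ss: "s o\<^sub>L s \<in> A" by (simp add: blinfun_compose_id_right)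
  define f where "f = id_blinfun - (s o\<^sub>L s)"
  have fA: "f \<in> A" unfolding f_def by (intro A' ss)
  have fv: "f z = z - s (s z)" for z by (simp add: f_def blinfun.diff_left)
  have fs: "f (s z) = 0" "s (f z) = 0" for z by (simp_all add: fv s' blinfun.diff_right)
  have ff: "f (f z) = f z" for z by (simp add: fv[of "f z"] fs)
  define u where "u = s + f"
  have uv: "u z = s z + f z" for z by (simp add: u_def blinfun.add_left)
  have "T (u v) = u (T v)" for v
  proof (rule symmetric_unitary_commute)
    show "u \<in> M" unfolding u_def using AM by (intro M' sM subsetD[OF AM fA])
    show "symmetric u" unfolding u_def f_def
      by (intro symmetric_add symmetric_diff symmetric_id symmetric_compose s') simp
    show "u (u z) = z" for z by (simp add: uv blinfun.add_right fs ff) (simp add: fv)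
    show "u o\<^sub>L a o\<^sub>L u \<in> A" if a: "a \<in> A" for a
    proof -
      have "u o\<^sub>L a o\<^sub>L u = (s o\<^sub>L a o\<^sub>L s) + (f o\<^sub>L a o\<^sub>L f)"
      proof (rule blinfun_eqI)
        fix z
        \<comment> \<open>The cross terms vanish because \<open>f\<close> commutes with \<open>a\<close> and is orthogonal to \<open>s\<close>.\<close>
        have "f (a (s z)) = 0" by (simp add: fs subalgebra_commute[OF fA a])
        moreover have "s (a (f z)) = 0" by (simp add: fs subalgebra_commute[OF a fA])
        ultimately show "(u o\<^sub>L a o\<^sub>L u) z = ((s o\<^sub>L a o\<^sub>L s) + (f o\<^sub>L a o\<^sub>L f)) z"
          by (simp add: uv blinfun.add_right blinfun.add_left)
      qed
      then show ?thesis using sas[OF a] fA a A' by simp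
    qed
  qed
  then have Ts: "T (s z) = s (T z)" for z by (simp add: uv blinfun.add_right commutes_with_subalgebra[OF fA])
  have "T (s (s (x v))) = s (T ((s o\<^sub>L x) v))" by (simp add: Ts)
  also have "\<dots> = s (s (x (T v)))" unfolding commutes_with_subalgebra[OF sxA] by simp
  finally show ?thesis by (simp only: s'(3))
qed

text \<open>If \<open>k\<close> maps the range of \<open>g\<close> into an orthogonal subspace, then \<open>k a k = k g a h k = k a g h k = 0\<close>, so
  \<open>x = k + k\<^sup>*\<close> satisfies \<open>x a x = k a k\<^sup>* + k\<^sup>* a k\<close> and is normalizing again. Orthogonality also
  allows \<open>k\<close> to be recovered as \<open>h x g\<close>.\<close>

lemma off_diagonal_normalizing_commute:
  assumes k: "k \<in> M" "normalizing A k" and gh: "g \<in> projections A" "h \<in> projections A"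
    and orth: "\<And>z. g (h z) = 0" and hkg: "\<And>z. h (k (g z)) = k z"
  shows "T (k v) = k (T v)"
proof -
  note M' = von_neumannD[OF M] star_subalgebraD[OF von_neumannD(1)[OF M]]
  note A' = von_neumannD[OF A] star_subalgebraD[OF von_neumannD(1)[OF A]]
  have Ab: "A \<subseteq> bounded_ops" using A' by blast
  note g' = projectionsD[OF gh(1) Ab] and h' = projectionsD[OF gh(2) Ab]
  have kb: "k \<in> bounded_ops" using k M' by blast
  have hg: "h (g z) = 0" for z using subalgebra_commute[OF h'(1) g'(1)] orth by simp
  have hk: "h (k z) = k z" for z by (metis hkg h'(2))
  have kg: "k (g z) = k z" for z by (metis hkg g'(2))
  have adjk: "g (adj k z) = adj k z" "adj k (h z) = adj k z" for z
    by (rule inner_eqI, simp add: g' inner_adj_left[OF kb] kg)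
      (rule inner_eqI, simp add: h'(3)[symmetric] inner_adj_left[OF kb] hk h'(3))
  have kak: "k (a (k z)) = 0" "adj k (a (adj k z)) = 0" if a: "a \<in> A" for a z
  proof -
    have "k (a (k z)) = k (g (a (h (k z))))" by (simp add: kg hk)
    also have "\<dots> = k (a (g (h (k z))))" by (simp add: subalgebra_commute[OF g'(1) a])
    finally show "k (a (k z)) = 0" by (simp add: orth)
    have "adj k (a (adj k z)) = adj k (h (a (g (adj k z))))" by (simp add: adjk)
    also have "\<dots> = adj k (a (h (g (adj k z))))" by (simp add: subalgebra_commute[OF h'(1) a])
    finally show "adj k (a (adj k z)) = 0" by (simp add: hg)
  qed
  define x where "x = k + adj k"
  have xv: "x z = k z + adj k z" for z by (simp add: x_def blinfun.add_left)
  have xM: "x \<in> M" unfolding x_def by (intro M' k)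
  have xsym: "symmetric x"
    by (simp add: symmetric_def xv inner_add_left inner_add_right inner_adj_left[OF kb] inner_adj_right[OF kb])
  have xb: "x \<in> bounded_ops" using xM M' by blast
  have "x o\<^sub>L a o\<^sub>L x \<in> A" if a: "a \<in> A" for a
  proof -
    have "x o\<^sub>L a o\<^sub>L x = (k o\<^sub>L a o\<^sub>L adj k) + (adj k o\<^sub>L a o\<^sub>L k)"
      by (rule blinfun_eqI) (simp add: xv blinfun.add_right blinfun.add_left kak[OF a])
    then show ?thesis using k(2) a A' by (simp add: normalizing_def)
  qed
  then have "normalizing A x" using xb xsym adj_eq_self_iff[OF xb] by (simp add: normalizing_def)
  then have Tx: "T (x z) = x (T z)" for z by (rule symmetric_normalizing_commute[OF xM xsym])
  have kx: "k z = h (x (g z))" for z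
  proof -
    have "h (adj k (g z)) = h (g (adj k (g z)))" by (simp add: adjk)
    then show ?thesis by (simp add: xv blinfun.add_right hkg hg)
  qed
  show ?thesis by (simp add: kx commutes_with_subalgebra g' h' Tx)
qed

text \<open>Since \<open>T\<close> commutes with \<open>A\<close>, the commutator \<open>D = T n - n T\<close> satisfies \<open>T n b - n b T = D b\<close> for
  \<open>b\<close> in \<open>A\<close>; thus \<open>D b = 0\<close> as soon as \<open>T\<close> commutes with \<open>n b\<close>. Let \<open>f\<close> be the smallest
  projection of \<open>A\<close> with \<open>D (1 - f) = 0\<close>. If \<open>n f\<close> had an off-diagonal block \<open>h n g \<noteq> 0\<close> with
  \<open>g \<le> f\<close> and \<open>g h = 0\<close>, then \<open>b = n\<^sup>* h n g\<close> would be a nonzero element of \<open>A f\<close> for which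
  \<open>n b = h n (n\<^sup>* n g)\<close> is off-diagonal and commutes with \<open>T\<close>, so that \<open>D b = 0\<close> contradicts the choice
  of \<open>f\<close>. Without such blocks, \<open>n f\<close> commutes with \<open>A\<close>; then \<open>T\<close> commutes with \<open>n f\<close>, and
  \<open>D f = 0\<close> forces \<open>f = 0\<close>.\<close>

theorem normalizing_commute:
  assumes n: "n \<in> M" "normalizing A n"
  shows "T (n v) = n (T v)"
proof -
  note M' = von_neumannD[OF M] star_subalgebraD[OF von_neumannD(1)[OF M]]
  note A' = von_neumannD[OF A] star_subalgebraD[OF von_neumannD(1)[OF A]]
  have Ab: "A \<subseteq> bounded_ops" using A' by blast
  have nb: "n \<in> bounded_ops" and Tb: "T \<in> bounded_ops" using n M' commutant_bounded[OF T] by auto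
  define D where "D = (T o\<^sub>L n) - (n o\<^sub>L T)"
  have Dv: "D z = T (n z) - n (T z)" for z by (simp add: D_def blinfun.diff_left)
  have Db: "D (c *\<^sub>C z) = c *\<^sub>C D z" for c z
    by (simp add: Dv bounded_opsD[OF nb] bounded_opsD[OF Tb] scaleC_diff_right)
  \<comment> \<open>The largest subspace of the kernel of \<open>D\<close> that is invariant under \<open>A'\<close>; its projection is \<open>1 - f\<close>.\<close>
  define X where "X = {z. \<forall>S\<in>commutant A. D (S z) = 0}"
  have A'c: "star_subalgebra (commutant A)" by (rule star_subalgebra_commutant[OF A'(3)])
  note Ac = star_subalgebraD[OF A'c]
  have idc: "id_blinfun \<in> commutant A" by (rule commutantI) (simp_all add: bounded_ops_id)
  have "closed (\<Inter>S\<in>commutant A. {z. D (blinfun_apply S z) = 0})"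
    by (intro closed_INT ballI closed_Collect_eq continuous_intros)
  moreover have "X = (\<Inter>S\<in>commutant A. {z. D (blinfun_apply S z) = 0})" by (auto simp: X_def)
  ultimately have "closed X" by simp
  moreover have "subspace X"
    by (auto simp: subspace_def X_def blinfun.zero_right blinfun.add_right blinfun.scaleR_right)
  moreover have "c *\<^sub>C z \<in> X" if "z \<in> X" for c z
    using that Ac(1) by (auto simp: X_def bounded_opsD Db)
  moreover have "R z \<in> X" if "R \<in> commutant A" "z \<in> X" for R z
  proof -
    have "D (S (R z)) = 0" if S: "S \<in> commutant A" for S
      using Ac(4)[OF S \<open>R \<in> commutant A\<close>] \<open>z \<in> X\<close> unfolding X_def by fastforce
    then show ?thesis by (simp add: X_def)
  qed
  ultimately obtain P where P: "P \<in> commutant (commutant A)" "symmetric P" "P o\<^sub>L P = P"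
    "\<And>z. P z \<in> X" "\<And>z. z \<in> X \<Longrightarrow> P z = z"
    using projection_in_commutant[OF star_subalgebra_adjoint_closed[OF A'c], of X] by blast
  have PA: "P \<in> A" using P(1) A'(2) by simp
  define f where "f = id_blinfun - P"
  have fv: "f z = z - P z" for z by (simp add: f_def blinfun.diff_left)
  have fA: "f \<in> A" unfolding f_def by (intro A' PA)
  have PP: "P (P z) = P z" for z using P(4,5) by blast
  have ff: "f (f z) = f z" for z by (simp add: fv blinfun.diff_right PP)
  have f0: "f z = 0" if z: "z \<in> X" for z using P(5)[OF z] by (simp add: fv)
  have key: "f (b z) = 0" if b: "b \<in> A" and Dfb: "\<And>w. D (f (b w)) = 0" for b z
  proof -
    have "D (S (f (b z))) = 0" if S: "S \<in> commutant A" for S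
      using Dfb[of "S z"] commutantD[OF S fA] commutantD[OF S b] by simp
    then have "f (b z) \<in> X" by (simp add: X_def)
    then show ?thesis using f0 ff by metis
  qed
  have noff: "h (n (g z)) = 0" if gp: "g \<in> projections A" and hp: "h \<in> projections A"
    and gf: "\<And>z. f (g z) = g z" and gh: "\<And>z. g (h z) = 0" for g h z
  proof -
    note g' = projectionsD[OF gp Ab] and h' = projectionsD[OF hp Ab]
    have nhn: "adj n o\<^sub>L h o\<^sub>L n \<in> A" and nn: "adj n o\<^sub>L id_blinfun o\<^sub>L n \<in> A" and nn': "n o\<^sub>L id_blinfun o\<^sub>L adj n \<in> A"
      using n(2) h'(1) A'(5) unfolding normalizing_def by blast+
    define b where "b = (adj n o\<^sub>L h o\<^sub>L n) o\<^sub>L g"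
    have bA: "b \<in> A" unfolding b_def by (intro A' nhn g')
    have bv: "b w = g (adj n (h (n w)))" for w
      using subalgebra_commute[OF nhn g'(1), of w] by (simp add: b_def)
    have fb: "f (b w) = b w" for w by (simp add: bv gf)
    define k where "k = h o\<^sub>L n o\<^sub>L ((adj n o\<^sub>L id_blinfun o\<^sub>L n) o\<^sub>L g)"
    have kv: "k w = h (n (adj n (n (g w))))" for w by (simp add: k_def)
    have nbk: "n (b w) = k w" for w
      using subalgebra_commute[OF nn' h'(1), of "n (g w)"] by (simp add: b_def kv)
    have "T (k w) = k (T w)" for w
    proof (rule off_diagonal_normalizing_commute[OF _ _ gp hp gh])
      have "h \<in> M" "g \<in> M" "adj n o\<^sub>L id_blinfun o\<^sub>L n \<in> M" using nn h' g' AM by auto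
      then show "k \<in> M" unfolding k_def by (intro M' n)
      show "normalizing A k" unfolding k_def
        by (intro normalizing_compose n normalizing_self A'(1) nn g' h')
      show "h (k (g z)) = k z" for z by (simp add: kv h' g')
    qed
    then have "D (f (b w)) = 0" for w
      unfolding fb by (simp add: Dv nbk commutes_with_subalgebra[OF bA])
    then have "b z = 0" using key[OF bA, of z] fb by simp
    then have "inner (b z) (g z) = 0" by simp
    then have "inner (h (n (g z))) (h (n (g z))) = 0"
      by (simp add: b_def g' inner_adj_left[OF nb] h'(3) h'(2))
    then show ?thesis by simp
  qed
  have fp: "f \<in> projections A"
    by (rule projectionsI[OF fA Ab ff]) (auto simp: f_def intro: symmetric_diff symmetric_id P)
  note f' = projectionsD[OF fp Ab]
  have comm_p: "n (f (p z)) = p (n (f z))" if p: "p \<in> projections A" for p z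
  proof -
    note p' = projectionsD[OF p Ab]
    define r where "r = id_blinfun - p"
    have rv: "r z = z - p z" for z by (simp add: r_def blinfun.diff_left)
    have rA: "r \<in> A" unfolding r_def by (intro A' p')
    have rp: "r \<in> projections A"
      by (rule projectionsI[OF rA Ab]) (auto simp: rv blinfun.diff_right p' symmetric_def inner_diff_left inner_diff_right)
    have meet: "f o\<^sub>L t \<in> projections A" if t: "t \<in> projections A" for t
    proof -
      note t' = projectionsD[OF t Ab]
      show ?thesis
        by (rule projectionsI[OF _ Ab])
          (auto simp: A' f' t' subalgebra_commute[OF t'(1) fA] symmetric_def)
    qed
    \<comment> \<open>The two off-diagonal blocks of \<open>n f\<close> with respect to \<open>p\<close> and \<open>r = 1 - p\<close>.\<close>
    have "r (n ((f o\<^sub>L p) z)) = 0"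
      by (rule noff[OF meet[OF p] rp]) (simp_all add: f' rv blinfun.diff_right p')
    moreover have "p (n ((f o\<^sub>L r) z)) = 0"
      by (rule noff[OF meet[OF rp] p]) (simp_all add: f' rv blinfun.diff_right p')
    ultimately show ?thesis by (simp add: rv blinfun.diff_right)
  qed
  have nfM: "n o\<^sub>L f \<in> M" using fA AM by (intro M' n) auto
  have "(n o\<^sub>L f) (a z) = a ((n o\<^sub>L f) z)" if "a \<in> A" for a z
    by (rule commutes_if_commutes_with_projections[OF A _ _ that])
      (use nfM M' comm_p in auto)
  then have "T ((n o\<^sub>L f) z) = (n o\<^sub>L f) (T z)" for z by (rule relative_commutant_commute[OF nfM])
  then have "D (f (id_blinfun z)) = 0" for z by (simp add: Dv commutes_with_subalgebra[OF fA])
  then have "f z = 0" for z using key[OF A'(5), of z] by simp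
  then have "v \<in> X" using P(4)[of v] by (simp add: fv)
  then have "D (id_blinfun v) = 0" using idc unfolding X_def by blast
  then show ?thesis by (simp add: Dv)
qed

end

section \<open>Minimal projections in finite factors\<close>

text \<open>The elements \<open>S\<close> for which \<open>S e\<close> is a multiple of \<open>e\<close> form a norm closed subspace, and by minimality
  it contains every projection \<open>q\<close> of \<open>A\<close>, as \<open>q e\<close> is a subprojection of \<open>e\<close>.\<close>

lemma minimal_projection_scalar:
  fixes A :: "('h::chilbert_space \<Rightarrow>\<^sub>L 'h) set"
  assumes A: "von_neumann_algebra A" and comm: "commutative A"
    and e: "minimal_projection A e" and a: "a \<in> A"
  shows "\<exists>c. \<forall>x. a (e x) = c *\<^sub>C e x"
proof -
  note A' = von_neumannD[OF A] star_subalgebraD[OF von_neumannD(1)[OF A]]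
  have b: "A \<subseteq> bounded_ops" using A' by blast
  have ep: "e \<in> projections A" using e by (simp add: minimal_projection_def)
  note e' = projectionsD[OF ep b]
  have c: "S (T x) = T (S x)" if "S \<in> A" "T \<in> A" for S T x
    using commutativeD[OF comm that] .
  obtain z where z: "e z \<noteq> 0"
    using e unfolding minimal_projection_def by (metis blinfun_eqI zero_blinfun.rep_eq)
  let ?V = "{S \<in> bounded_ops. \<exists>c. \<forall>x. blinfun_apply S (e x) = c *\<^sub>C e x}"
  have "A \<subseteq> ?V"
  proof (rule projections_span_von_neumann_algebra[OF A])
    show "S + T \<in> ?V" if ST: "S \<in> ?V" "T \<in> ?V" for S T
    proof -
      obtain s t where "\<forall>x. S (e x) = s *\<^sub>C e x" "\<forall>x. T (e x) = t *\<^sub>C e x" using ST by auto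
      then have "\<forall>x. (S + T) (e x) = (s + t) *\<^sub>C e x" by (simp add: blinfun.add_left scaleC_add_left)
      then show ?thesis using ST bounded_ops_add by blast
    qed
    show "scaleC_op d T \<in> ?V" if T: "T \<in> ?V" for d T
    proof -
      obtain t where "\<forall>x. T (e x) = t *\<^sub>C e x" using T by auto
      then have "\<forall>x. scaleC_op d T (e x) = (d * t) *\<^sub>C e x" by (simp add: scaleC_op.rep_eq scaleC_scaleC)
      then show ?thesis using T bounded_ops_scaleC by blast
    qed
    show "projections A \<subseteq> ?V"
    proof
      fix q assume q: "q \<in> projections A"
      note q' = projectionsD[OF q b]
      have "q o\<^sub>L e \<in> projections A"
        by (rule projectionsI[OF _ b]) (auto simp: A' q' e' c[OF e'(1) q'(1)] symmetric_def)
      moreover have "e o\<^sub>L (q o\<^sub>L e) = q o\<^sub>L e" by (rule blinfun_eqI) (simp add: c[OF e'(1) q'(1)] e')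
      ultimately have "q o\<^sub>L e = 0 \<or> q o\<^sub>L e = e" using e by (simp add: minimal_projection_def)
      then have "(\<forall>x. q (e x) = 0 *\<^sub>C e x) \<or> (\<forall>x. q (e x) = 1 *\<^sub>C e x)"
        using scaleC_of_real[of 0] scaleC_of_real[of 1]
        by (metis blinfun_apply_blinfun_compose of_real_0 of_real_1 scaleR_one scaleR_zero_left zero_blinfun.rep_eq)
      then show "q \<in> ?V" using q'(5) by blast
    qed
    show "closed ?V"
      unfolding closed_sequential_limits
    proof (intro allI impI, elim conjE)
      fix f T assume f: "\<forall>n. f n \<in> ?V" and lim: "f \<longlonglongrightarrow> T"
      then have T: "T \<in> bounded_ops" using f by (intro closed_sequentially[OF closed_bounded_ops _ lim]) auto
      have "\<forall>n. \<exists>s. \<forall>x. f n (e x) = s *\<^sub>C e x" using f by blast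
      then obtain s where s: "\<And>n x. f n (e x) = s n *\<^sub>C e x" using choice[of "\<lambda>n s. \<forall>x. f n (e x) = s *\<^sub>C e x"] by blast
      have limv: "(\<lambda>n. s n *\<^sub>C e x) \<longlonglongrightarrow> T (e x)" for x
      proof -
        have "(\<lambda>n. f n (e x)) \<longlonglongrightarrow> T (e x)" by (intro tendsto_intros lim)
        then show ?thesis by (simp add: s)
      qed
      have dist: "dist (s m *\<^sub>C y) (s n *\<^sub>C y) = dist (s m) (s n) * norm y" for m n and y :: 'h
      proof -
        have "s m *\<^sub>C y - s n *\<^sub>C y = (s m - s n) *\<^sub>C y"
          using scaleC_add_left[of "s m - s n" "s n" y] by simp
        then show ?thesis by (simp add: dist_norm norm_scaleC)
      qed
      have "Cauchy s"
      proof (rule metric_CauchyI)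
        fix r :: real assume r: "r > 0"
        have "Cauchy (\<lambda>n. s n *\<^sub>C e z)" using limv by (rule LIMSEQ_imp_Cauchy)
        then obtain N where N: "\<And>m n. m \<ge> N \<Longrightarrow> n \<ge> N \<Longrightarrow> dist (s m *\<^sub>C e z) (s n *\<^sub>C e z) < r * norm (e z)"
          using metric_CauchyD[of "\<lambda>n. s n *\<^sub>C e z" "r * norm (e z)"] r z by auto
        then show "\<exists>N. \<forall>m\<ge>N. \<forall>n\<ge>N. dist (s m) (s n) < r" using z by (intro exI[of _ N]) (auto simp: dist)
      qed
      then obtain t where t: "s \<longlonglongrightarrow> t" using Cauchy_convergent_iff convergent_def by blast
      have "T (e x) = t *\<^sub>C e x" for x
      proof (rule LIMSEQ_unique[OF limv])
        have "(\<lambda>n. cmod (s n - t) * norm (e x)) \<longlonglongrightarrow> 0 * norm (e x)"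
          by (intro tendsto_intros) (use t in \<open>simp add: LIM_zero tendsto_norm_zero\<close>)
        moreover have "s n *\<^sub>C e x - t *\<^sub>C e x = (s n - t) *\<^sub>C e x" for n
          using scaleC_add_left[of "s n - t" t "e x"] by simp
        ultimately have "(\<lambda>n. norm (s n *\<^sub>C e x - t *\<^sub>C e x)) \<longlonglongrightarrow> 0" by (simp add: norm_scaleC)
        then show "(\<lambda>n. s n *\<^sub>C e x) \<longlonglongrightarrow> t *\<^sub>C e x" by (simp add: tendsto_norm_zero_iff LIM_zero_iff)
      qed
      then show "T \<in> ?V" using T by blast
    qed
  qed
  then show ?thesis using a by blast
qed

lemma orthogonal_series_converges:
  fixes t :: "nat \<Rightarrow> 'a::{real_inner,complete_space} \<Rightarrow>\<^sub>L 'a"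
  assumes orth: "\<And>i j x y. i \<noteq> j \<Longrightarrow> inner (t i x) (t j y) = 0"
    and bessel: "\<And>k x. (\<Sum>i<k. (norm (t i x))\<^sup>2) \<le> (norm x)\<^sup>2"
  shows "\<exists>S::'a \<Rightarrow>\<^sub>L 'a. (\<forall>x. (\<lambda>k. (\<Sum>i<k. t i) x) \<longlonglongrightarrow> S x)
    \<and> (\<forall>x. (\<lambda>k. \<Sum>i<k. (norm (t i x))\<^sup>2) \<longlonglongrightarrow> (norm (S x))\<^sup>2)"
proof -
  have ip: "inner ((\<Sum>i<k. t i) x) ((\<Sum>i<l. t i) x) = (\<Sum>i<l. (norm (t i x))\<^sup>2)" if "l \<le> k" for k l x
  proof -
    have "inner ((\<Sum>i<k. t i) x) ((\<Sum>i<l. t i) x) = (\<Sum>j<l. \<Sum>i<k. inner (t i x) (t j x))"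
      by (simp add: blinfun.sum_left inner_sum_left inner_sum_right sum.swap[of _ "{..<l}"])
    also have "\<dots> = (\<Sum>j<l. (norm (t j x))\<^sup>2)"
    proof (rule sum.cong[OF refl])
      fix j assume "j \<in> {..<l}"
      then have j: "j \<in> {..<k}" using that by simp
      have "(\<Sum>i<k. inner (t i x) (t j x)) = (\<Sum>i\<in>{j}. inner (t i x) (t j x))"
        by (rule sum.mono_neutral_right) (use j orth in auto)
      then show "(\<Sum>i<k. inner (t i x) (t j x)) = (norm (t j x))\<^sup>2" by (simp add: power2_norm_eq_inner)
    qed
    finally show ?thesis .
  qed
  have sq: "(norm ((\<Sum>i<k. t i) x))\<^sup>2 = (\<Sum>i<k. (norm (t i x))\<^sup>2)" for k x
    using ip[of k k x] by (simp add: power2_norm_eq_inner)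
  have "\<exists>S::'a \<Rightarrow>\<^sub>L 'a. (\<forall>x. (\<lambda>k. (\<Sum>i<k. t i) x) \<longlonglongrightarrow> S x) \<and> (\<forall>x. norm (S x) \<le> norm x)"
  proof (rule monotone_strong_convergence)
    show "norm ((\<Sum>i<k. t i) x) \<le> norm x" for k x
      by (rule power2_le_imp_le) (simp_all add: sq bessel)
    show "(norm ((\<Sum>i<l. t i) x))\<^sup>2 \<le> inner ((\<Sum>i<k. t i) x) ((\<Sum>i<l. t i) x)" if "l \<le> k" for l k x
      using ip[OF that] by (simp add: sq)
  qed
  then obtain S :: "'a \<Rightarrow>\<^sub>L 'a" where S: "\<And>x. (\<lambda>k. (\<Sum>i<k. t i) x) \<longlonglongrightarrow> S x" by blast
  have "(\<lambda>k. \<Sum>i<k. (norm (t i x))\<^sup>2) \<longlonglongrightarrow> (norm (S x))\<^sup>2" for x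
    unfolding sq[symmetric] by (intro tendsto_intros S)
  then show ?thesis using S by blast
qed

lemma isometry_adj:
  assumes "v \<in> bounded_ops" and "\<And>x. norm (v x) = norm x"
  shows "adj v o\<^sub>L v = id_blinfun"
proof (rule blinfun_eqI, rule inner_eqI)
  fix x y
  have sq: "inner (v z) (v z) = inner z z" for z
    using assms(2)[of z] by (simp add: power2_norm_eq_inner[symmetric])
  have "inner (v x) (v y) = inner x y"
    using sq[of "x + y"] sq[of x] sq[of y]
    by (simp add: blinfun.add_right inner_add_left inner_add_right inner_commute)
  then show "inner ((adj v o\<^sub>L v) x) y = inner (id_blinfun x) y"
    by (simp add: inner_adj_left[OF assms(1)])
qed

text \<open>The adjoints \<open>w\<^sub>i\<^sup>*\<close> are partial isometries from the range of \<open>e\<close> onto pairwise orthogonal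
  subspaces, the ranges of \<open>f\<^sub>i = w\<^sub>i\<^sup>* w\<^sub>i\<close>. The operator that shifts the range of each \<open>f\<^sub>i\<close> onto that of
  \<open>f\<^sub>i\<^sub>+\<^sub>1\<close> and is the identity orthogonally to all of them is an isometry whose range is orthogonal to
  that of \<open>f\<^sub>0\<close>. Finiteness makes it surjective, so \<open>f\<^sub>0 = 0\<close>.\<close>

lemma finite_algebra_equivalent_orthogonal:
  fixes M :: "('h::chilbert_space \<Rightarrow>\<^sub>L 'h) set" and w :: "nat \<Rightarrow> 'h \<Rightarrow>\<^sub>L 'h" and e :: "'h \<Rightarrow>\<^sub>L 'h"
  assumes M: "von_neumann_algebra M" and fin: "finite_algebra M" and wM: "\<And>i. w i \<in> M"
    and we: "\<And>i x. w i (adj (w i) x) = e x" "\<And>i x. e (w i x) = w i x"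
    and orth: "\<And>i j x. i \<noteq> j \<Longrightarrow> w i (adj (w j) x) = 0"
  shows "e = 0"
proof -
  note M' = von_neumannD[OF M] star_subalgebraD[OF von_neumannD(1)[OF M]]
  have wb: "w i \<in> bounded_ops" for i using wM M' by blast
  note adjw = inner_adj_left[OF wb] inner_adj_right[OF wb]
  define f g where "f i = adj (w i) o\<^sub>L w i" and "g i = adj (w (Suc i)) o\<^sub>L w i" for i
  have fv: "f i x = adj (w i) (w i x)" and gv: "g i x = adj (w (Suc i)) (w i x)" for i x
    by (simp_all add: f_def g_def)
  have fg_norm: "(norm (f i x))\<^sup>2 = inner (f i x) x" "(norm (g i x))\<^sup>2 = inner (f i x) x" for i x
    by (simp_all add: fv gv power2_norm_eq_inner adjw we)
  have f_orth: "inner (f i x) (f j y) = 0" and g_orth: "inner (g i x) (g j y) = 0" if "i \<noteq> j" for i j x y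
    using that by (simp_all add: fv gv adjw orth)
  have bessel: "(\<Sum>i<k. inner (f i x) x) \<le> (norm x)\<^sup>2" for k x
  proof -
    let ?F = "\<Sum>i<k. f i x"
    have "(norm ?F)\<^sup>2 = (\<Sum>i<k. \<Sum>j<k. inner (f i x) (f j x))"
      by (simp add: power2_norm_eq_inner inner_sum_left inner_sum_right) (rule sum.swap)
    also have "\<dots> = (\<Sum>i<k. inner (f i x) x)"
    proof (rule sum.cong[OF refl])
      fix i assume "i \<in> {..<k}"
      then have "(\<Sum>j<k. inner (f i x) (f j x)) = (\<Sum>j\<in>{i}. inner (f i x) (f j x))"
        by (intro sum.mono_neutral_right) (use f_orth in auto)
      then show "(\<Sum>j<k. inner (f i x) (f j x)) = inner (f i x) x"
        by (simp add: power2_norm_eq_inner[symmetric] fg_norm)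
    qed
    finally have *: "(norm ?F)\<^sup>2 = inner ?F x" by (simp add: inner_sum_left)
    also have "\<dots> \<le> norm ?F * norm x" by (rule norm_cauchy_schwarz)
    finally have "norm ?F \<le> norm x" by (cases "?F = 0") (auto simp: power2_eq_square)
    then have "(norm ?F)\<^sup>2 \<le> (norm x)\<^sup>2" by (intro power_mono) auto
    then show ?thesis using * by (simp add: inner_sum_left)
  qed
  obtain F :: "'h \<Rightarrow>\<^sub>L 'h" where F: "\<And>x. (\<lambda>k. (\<Sum>i<k. f i) x) \<longlonglongrightarrow> F x"
      "\<And>x. (\<lambda>k. \<Sum>i<k. (norm (f i x))\<^sup>2) \<longlonglongrightarrow> (norm (F x))\<^sup>2"
    using orthogonal_series_converges[of f] f_orth bessel by (auto simp: fg_norm)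
  obtain G :: "'h \<Rightarrow>\<^sub>L 'h" where G: "\<And>x. (\<lambda>k. (\<Sum>i<k. g i) x) \<longlonglongrightarrow> G x"
      "\<And>x. (\<lambda>k. \<Sum>i<k. (norm (g i x))\<^sup>2) \<longlonglongrightarrow> (norm (G x))\<^sup>2"
    using orthogonal_series_converges[of g] g_orth bessel by (auto simp: fg_norm)
  have sumM: "(\<Sum>i<k. t i) \<in> commutant (commutant M)" if "\<And>i. t i \<in> M" for t :: "nat \<Rightarrow> 'h \<Rightarrow>\<^sub>L 'h" and k
    unfolding M'(2) by (induction k) (auto simp: M' that)
  have fgM: "f i \<in> M" "g i \<in> M" for i by (simp_all add: f_def g_def M' wM)
  have FM: "F \<in> M" using commutant_strong_limit[OF sumM[of f, OF fgM(1)] F(1)] M'(2) by simp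
  have GM: "G \<in> M" using commutant_strong_limit[OF sumM[of g, OF fgM(2)] G(1)] M'(2) by simp
  have wf: "w i (f j x) = (if i = j then w i x else 0)" for i j x
    by (auto simp: fv we orth)
  have wF: "w i (F x) = w i x" for i x
  proof -
    have lim: "(\<lambda>k. w i ((\<Sum>j<k. f j) x)) \<longlonglongrightarrow> w i (F x)" by (intro tendsto_intros F(1))
    have "\<forall>\<^sub>F k in sequentially. w i ((\<Sum>j<k. f j) x) = w i x"
      using eventually_gt_at_top[of i]
      by eventually_elim (simp add: blinfun.sum_left blinfun.sum_right wf)
    then show ?thesis by (rule LIMSEQ_unique[OF lim tendsto_eventually])
  qed
  have w0G: "w 0 (G x) = 0" for x
  proof -
    have "(\<lambda>k. w 0 ((\<Sum>j<k. g j) x)) \<longlonglongrightarrow> w 0 (G x)" by (intro tendsto_intros G(1))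
    then show ?thesis by (simp add: blinfun.sum_left blinfun.sum_right gv orth LIMSEQ_const_iff)
  qed
  have ortho: "inner (x - F x) (F y) = 0" "inner (x - F x) (G y) = 0" for x y
  proof -
    have "(\<lambda>k. inner (x - F x) ((\<Sum>j<k. f j) y)) \<longlonglongrightarrow> inner (x - F x) (F y)" by (intro tendsto_intros F(1))
    then show "inner (x - F x) (F y) = 0"
      by (simp add: blinfun.sum_left inner_sum_right fv adjw blinfun.diff_right wF LIMSEQ_const_iff)
    have "(\<lambda>k. inner (x - F x) ((\<Sum>j<k. g j) y)) \<longlonglongrightarrow> inner (x - F x) (G y)" by (intro tendsto_intros G(1))
    then show "inner (x - F x) (G y) = 0"
      by (simp add: blinfun.sum_left inner_sum_right gv adjw blinfun.diff_right wF LIMSEQ_const_iff)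
  qed
  have FG: "(norm (G x))\<^sup>2 = (norm (F x))\<^sup>2" for x
    using LIMSEQ_unique[OF G(2)[of x]] F(2)[of x] by (simp add: fg_norm)
  define v where "v = id_blinfun - F + G"
  have vv: "v x = (x - F x) + G x" for x by (simp add: v_def blinfun.add_left blinfun.diff_left)
  have vM: "v \<in> M" unfolding v_def by (intro M' FM GM)
  have "norm (v x) = norm x" for x
  proof -
    have "(norm (v x))\<^sup>2 = (norm (x - F x))\<^sup>2 + (norm (G x))\<^sup>2"
      using ortho(2)[of x x] by (simp add: vv power2_norm_eq_inner inner_add_left inner_add_right inner_commute)
    also have "\<dots> = (norm ((x - F x) + F x))\<^sup>2"
      using ortho(1)[of x x] unfolding FG by (simp only: power2_norm_eq_inner inner_add_left inner_add_right inner_commute[of "F x" "x - F x"])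
    finally show ?thesis by simp
  qed
  then have "adj v o\<^sub>L v = id_blinfun" using vM M' by (intro isometry_adj) auto
  then have "v o\<^sub>L adj v = id_blinfun" using fin vM by (simp add: finite_algebra_def)
  then have "v (adj v x) = x" for x by (metis blinfun_apply_blinfun_compose blinfun_apply_id_blinfun)
  moreover have "w 0 (v x) = 0" for x by (simp add: vv blinfun.add_right blinfun.diff_right wF w0G)
  ultimately have "w 0 x = 0" for x by metis
  then have "e x = 0" for x using we(1)[of 0 x] by simp
  then show ?thesis by (intro blinfun_eqI) simp
qed

section \<open>Irreducibility and the atoms of a normalized subalgebra\<close>


lemma cinner_self: "cinner x x = complex_of_real ((norm (x::'h::complex_inner))\<^sup>2)"
proof (rule complex_eqI)
  show "Re (cinner x x) = Re (complex_of_real ((norm x)\<^sup>2))" by (simp add: Re_cinner power2_norm_eq_inner)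
  show "Im (cinner x x) = Im (complex_of_real ((norm x)\<^sup>2))"
    using arg_cong[OF cinner_commute[of x x], of Im] by simp
qed

lemma cinner_adj_right: "T \<in> bounded_ops \<Longrightarrow> cinner x (adj T y) = cinner (T x) y"
  by (rule complex_eqI)
    (simp_all add: Re_cinner Im_cinner inner_adj_right bounded_opsD[OF bounded_ops_adj, symmetric])

text \<open>The projection onto \<open>V\<close> lies in the center of \<open>M\<close>.\<close>

lemma factor_irreducible:
  fixes M :: "('h::chilbert_space \<Rightarrow>\<^sub>L 'h) set"
  assumes M: "factor M" and N: "N \<subseteq> M" "\<And>n. n \<in> N \<Longrightarrow> adj n \<in> N" "commutant N \<subseteq> commutant M"
    and V: "closed V" "subspace V" "\<And>c x. x \<in> V \<Longrightarrow> c *\<^sub>C x \<in> V"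
    and inv: "\<And>n x. n \<in> N \<Longrightarrow> x \<in> V \<Longrightarrow> n x \<in> V"
      "\<And>S x. S \<in> commutant M \<Longrightarrow> x \<in> V \<Longrightarrow> S x \<in> V"
    and proper: "y \<notin> V" and x: "x \<in> V"
  shows "x = 0"
proof -
  have vM: "von_neumann_algebra M" using M by (simp add: factor_def)
  note M' = von_neumannD[OF vM] star_subalgebraD[OF von_neumannD(1)[OF vM]]
  have "adjoint_closed (commutant M \<union> N)"
    using adjoint_closed_commutant[OF M'(3)] N(1,2) M' by (auto simp: adjoint_closed_def)
  from projection_in_commutant[OF this V] inv obtain P where P: "P \<in> commutant (commutant M \<union> N)"
    "\<And>x. P x \<in> V" "\<And>x. x \<in> V \<Longrightarrow> P x = x" by blast
  have "P \<in> M" using P(1) commutant_antimono[of "commutant M" "commutant M \<union> N"] M'(2) by auto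
  moreover have "P \<in> commutant M" using P(1) commutant_antimono[of N "commutant M \<union> N"] N(3) by auto
  ultimately obtain c where c: "P = scaleC_op c id_blinfun" using M unfolding factor_def by blast
  have "(1 / c) *\<^sub>C P y \<in> V" by (intro V P)
  then have "c = 0" using proper scaleC_of_real[of 1 y]
    by (cases "c = 0") (auto simp: c scaleC_op.rep_eq scaleC_scaleC)
  then show "x = 0" using P(3)[OF x] by (simp add: c)
qed

text \<open>The partial isometries \<open>w\<close> in \<open>W\<close> are the normalized nonzero operators \<open>e n\<close> with \<open>n\<close> normalizing,
  and the projections \<open>w\<^sup>* w\<close> are the minimal projections of \<open>A\<close> met by moving \<open>e\<close> around with
  normalizing operators. The vectors killed by all \<open>e n\<close> form a subspace invariant under the normalizing
  operators and under \<open>M'\<close>, hence zero. So the set of these projections is either infinite, against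
  finiteness of \<open>M\<close>, or finite with sum 1; in the latter case it spans \<open>A\<close>.\<close>

lemma minimal_projection_finite_dimensional:
  fixes M :: "('h::chilbert_space \<Rightarrow>\<^sub>L 'h) set"
  assumes M: "factor M" and fin: "finite_algebra M"
    and A: "von_neumann_algebra A" and AM: "A \<subseteq> M" and comm: "commutative A"
    and gen: "commutant {n \<in> M. normalizing A n} \<subseteq> commutant M"
    and min: "minimal_projection A e"
  shows "\<exists>F. finite F \<and> A \<subseteq> cop_span F"
proof -
  have vM: "von_neumann_algebra M" using M by (simp add: factor_def)
  note M' = von_neumannD[OF vM] star_subalgebraD[OF von_neumannD(1)[OF vM]]
  note A' = von_neumannD[OF A] star_subalgebraD[OF von_neumannD(1)[OF A]]
  have Ab: "A \<subseteq> bounded_ops" using A' by blast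
  have ep: "e \<in> projections A" and e0: "e \<noteq> 0" using min by (auto simp: minimal_projection_def)
  note e' = projectionsD[OF ep Ab]
  have Ac: "S (T x) = T (S x)" if "S \<in> A" "T \<in> A" for S T x
    using commutativeD[OF comm that] .
  obtain z0 where z0: "e z0 \<noteq> 0" using e0 by (metis blinfun_eqI zero_blinfun.rep_eq)
  define \<xi> where "\<xi> = (1 / norm (e z0)) *\<^sub>R e z0"
  have \<xi>: "e \<xi> = \<xi>" "norm \<xi> = 1" using z0 by (simp_all add: \<xi>_def blinfun.scaleR_right e')
  let ?N = "{n \<in> M. normalizing A n}"
  define W where "W = {w \<in> M. normalizing A w \<and> w o\<^sub>L adj w = e \<and> e o\<^sub>L w = w}"
  have sep: "x = 0" if x: "\<And>w. w \<in> W \<Longrightarrow> w x = 0" for x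
  proof -
    define V where "V = {x. \<forall>n\<in>?N. e (n x) = 0}"
    have "V = (\<Inter>n\<in>?N. {x. e (blinfun_apply n x) = 0})" by (auto simp: V_def)
    moreover have "closed (\<Inter>n\<in>?N. {x. e (blinfun_apply n x) = 0})"
      by (intro closed_INT ballI closed_Collect_eq continuous_intros)
    ultimately have 1: "closed V" by simp
    have 2: "subspace V" by (auto simp: V_def subspace_def blinfun.zero_right blinfun.add_right blinfun.scaleR_right)
    have 3: "c *\<^sub>C x \<in> V" if "x \<in> V" for c x
      using that e'(5) M'(6) by (auto simp: V_def bounded_opsD)
    have 4: "m x \<in> V" if m: "m \<in> ?N" and x: "x \<in> V" for m x
    proof -
      have "n o\<^sub>L m \<in> ?N" if "n \<in> ?N" for n
        using that m by (auto intro: M'(9) normalizing_compose)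
      then show ?thesis using x by (force simp: V_def)
    qed
    have 5: "S x \<in> V" if S: "S \<in> commutant M" and x: "x \<in> V" for S x
    proof -
      have "e \<in> M" using e'(1) AM by blast
      then have "e (n (S x)) = S (e (n x))" if "n \<in> M" for n
        using that by (simp add: commutantD[OF S])
      then show ?thesis using x by (simp add: V_def blinfun.zero_right)
    qed
    have "id_blinfun \<in> ?N" using M'(5) normalizing_self[OF A'(1,5)] by simp
    then have 6: "\<xi> \<notin> V" using \<xi> by (force simp: V_def)
    have 7: "adj n \<in> ?N" if "n \<in> ?N" for n using that by (auto intro: M'(11) normalizing_adj)
    have "x \<in> V"
      unfolding V_def
    proof (intro CollectI ballI)
      fix n assume n: "n \<in> ?N"
      then have nM: "n \<in> M" "normalizing A n" by auto
      have nb: "n \<in> bounded_ops" using nM M' by blast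
      have ennA: "n o\<^sub>L id_blinfun o\<^sub>L adj n \<in> A" using nM A'(5) by (auto simp: normalizing_def)
      obtain c where c: "\<And>x. (n o\<^sub>L id_blinfun o\<^sub>L adj n) (e x) = c *\<^sub>C e x"
        using minimal_projection_scalar[OF A comm min ennA] by blast
      \<comment> \<open>The scalar in \<open>e n n\<^sup>* e = r e\<close>: real and nonnegative, and \<open>r = 0\<close> only if \<open>e n = 0\<close>.\<close>
      define r where "r = (norm (adj n \<xi>))\<^sup>2"
      have "c * cinner \<xi> \<xi> = cinner (adj n \<xi>) (adj n \<xi>)"
        using c[of \<xi>] by (simp add: \<xi> cinner_adj_right[OF nb] cinner_scaleC_left[symmetric])
      then have cr: "c = complex_of_real r" by (simp add: cinner_self \<xi> r_def)
      have nn: "n (adj n (e x)) = r *\<^sub>R e x" for x using c[of x] by (simp add: cr scaleC_of_real)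
      show "e (n x) = 0"
      proof (cases "r = 0")
        case True
        have "inner (e (n x)) (e (n x)) = inner x (adj n (e (n x)))"
          by (simp add: inner_adj_right[OF nb] e')
        also have "\<dots> = 0"
        proof -
          have "inner (adj n (e (n x))) (adj n (e (n x))) = inner (e (n x)) (n (adj n (e (n x))))"
            by (simp add: inner_adj_left[OF nb])
          then show ?thesis by (simp add: nn True)
        qed
        finally show ?thesis by simp
      next
        case False
        then have r: "r > 0" by (simp add: r_def)
        define w where "w = (1 / sqrt r) *\<^sub>R (e o\<^sub>L n)"
        have wv: "w y = (1 / sqrt r) *\<^sub>R e (n y)" for y by (simp add: w_def blinfun.scaleR_left)
        have wM: "w \<in> M" unfolding w_def using e'(1) AM nM by (intro M'(9,12)) auto
        have wb: "w \<in> bounded_ops" using wM M' by blast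
        have "normalizing A (e o\<^sub>L n)" using normalizing_compose[OF normalizing_self[OF A'(1) e'(1)] nM(2)] .
        moreover have "normalizing A ((1 / sqrt r) *\<^sub>R id_blinfun)"
          by (intro normalizing_self A')
        moreover have "w = ((1 / sqrt r) *\<^sub>R id_blinfun) o\<^sub>L (e o\<^sub>L n)"
          by (rule blinfun_eqI) (simp add: wv blinfun.scaleR_left)
        ultimately have wN: "normalizing A w" using normalizing_compose by metis
        have adjw: "adj w y = (1 / sqrt r) *\<^sub>R adj n (e y)" for y
          by (rule inner_eqI) (simp add: inner_adj_left[OF wb] wv inner_adj_left[OF nb] e')
        have "w o\<^sub>L adj w = e"
          using r by (intro blinfun_eqI) (simp add: wv adjw blinfun.scaleR_right nn e' real_sqrt_mult_self)
        moreover have "e o\<^sub>L w = w" by (rule blinfun_eqI) (simp add: wv blinfun.scaleR_right e')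
        ultimately have "w \<in> W" using wM wN by (simp add: W_def)
        then have "w x = 0" by (rule x)
        then show ?thesis using r by (simp add: wv)
      qed
    qed
    then show ?thesis
      using factor_irreducible[OF M _ 7 gen 1 2 3 4 5 6, of x] by blast
  qed
  have wprops: "w \<in> M" "normalizing A w" "w \<in> bounded_ops" "\<And>x. w (adj w x) = e x" "\<And>x. e (w x) = w x"
    "adj w o\<^sub>L w \<in> projections A" "adj w o\<^sub>L w \<noteq> 0"
    "\<And>a. a \<in> A \<Longrightarrow> \<exists>c. \<forall>x. a (adj w (w x)) = c *\<^sub>C adj w (w x)" if w: "w \<in> W" for w
  proof -
    show wM: "w \<in> M" and wN: "normalizing A w" using w by (auto simp: W_def)
    then show wb: "w \<in> bounded_ops" using M' by blast
    have "w o\<^sub>L adj w = e" "e o\<^sub>L w = w" using w by (auto simp: W_def)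
    then show ww: "w (adj w x) = e x" and ew: "e (w x) = w x" for x
      by (metis blinfun_apply_blinfun_compose)+
    have "adj w o\<^sub>L id_blinfun o\<^sub>L w \<in> A" using wN A'(5) by (auto simp: normalizing_def)
    then have fA: "adj w o\<^sub>L w \<in> A" by (simp add: blinfun_compose_id_right)
    show "adj w o\<^sub>L w \<in> projections A"
      by (rule projectionsI[OF fA Ab])
        (auto simp: ww ew symmetric_def inner_adj_left[OF wb] inner_adj_right[OF wb])
    show "adj w o\<^sub>L w \<noteq> 0"
    proof
      assume "adj w o\<^sub>L w = 0"
      then have "adj w (w x) = 0" for x by (metis blinfun_apply_blinfun_compose zero_blinfun.rep_eq)
      then have "e (e z0) = 0" using ww by (metis blinfun.zero_right)
      then show False using z0 e' by simp
    qed
    fix a assume a: "a \<in> A"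
    have "w o\<^sub>L a o\<^sub>L adj w \<in> A" using wN a by (auto simp: normalizing_def)
    then obtain c where c: "\<And>x. (w o\<^sub>L a o\<^sub>L adj w) (e x) = c *\<^sub>C e x"
      using minimal_projection_scalar[OF A comm min] by blast
    have "a (adj w (w x)) = c *\<^sub>C adj w (w x)" for x
    proof -
      have "a (adj w (w x)) = a ((adj w o\<^sub>L w) (adj w (w x)))" by (simp add: ww ew)
      also have "\<dots> = adj w (w (a (adj w (w x))))" using Ac[OF a fA] by simp
      also have "w (a (adj w (w x))) = c *\<^sub>C w x" using c[of "w x"] by (simp add: ew)
      finally show ?thesis by (simp add: bounded_opsD[OF bounded_ops_adj[OF wb]])
    qed
    then show "\<exists>c. \<forall>x. a (adj w (w x)) = c *\<^sub>C adj w (w x)" by blast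
  qed
  define \<Phi> where "\<Phi> = (\<lambda>w. adj w o\<^sub>L w) ` W"
  have \<Phi>p: "f \<in> projections A" if "f \<in> \<Phi>" for f using that wprops(6) by (auto simp: \<Phi>_def)
  note \<Phi>' = projectionsD[OF \<Phi>p Ab]
  have \<Phi>scal: "\<exists>c. a o\<^sub>L f = scaleC_op c f" if f: "f \<in> \<Phi>" and a: "a \<in> A" for f a
  proof -
    obtain w where w: "w \<in> W" "f = adj w o\<^sub>L w" using f by (auto simp: \<Phi>_def)
    obtain c where "\<forall>x. a (adj w (w x)) = c *\<^sub>C adj w (w x)" using wprops(8)[OF w(1) a] by blast
    then have "a o\<^sub>L f = scaleC_op c f" by (intro blinfun_eqI) (simp add: w scaleC_op.rep_eq)
    then show ?thesis by blast
  qed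
  have min\<Phi>: "g o\<^sub>L f = 0 \<or> g o\<^sub>L f = f" if f: "f \<in> \<Phi>" and g: "g \<in> \<Phi>" for f g
  proof -
    obtain c where c: "g o\<^sub>L f = scaleC_op c f" using \<Phi>scal[OF f \<Phi>'(1)[OF g]] by blast
    have "g o\<^sub>L (g o\<^sub>L f) = g o\<^sub>L f" by (rule blinfun_eqI) (simp add: \<Phi>'[OF g])
    moreover have "g o\<^sub>L scaleC_op c f = scaleC_op c (g o\<^sub>L f)"
      by (rule blinfun_eqI) (simp add: scaleC_op.rep_eq bounded_opsD[OF \<Phi>'(5)[OF g]])
    ultimately have "scaleC_op (c * c) f = scaleC_op c f" by (simp add: c)
    then have "c * c = c \<or> f = 0" by simp
    then show ?thesis using c by auto
  qed
  have ortho\<Phi>: "g o\<^sub>L f = 0" if fg: "f \<in> \<Phi>" "g \<in> \<Phi>" "f \<noteq> g" for f g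
  proof (rule ccontr)
    assume n: "g o\<^sub>L f \<noteq> 0"
    have "g o\<^sub>L f = f o\<^sub>L g" using comm \<Phi>'(1) fg unfolding commutative_def by blast
    then show False using min\<Phi>[OF fg(1,2)] min\<Phi>[OF fg(2,1)] n fg(3) by auto
  qed
  have "finite \<Phi>"
  proof (rule ccontr)
    assume "infinite \<Phi>"
    then obtain F :: "nat \<Rightarrow> 'h \<Rightarrow>\<^sub>L 'h" where F: "inj F" "range F \<subseteq> \<Phi>"
      using infinite_countable_subset by blast
    have "\<forall>i. \<exists>w. w \<in> W \<and> F i = adj w o\<^sub>L w" using F(2) by (auto simp: \<Phi>_def)
    then obtain w where w: "\<And>i. w i \<in> W" "\<And>i. F i = adj (w i) o\<^sub>L w i"
      using choice[of "\<lambda>i w. w \<in> W \<and> F i = adj w o\<^sub>L w"] by blast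
    note w' = wprops[OF w(1)]
    have "w i (adj (w j) x) = 0" if ij: "i \<noteq> j" for i j x
    proof -
      have "F i o\<^sub>L F j = 0" using F ij by (intro ortho\<Phi>) (auto dest: injD)
      then have "adj (w i) (w i (adj (w j) (w j y))) = 0" for y
        using w(2) by (metis blinfun_apply_blinfun_compose zero_blinfun.rep_eq)
      then have "e (w i (adj (w j) (e x))) = 0"
        using w'(4)[of i] w'(4)[of j x] by (metis blinfun.zero_right)
      then have *: "w i (adj (w j) (e x)) = 0" by (simp add: w'(5))
      have "adj (w j) (e x) = adj (w j) x"
        by (rule inner_eqI) (simp add: inner_adj_left[OF w'(3)] e'(3) w'(5))
      then show ?thesis using * by simp
    qed
    then have "e = 0"
      by (intro finite_algebra_equivalent_orthogonal[OF vM fin, of w]) (simp_all add: w')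
    then show False using e0 by simp
  qed
  moreover have "A \<subseteq> cop_span \<Phi>"
  proof
    fix a assume a: "a \<in> A"
    have one: "(\<Sum>f\<in>\<Phi>. blinfun_apply f x) = x" for x
    proof -
      have "w (x - (\<Sum>f\<in>\<Phi>. blinfun_apply f x)) = 0" if w: "w \<in> W" for w
      proof -
        define g where "g = adj w o\<^sub>L w"
        have g: "g \<in> \<Phi>" using w by (auto simp: \<Phi>_def g_def)
        have gf: "g (f x) = (if f = g then g x else 0)" if "f \<in> \<Phi>" for f
          using ortho\<Phi>[OF that g] \<Phi>'(2)[OF g]
          by (metis blinfun_apply_blinfun_compose zero_blinfun.rep_eq)
        have "g (\<Sum>f\<in>\<Phi>. blinfun_apply f x) = (\<Sum>f\<in>\<Phi>. if f = g then g x else 0)"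
          by (simp add: blinfun.sum_right gf)
        also have "\<dots> = g x" using \<open>finite \<Phi>\<close> g by simp
        finally have "g (x - (\<Sum>f\<in>\<Phi>. blinfun_apply f x)) = 0" by (simp add: blinfun.diff_right)
        then have "w (adj w (w (x - (\<Sum>f\<in>\<Phi>. blinfun_apply f x)))) = 0" by (simp add: g_def blinfun.zero_right)
        then show ?thesis using wprops(4,5)[OF w] by simp
      qed
      then have "x - (\<Sum>f\<in>\<Phi>. blinfun_apply f x) = 0" by (rule sep)
      then show ?thesis by simp
    qed
    have "a = (\<Sum>f\<in>\<Phi>. a o\<^sub>L f)"
      by (rule blinfun_eqI) (simp add: blinfun.sum_left blinfun.sum_right[symmetric] one)
    moreover have "(\<Sum>f\<in>\<Phi>. a o\<^sub>L f) \<in> cop_span \<Phi>"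
    proof (rule cop.span_sum)
      fix f assume f: "f \<in> \<Phi>"
      obtain c where "a o\<^sub>L f = scaleC_op c f" using \<Phi>scal[OF f a] by blast
      then show "a o\<^sub>L f \<in> cop_span \<Phi>" using cop.span_scale[OF cop.span_base[OF f]] by simp
    qed
    ultimately show "a \<in> cop_span \<Phi>" by simp
  qed
  ultimately show ?thesis by blast
qed

section \<open>Regular abelian subalgebras\<close>

text \<open>The operators commuting with \<open>S\<close> and with its adjoint form a C*-algebra containing the normalizers,
  hence containing \<open>B\<close>. Commuting with \<open>S\<close> is a strongly closed condition, so it extends to \<open>M\<close>.\<close>

lemma commutant_of_regular_normalizers:
  assumes B: "cstar_subalgebra B" "strongly_dense B M" and reg: "regular_in C B"
    and N: "adjoint_closed (normalizers B C)"
  shows "commutant (normalizers B C) \<subseteq> commutant M"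
proof
  fix S assume S: "S \<in> commutant (normalizers B C)"
  have Sb: "S \<in> bounded_ops" using S by (rule commutant_bounded)
  define X where "X = commutant {S, adj S}"
  have "adjoint_closed {S, adj S}" using Sb by (auto simp: adjoint_closed_def bounded_ops_adj adj_adj)
  then have "cstar_subalgebra X"
    unfolding X_def cstar_subalgebra_def by (intro conjI star_subalgebra_commutant closed_commutant)
  moreover have "normalizers B C \<subseteq> X"
  proof
    fix n assume n: "n \<in> normalizers B C"
    show "n \<in> X"
      unfolding X_def
    proof (rule commutantI)
      show "n \<in> bounded_ops" using n N by (auto simp: adjoint_closed_def)
      show "n (R x) = R (n x)" if "R \<in> {S, adj S}" for R x
        using that commutantD[OF S n] commutantD[OF commutant_adj[OF N S] n] by auto
    qed
  qed
  ultimately have "cstar_subalgebra hull normalizers B C \<subseteq> X" by (rule hull_minimal[rotated])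
  then have BX: "B \<subseteq> X" using reg by (simp add: regular_in_def)
  show "S \<in> commutant M"
  proof (rule commutantI[OF Sb])
    fix R x assume R: "R \<in> M"
    define Y where "Y = {R :: 'a \<Rightarrow>\<^sub>L 'a. S (blinfun_apply R x) - blinfun_apply R (S x) = 0}"
    have "continuous_map strong_operator_topology euclidean (\<lambda>R :: 'a \<Rightarrow>\<^sub>L 'a. blinfun_apply S (blinfun_apply R x))"
      using continuous_map_compose[OF strong_operator_topology_continuous_evaluation[of x], of euclidean "blinfun_apply S"]
      by (simp add: o_def linear_continuous_on blinfun.bounded_linear_right)
    then have "continuous_map strong_operator_topology euclidean
        (\<lambda>R :: 'a \<Rightarrow>\<^sub>L 'a. S (blinfun_apply R x) - blinfun_apply R (S x))"
      by (intro continuous_map_diff strong_operator_topology_continuous_evaluation)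
    then have "closedin strong_operator_topology
        {R \<in> topspace strong_operator_topology. S (blinfun_apply R x) - blinfun_apply R (S x) \<in> {0}}"
      by (rule closedin_continuous_map_preimage) simp
    then have "closedin strong_operator_topology Y"
      by (simp add: Y_def strong_operator_topology_topspace)
    moreover have "B \<subseteq> Y" using BX commutantD[of _ "{S, adj S}" S x] by (force simp: Y_def X_def)
    ultimately have "strong_operator_topology closure_of B \<subseteq> Y" by (rule closure_of_minimal[rotated])
    then show "S (R x) = R (S x)" using R B(2) by (auto simp: Y_def strongly_dense_def)
  qed
qed

theorem corollary2p3:
  fixes M :: "('h::chilbert_space \<Rightarrow>\<^sub>L 'h) set"
  assumes "factor M" and "type_II1 M" and "strongly_solid M" and "\<not> amenable M"
  shows "\<not> (\<exists>B. cstar_subalgebra B \<and> strongly_dense B M \<and>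
    (\<exists>C. star_subalgebra C \<and> C \<subseteq> B \<and> commutative C \<and> infinite_dimensional C \<and> regular_in C B))"
proof
  assume "\<exists>B. cstar_subalgebra B \<and> strongly_dense B M \<and>
    (\<exists>C. star_subalgebra C \<and> C \<subseteq> B \<and> commutative C \<and> infinite_dimensional C \<and> regular_in C B)"
  then obtain B C where B: "cstar_subalgebra B" "strongly_dense B M"
    and C: "star_subalgebra C" "C \<subseteq> B" "commutative C" "infinite_dimensional C" "regular_in C B"
    by blast
  have vM: "von_neumann_algebra M" using assms(1) by (simp add: factor_def)
  note M' = von_neumannD[OF vM] star_subalgebraD[OF von_neumannD(1)[OF vM]]
  note C' = star_subalgebraD[OF C(1)]
  have BM: "B \<subseteq> M" using B(2) by (simp add: strongly_dense_def)
  let ?N = "normalizers B C"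
  have NB: "n \<in> B" "n \<in> M" "n \<in> bounded_ops" if "n \<in> ?N" for n
    using that BM M' by (auto simp: normalizers_def)
  have NC: "n o\<^sub>L c o\<^sub>L adj n \<in> C" "adj n o\<^sub>L c o\<^sub>L n \<in> C" if "n \<in> ?N" "c \<in> C" for n c
    using that by (auto simp: normalizers_def)
  have Nadj: "adj n \<in> ?N" if n: "n \<in> ?N" for n
    using B(1) NB[OF n] NC[OF n]
    by (auto simp: normalizers_def adj_adj cstar_subalgebra_def star_subalgebraD)
  have Nac: "adjoint_closed ?N" using NB Nadj by (auto simp: adjoint_closed_def)
  have gen: "commutant ?N \<subseteq> commutant M" by (rule commutant_of_regular_normalizers[OF B C(5) Nac])
  have nondeg: "x = 0" if x: "\<And>c. c \<in> C \<Longrightarrow> c x = 0" for x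
  proof -
    define V where "V = {x. \<forall>c\<in>C. blinfun_apply c x = 0}"
    have "V = (\<Inter>c\<in>C. {x. blinfun_apply c x = 0})" by (auto simp: V_def)
    moreover have "closed (\<Inter>c\<in>C. {x. blinfun_apply c x = 0})"
      by (intro closed_INT ballI closed_Collect_eq continuous_intros)
    ultimately have 1: "closed V" by simp
    have 2: "subspace V" by (auto simp: V_def subspace_def blinfun.zero_right blinfun.add_right blinfun.scaleR_right)
    have 3: "a *\<^sub>C x \<in> V" if "x \<in> V" for a x using that C'(1) by (auto simp: V_def bounded_opsD)
    have 4: "n x \<in> V" if n: "n \<in> ?N" and x: "x \<in> V" for n x
      unfolding V_def
    proof (intro CollectI ballI)
      fix c assume c: "c \<in> C"
      \<comment> \<open>The vector \<open>c n x\<close> is zero because \<open>\<parallel>c n x\<parallel>\<^sup>2 = \<langle>n\<^sup>* c\<^sup>* c n x, x\<rangle>\<close> and \<open>x\<close> is killed by \<open>C\<close>.\<close>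
      have "adj n o\<^sub>L (adj c o\<^sub>L c) o\<^sub>L n \<in> C" by (intro NC n C' c)
      then have "(adj n o\<^sub>L (adj c o\<^sub>L c) o\<^sub>L n) x = 0" using x unfolding V_def by blast
      then have "adj n (adj c (c (n x))) = 0" by simp
      then have "inner (adj n (adj c (c (n x)))) x = 0" by simp
      then show "c (n x) = 0" by (simp add: inner_adj_left[OF NB(3)[OF n]] inner_adj_left[OF C'(1)[OF c]])
    qed
    have 5: "S x \<in> V" if S: "S \<in> commutant M" and x: "x \<in> V" for S x
    proof -
      have "c (S x) = S (c x)" if "c \<in> C" for c using that C(2) BM by (intro commutantD[OF S, symmetric]) auto
      then show ?thesis using x by (simp add: V_def blinfun.zero_right)
    qed
    obtain y where 6: "y \<notin> V"
    proof -
      have "\<not> C \<subseteq> {0}"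
      proof
        assume "C \<subseteq> {0}"
        then have "C \<subseteq> cop_span {}" using cop.span_zero[of "{}"] by auto
        then show False using C(4) unfolding infinite_dimensional_def by blast
      qed
      then obtain c where "c \<in> C" "c \<noteq> 0" by blast
      moreover from this obtain y where "c y \<noteq> 0" by (metis blinfun_eqI zero_blinfun.rep_eq)
      ultimately show ?thesis using that by (auto simp: V_def)
    qed
    have "x \<in> V" using x by (simp add: V_def)
    then show ?thesis
      using factor_irreducible[OF assms(1) _ Nadj gen 1 2 3 4 5 6, of x] NB(2) by blast
  qed
  define A where "A = commutant (commutant C)"
  have Cac: "adjoint_closed C" using C(1) by (rule star_subalgebra_adjoint_closed)
  have A: "von_neumann_algebra A" unfolding A_def by (intro von_neumann_commutant adjoint_closed_commutant Cac)
  have CA: "C \<subseteq> A" unfolding A_def using C'(1) by (intro subset_double_commutant) blast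
  have AM: "A \<subseteq> M"
    using commutant_antimono[OF commutant_antimono[of C M]] C(2) BM M'(2) unfolding A_def by blast
  have comm: "commutative A"
  proof -
    have "C \<subseteq> commutant C" using C(3) C'(1) unfolding commutative_def commutant_def by blast
    then have "A \<subseteq> commutant C" unfolding A_def by (rule commutant_antimono)
    then show ?thesis unfolding commutative_def A_def by (auto simp: commutant_def)
  qed
  have NN: "normalizing A n" if n: "n \<in> ?N" for n
    unfolding normalizing_def A_def
    by (intro conjI ballI double_commutant_conjugation[OF C(1) nondeg] NB(3)[OF n] NC[OF n]
        bounded_ops_adj)
  then have Nsub: "?N \<subseteq> {n \<in> M. normalizing A n}" using NB by blast
  have "diffuse A"
    unfolding diffuse_def
  proof
    assume "\<exists>p. minimal_projection A p"
    then obtain e where e: "minimal_projection A e" by blast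
    have "commutant {n \<in> M. normalizing A n} \<subseteq> commutant M"
      using commutant_antimono[OF Nsub] gen by blast
    moreover have "finite_algebra M" using assms(2) by (simp add: type_II1_def)
    ultimately obtain F where "finite F" "A \<subseteq> cop_span F"
      using minimal_projection_finite_dimensional[OF assms(1) _ A AM comm _ e] by blast
    then show False using C(4) CA unfolding infinite_dimensional_def by blast
  qed
  moreover have "amenable A" by (rule abelian_amenable[OF A comm])
  ultimately have am: "amenable (commutant (commutant (unitary_normalizer M A)))"
    using assms(3) A AM by (auto simp: strongly_solid_def)
  have "commutant (unitary_normalizer M A) \<subseteq> commutant M"
  proof
    fix T assume T: "T \<in> commutant (unitary_normalizer M A)"
    have "T \<in> commutant ?N"
    proof (rule commutantI)
      show "T \<in> bounded_ops" using T by (rule commutant_bounded)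
      show "T (n x) = n (T x)" if "n \<in> ?N" for n x
        by (rule normalizing_commute[OF vM A AM comm T NB(2)[OF that] NN[OF that]])
    qed
    then show "T \<in> commutant M" using gen by blast
  qed
  then have "M \<subseteq> commutant (commutant (unitary_normalizer M A))"
    using commutant_antimono M'(2) by blast
  moreover have "unitary_normalizer M A \<subseteq> M" by (auto simp: unitary_normalizer_def unitaries_def)
  then have "commutant (commutant (unitary_normalizer M A)) \<subseteq> M"
    using commutant_antimono[OF commutant_antimono] M'(2) by blast
  ultimately show False using am assms(4) by simp
qed

end
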